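(* Let $K$ be a global function field, $E$ a local field of positive characteristic, and $\rho_1,\rho_2:G_K\to\mathrm{GL}_n(E)$ two semisimple (continuous) Galois representations. Let $\rho:=(\rho_1,\rho_2):G_K\to\mathrm{GL}_n(E)\times\mathrm{GL}_n(E)$, let $H:=\overline{\rho(G_K)}^{\mathrm{Zar}}\subset\mathrm{GL}_n\times\mathrm{GL}_n$ be the Zariski closure over $E$, $H^\circ$ its identity component, $\Phi:=H/H^\circ$, $S:=\{v\in\Sigma_K:\rho\text{ unramified at }v\}$, $X:=\{(g_1,g_2)\in\mathrm{GL}_n\times\mathrm{GL}_n:\chi_{\mathrm{char}}(g_1)=\chi_{\mathrm{char}}(g_2)\}$ where $\chi_{\mathrm{char}}(g)$ is the characteristic polynomial of $g$, and $\Sigma_X:=\{v\in S:\rho(\mathrm{Frob}_v)\in X\}$. Suppose $H^\circ\subset X$. Then: (i) there is a finite extension $L/K$ such that $\rho_1|_{G_L}\cong\rho_2|_{G_L}$; (ii) if moreover $\rho_1$ is absolutely irreducible and $\overline{\rho_1(G_K)}^{\mathrm{Zar}}\subset\mathrm{GL}_n$ is connected, then there is a finite-order character $\chi:G_K\to E^*$ such that $\rho_2\cong\rho_1\otimes\chi$.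
   Context: $G_K=\mathrm{Gal}(\bar K/K)$, $\Sigma_K$ is the set of places of $K$, and $\mathrm{Frob}_v$ is a Frobenius element at an unramified place $v$. *)

theory Defs
  imports "HOL-Analysis.Analysis" "HOL-Algebra.Algebraic_Closure_Type" "HOL-Algebra.Generated_Fields"
begin

unbundle no Formal_Power_Series.fps_syntax

section \<open>Fields\<close>

text \<open>
  A local field is a non-discrete locally compact Hausdorff topological field. With
  \<open>CHAR('e) > 0\<close> these are the fields of Laurent series over finite fields.
  The class \<open>perfect_space\<close> means that no point is isolated; it does not refer to perfect fields.
\<close>

class local_field = Fields.field + t2_space + perfect_space +
    topological_group_add + topological_semigroup_mult +
  assumes tendsto_inverse_nhds: "a \<noteq> 0 \<Longrightarrow> (inverse \<longlongrightarrow> inverse a) (nhds a)"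
    and compact_neighbourhood: "\<exists>U C. open U \<and> a \<in> U \<and> U \<subseteq> C \<and> compact C"

text \<open>A global function field is a finite extension of \<open>F(t)\<close> with \<open>F\<close> a finite field.\<close>

definition global_function_field :: "'k::field itself \<Rightarrow> bool" where
  "global_function_field _ \<longleftrightarrow>
    (let R = (ring_of_type_algebra :: 'k ring) in
      \<exists>F t. subfield F R \<and> finite F \<and> ring.transcendental R F t \<and>
        ring.finite_dimension R (generate_field R (insert t F)) UNIV)"


section \<open>The absolute Galois group\<close>

text \<open>
  \<open>K\<close> is the type \<open>'k\<close>, embedded in its algebraic closure by \<open>to_ac\<close>. The group
  \<open>G\<^sub>K\<close> is the group of automorphisms of the algebraic closure over \<open>K\<close>; restricting to
  the separable closure identifies it with the Galois group of the latter.
\<close>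

definition absolute_galois_group :: "('k::field alg_closure \<Rightarrow> 'k alg_closure) monoid" where
  "absolute_galois_group =
    \<lparr> carrier = {\<sigma> \<in> ring_iso ring_of_type_algebra ring_of_type_algebra. \<forall>a. \<sigma> (to_ac a) = to_ac a},
      monoid.mult = (\<circ>), one = id \<rparr>"

text \<open>Finite extensions of \<open>K\<close> are taken inside the fixed algebraic closure.\<close>

definition finite_extension :: "'k::field alg_closure set \<Rightarrow> bool" where
  "finite_extension L \<longleftrightarrow>
    subfield L ring_of_type_algebra \<and> range to_ac \<subseteq> L \<and>
    ring.finite_dimension ring_of_type_algebra (range to_ac) L"

definition galois_subgroup ::
    "'k::field alg_closure set \<Rightarrow> ('k alg_closure \<Rightarrow> 'k alg_closure) set" where
  "galois_subgroup L = {\<sigma> \<in> carrier absolute_galois_group. \<forall>x\<in>L. \<sigma> x = x}"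

text \<open>The Krull topology: the left cosets of the subgroups \<open>G\<^sub>L\<close> form a basis.\<close>

definition krull_topology :: "('k::field alg_closure \<Rightarrow> 'k alg_closure) topology" where
  "krull_topology = topology_generated_by
    {(\<lambda>\<tau>. \<sigma> \<circ> \<tau>) ` galois_subgroup L | \<sigma> L.
       \<sigma> \<in> carrier absolute_galois_group \<and> finite_extension L}"


section \<open>Galois representations\<close>

definition general_linear_group :: "('a::field ^'n ^'n) monoid" where
  "general_linear_group = \<lparr> carrier = {A. invertible A}, monoid.mult = (**), one = mat 1 \<rparr>"

definition galois_representation ::
    "(('k::field alg_closure \<Rightarrow> 'k alg_closure) \<Rightarrow> 'e::local_field ^'n ^'n) \<Rightarrow> bool" where
  "galois_representation \<rho> \<longleftrightarrow>
    \<rho> \<in> hom absolute_galois_group general_linear_group \<and>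
    continuous_map krull_topology (top_of_set (carrier general_linear_group)) \<rho>"

definition galois_character ::
    "(('k::field alg_closure \<Rightarrow> 'k alg_closure) \<Rightarrow> 'e::local_field) \<Rightarrow> bool" where
  "galois_character \<psi> \<longleftrightarrow>
    \<psi> \<in> hom absolute_galois_group (units_of ring_of_type_algebra) \<and>
    continuous_map krull_topology (top_of_set (- {0})) \<psi>"

definition finite_order_character ::
    "(('k::field alg_closure \<Rightarrow> 'k alg_closure) \<Rightarrow> 'e::local_field) \<Rightarrow> bool" where
  "finite_order_character \<psi> \<longleftrightarrow> galois_character \<psi> \<and>
    (\<exists>m>0. \<forall>\<sigma>\<in>carrier absolute_galois_group. \<psi> \<sigma> ^ m = 1)"

definition twist :: "('g \<Rightarrow> 'a::field ^'n ^'n) \<Rightarrow> ('g \<Rightarrow> 'a) \<Rightarrow> 'g \<Rightarrow> 'a ^'n ^'n" where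
  "twist \<rho> \<psi> = (\<lambda>\<sigma>. \<chi> i j. \<psi> \<sigma> * \<rho> \<sigma> $ i $ j)"

definition base_change :: "'a::field ^'n ^'n \<Rightarrow> 'a alg_closure ^'n ^'n" where
  "base_change = map_matrix to_ac"

text \<open>
  In the following definitions \<open>G\<close> is the set of elements of the group which acts through \<open>\<rho>\<close>.
\<close>

definition subrepresentation ::
    "'g set \<Rightarrow> ('g \<Rightarrow> 'a::field ^'n ^'n) \<Rightarrow> ('a ^'n) set \<Rightarrow> bool" where
  "subrepresentation G \<rho> W \<longleftrightarrow> vec.subspace W \<and> (\<forall>\<sigma>\<in>G. \<forall>w\<in>W. \<rho> \<sigma> *v w \<in> W)"

definition irreducible_subrepresentation ::
    "'g set \<Rightarrow> ('g \<Rightarrow> 'a::field ^'n ^'n) \<Rightarrow> ('a ^'n) set \<Rightarrow> bool" where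
  "irreducible_subrepresentation G \<rho> W \<longleftrightarrow> subrepresentation G \<rho> W \<and> W \<noteq> {0} \<and>
    (\<forall>U. subrepresentation G \<rho> U \<and> U \<subseteq> W \<longrightarrow> U = {0} \<or> U = W)"

definition semisimple_representation :: "'g set \<Rightarrow> ('g \<Rightarrow> 'a::field ^'n ^'n) \<Rightarrow> bool" where
  "semisimple_representation G \<rho> \<longleftrightarrow>
    (\<exists>(m::nat) W. (\<forall>i<m. irreducible_subrepresentation G \<rho> (W i)) \<and>
      (\<forall>v. \<exists>!w. w \<in> (\<Pi>\<^sub>E i\<in>{..<m}. W i) \<and> v = (\<Sum>i<m. w i)))"

definition absolutely_irreducible :: "'g set \<Rightarrow> ('g \<Rightarrow> 'a::field ^'n ^'n) \<Rightarrow> bool" where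
  "absolutely_irreducible G \<rho> \<longleftrightarrow>
    irreducible_subrepresentation G (\<lambda>\<sigma>. base_change (\<rho> \<sigma>)) UNIV"

definition isomorphic_representations ::
    "'g set \<Rightarrow> ('g \<Rightarrow> 'a::field ^'n ^'n) \<Rightarrow> ('g \<Rightarrow> 'a ^'n ^'n) \<Rightarrow> bool" where
  "isomorphic_representations G \<rho> \<rho>' \<longleftrightarrow>
    (\<exists>P. invertible P \<and> (\<forall>\<sigma>\<in>G. P ** \<rho> \<sigma> = \<rho>' \<sigma> ** P))"


section \<open>Zariski topology over \<open>E\<close>\<close>

text \<open>
  A variety over \<open>E\<close> is represented by its points over the algebraic closure of \<open>E\<close>, with closed
  sets the zero sets of polynomials with coefficients in \<open>E\<close>. Sending a geometric point to
  the closed point below it identifies the closed sets with those of the underlying scheme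
  over \<open>E\<close>, so closures and connected components are those of the scheme.
  For \<open>GL\<^sub>n\<close>, an open subset of the space of matrices, polynomials in the matrix entries
  suffice: the powers of the determinant can be cleared from the denominators.
\<close>

inductive_set polynomial_functions ::
    "('x \<Rightarrow> 'e::field alg_closure) set \<Rightarrow> ('x \<Rightarrow> 'e alg_closure) set"
  for coords :: "('x \<Rightarrow> 'e alg_closure) set" where
  const: "(\<lambda>_. to_ac c) \<in> polynomial_functions coords"
| coord: "f \<in> coords \<Longrightarrow> f \<in> polynomial_functions coords"
| add: "f \<in> polynomial_functions coords \<Longrightarrow> g \<in> polynomial_functions coords \<Longrightarrow>
    (\<lambda>x. f x + g x) \<in> polynomial_functions coords"
| mult: "f \<in> polynomial_functions coords \<Longrightarrow> g \<in> polynomial_functions coords \<Longrightarrow>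
    (\<lambda>x. f x * g x) \<in> polynomial_functions coords"

definition zariski_topology ::
    "('x \<Rightarrow> 'e::field alg_closure) set \<Rightarrow> 'x set \<Rightarrow> 'x topology" where
  "zariski_topology coords V =
    topology_generated_by {{x \<in> V. f x \<noteq> 0} | f. f \<in> polynomial_functions coords}"

definition zariski_GL :: "('e::field alg_closure ^'n ^'n) topology" where
  "zariski_GL = zariski_topology {\<lambda>g. g $ i $ j | i j. True} {g. invertible g}"

definition zariski_GL_GL ::
    "(('e::field alg_closure ^'n ^'n) \<times> ('e alg_closure ^'n ^'n)) topology" where
  "zariski_GL_GL = zariski_topology
    ({\<lambda>g. fst g $ i $ j | i j. True} \<union> {\<lambda>g. snd g $ i $ j | i j. True})
    ({g. invertible g} \<times> {g. invertible g})"

definition identity_component ::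
    "(('e::field alg_closure ^'n ^'n) \<times> ('e alg_closure ^'n ^'n)) set \<Rightarrow>
     (('e alg_closure ^'n ^'n) \<times> ('e alg_closure ^'n ^'n)) set" where
  "identity_component H =
    connected_component_of_set (subtopology zariski_GL_GL H) (mat 1, mat 1)"

definition characteristic_polynomial :: "'a::comm_ring_1 ^'n ^'n \<Rightarrow> 'a poly" where
  "characteristic_polynomial A = det (mat [:0, 1:] - map_matrix (\<lambda>a. [:a:]) A)"

definition equal_charpoly_locus ::
    "(('e::field alg_closure ^'n ^'n) \<times> ('e alg_closure ^'n ^'n)) set" where
  "equal_charpoly_locus = {(g\<^sub>1, g\<^sub>2). invertible g\<^sub>1 \<and> invertible g\<^sub>2 \<and>
    characteristic_polynomial g\<^sub>1 = characteristic_polynomial g\<^sub>2}"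

definition monodromy_group ::
    "'g set \<Rightarrow> ('g \<Rightarrow> 'e::field ^'n ^'n) \<Rightarrow> ('e alg_closure ^'n ^'n) set" where
  "monodromy_group G \<rho> = zariski_GL closure_of ((\<lambda>\<sigma>. base_change (\<rho> \<sigma>)) ` G)"

definition joint_monodromy_group ::
    "'g set \<Rightarrow> ('g \<Rightarrow> 'e::field ^'n ^'n) \<Rightarrow> ('g \<Rightarrow> 'e ^'n ^'n) \<Rightarrow>
     (('e alg_closure ^'n ^'n) \<times> ('e alg_closure ^'n ^'n)) set" where
  "joint_monodromy_group G \<rho>\<^sub>1 \<rho>\<^sub>2 =
    zariski_GL_GL closure_of ((\<lambda>\<sigma>. (base_change (\<rho>\<^sub>1 \<sigma>), base_change (\<rho>\<^sub>2 \<sigma>))) ` G)"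

end

theory Submission
  imports Defs "HOL-Library.Function_Algebras"
begin

text \<open>
  The Zariski topology is Noetherian, so \<open>H\<degree>\<close> is open and closed in \<open>H\<close> and its preimage \<open>N\<close> in
  \<open>G\<^sub>K\<close> is a normal subgroup of finite index. It is open, because polynomials in the entries of a
  continuous representation are continuous, so it contains some \<open>G\<^sub>L\<close>. By Clifford's theorem
  \<open>\<rho>\<^sub>1\<close> and \<open>\<rho>\<^sub>2\<close> remain semisimple on \<open>N\<close>, where they have equal characteristic polynomials.

  Isomorphism on \<open>N\<close> is the Brauer--Nesbitt theorem. Traces do not suffice in positive
  characteristic. Instead, \<open>det (1 - x)\<close> agrees in the two representations for every element \<open>x\<close>
  of the group algebra, not only for multiples of group elements, so idempotents of the algebra
  have equal ranks in both. This is used to enlarge the rank of any intertwiner that is not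
  injective.

  If \<open>P\<close> intertwines the restrictions to \<open>N\<close>, then
  \<open>M = P\<inverse> \<rho>\<^sub>2(\<sigma>) P \<rho>\<^sub>1(\<sigma>)\<inverse>\<close> commutes with \<open>\<rho>\<^sub>1(N)\<close>, hence with \<open>\<rho>\<^sub>1(G\<^sub>K)\<close> by
  connectedness, and is a scalar \<open>\<chi>(\<sigma>)\<close> by Schur's lemma.
\<close>

section \<open>The Hilbert basis theorem and Noetherian Zariski topologies\<close>

text \<open>Closed sets are cut out by polynomials with coefficients in \<open>E\<close>, so the
  continuous maps at hand are translations and conjugations by \<open>E\<close>-rational points. The
  component argument is therefore run with the elements of \<open>G_K\<close> acting on
  \<open>H\<close> through the representations. A trace sees the rank of an idempotent
  \<open>e\<close> only modulo the characteristic, while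
  \<open>det (1 - x e) = (1 - x) ^ rank e\<close>, as a polynomial in \<open>x\<close>, sees the
  rank itself. The obstacle is that equal characteristic polynomials are given for group elements
  only and have to be carried over to sums. This rests on
  \<open>1 - a - b = (1 - a) (1 - (1 - a)^-1 b)\<close>, which makes sense once every matrix is
  multiplied by an indeterminate \<open>t\<close> and determinants are compared modulo powers of
  \<open>t\<close>. The group algebra is kept as the additive span of scaled pairs of matrices, one
  component for each representation, so that a single element acts on both spaces. All pairs of
  matrices form a semisimple left module over it, and complements in that module supply the
  idempotents in place of the structure theory of semisimple algebras.\<close>

definition subring_set :: "'a::comm_ring_1 set \<Rightarrow> bool" where
  "subring_set R \<longleftrightarrow> 1 \<in> R \<and> (\<forall>x\<in>R. \<forall>y\<in>R. x - y \<in> R \<and> x * y \<in> R)"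

definition ideal_set :: "'a::comm_ring_1 set \<Rightarrow> 'a set \<Rightarrow> bool" where
  "ideal_set R I \<longleftrightarrow> I \<subseteq> R \<and> 0 \<in> I \<and> (\<forall>x\<in>I. \<forall>y\<in>I. x + y \<in> I) \<and> (\<forall>r\<in>R. \<forall>x\<in>I. r * x \<in> I)"

definition noetherian_set :: "'a::comm_ring_1 set \<Rightarrow> bool" where
  "noetherian_set R \<longleftrightarrow>
    (\<forall>I. (\<forall>k::nat. ideal_set R (I k)) \<and> mono I \<longrightarrow> (\<exists>m. \<forall>k\<ge>m. I k = I m))"

text \<open>Values of polynomials in \<open>f\<close> of degree below \<open>d\<close> with
  coefficients in \<open>R\<close>. Since \<open>f\<close> may satisfy relations over
  \<open>R\<close>, an element can have several such expressions; \<open>leading_coeffs\<close>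
  collects the coefficients of \<open>f ^ d\<close> from all of them.\<close>

primrec poly_below :: "'a::comm_ring_1 set \<Rightarrow> 'a \<Rightarrow> nat \<Rightarrow> 'a set" where
  "poly_below R f 0 = {0}"
| "poly_below R f (Suc d) = {a * f ^ d + g | a g. a \<in> R \<and> g \<in> poly_below R f d}"

definition leading_coeffs :: "'a::comm_ring_1 set \<Rightarrow> 'a \<Rightarrow> nat \<Rightarrow> 'a set \<Rightarrow> 'a set" where
  "leading_coeffs R f d I = {a \<in> R. \<exists>g\<in>poly_below R f d. a * f ^ d + g \<in> I}"

lemma subring_setD:
  assumes "subring_set R"
  shows "1 \<in> R" "0 \<in> R" "\<And>x y. x \<in> R \<Longrightarrow> y \<in> R \<Longrightarrow> x - y \<in> R"
    "\<And>x. x \<in> R \<Longrightarrow> - x \<in> R" "\<And>x y. x \<in> R \<Longrightarrow> y \<in> R \<Longrightarrow> x + y \<in> R"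
    "\<And>x y. x \<in> R \<Longrightarrow> y \<in> R \<Longrightarrow> x * y \<in> R"
proof -
  show 1: "1 \<in> R" and d: "\<And>x y. x \<in> R \<Longrightarrow> y \<in> R \<Longrightarrow> x - y \<in> R"
    and "\<And>x y. x \<in> R \<Longrightarrow> y \<in> R \<Longrightarrow> x * y \<in> R"
    using assms by (auto simp: subring_set_def)
  show 0: "0 \<in> R" using d[OF 1 1] by simp
  show m: "- x \<in> R" if "x \<in> R" for x using d[OF 0 that] by simp
  show "x + y \<in> R" if "x \<in> R" "y \<in> R" for x y using d[OF that(1) m[OF that(2)]] by simp
qed

lemma poly_below_add:
  assumes R: "subring_set R"
  shows "x \<in> poly_below R f d \<Longrightarrow> y \<in> poly_below R f d \<Longrightarrow> x + y \<in> poly_below R f d"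
proof (induction d arbitrary: x y)
  case (Suc d)
  obtain a g where x: "x = a * f ^ d + g" "a \<in> R" "g \<in> poly_below R f d" using Suc.prems(1) by auto
  obtain b h where y: "y = b * f ^ d + h" "b \<in> R" "h \<in> poly_below R f d" using Suc.prems(2) by auto
  have "x + y = (a + b) * f ^ d + (g + h)" by (simp add: x y algebra_simps)
  then show ?case using Suc.IH[OF x(3) y(3)] subring_setD(5)[OF R x(2) y(2)] by auto
qed simp

lemma poly_below_scale:
  assumes R: "subring_set R" and r: "r \<in> R"
  shows "x \<in> poly_below R f d \<Longrightarrow> r * x \<in> poly_below R f d"
proof (induction d arbitrary: x)
  case (Suc d)
  obtain a g where x: "x = a * f ^ d + g" "a \<in> R" "g \<in> poly_below R f d" using Suc.prems(1) by auto
  have "r * x = (r * a) * f ^ d + (r * g)" by (simp add: x algebra_simps)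
  then show ?case using Suc.IH[OF x(3)] subring_setD(6)[OF R r x(2)] by auto
qed simp

lemma poly_below_shift:
  assumes R: "subring_set R"
  shows "x \<in> poly_below R f d \<Longrightarrow> f * x \<in> poly_below R f (Suc d)"
proof (induction d arbitrary: x)
  case 0
  then show ?case using subring_setD(2)[OF R] by auto
next
  case (Suc d)
  obtain a g where x: "x = a * f ^ d + g" "a \<in> R" "g \<in> poly_below R f d" using Suc.prems(1) by auto
  have "f * x = a * f ^ Suc d + f * g" by (simp add: x algebra_simps)
  then show ?case using Suc.IH[OF x(3)] x(2) poly_below.simps(2)[of R f "Suc d"] by blast
qed

lemma poly_below_mono:
  assumes R: "subring_set R" and "d \<le> e"
  shows "poly_below R f d \<subseteq> poly_below R f e"
  using \<open>d \<le> e\<close>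
proof (induction e rule: dec_induct)
  case (step n)
  have "x \<in> poly_below R f (Suc n)" if "x \<in> poly_below R f n" for x
  proof -
    have "x = 0 * f ^ n + x" by simp
    then show ?thesis using that subring_setD(2)[OF R] unfolding poly_below.simps by blast
  qed
  then show ?case using step.IH by blast
qed simp

lemma leading_coeffs_ideal:
  assumes R: "subring_set R" and I: "0 \<in> I" "\<And>x y. x \<in> I \<Longrightarrow> y \<in> I \<Longrightarrow> x + y \<in> I"
    "\<And>r x. r \<in> R \<Longrightarrow> x \<in> I \<Longrightarrow> r * x \<in> I"
  shows "ideal_set R (leading_coeffs R f d I)"
proof -
  have z: "0 \<in> poly_below R f d" using poly_below_mono[OF R, of 0 d f] by auto
  have 0: "0 \<in> leading_coeffs R f d I"
    using I(1) z subring_setD(2)[OF R] by (auto simp: leading_coeffs_def intro!: bexI[of _ 0])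
  have add: "a + b \<in> leading_coeffs R f d I"
    if "a \<in> leading_coeffs R f d I" "b \<in> leading_coeffs R f d I" for a b
  proof -
    from that(1) obtain g where g: "a \<in> R" "g \<in> poly_below R f d" "a * f ^ d + g \<in> I"
      by (auto simp: leading_coeffs_def)
    from that(2) obtain h where h: "b \<in> R" "h \<in> poly_below R f d" "b * f ^ d + h \<in> I"
      by (auto simp: leading_coeffs_def)
    have "(a + b) * f ^ d + (g + h) \<in> I" using I(2)[OF g(3) h(3)] by (simp add: algebra_simps)
    then show ?thesis
      using poly_below_add[OF R g(2) h(2)] subring_setD(5)[OF R g(1) h(1)]
      by (auto simp: leading_coeffs_def)
  qed
  have mul: "r * a \<in> leading_coeffs R f d I" if "r \<in> R" "a \<in> leading_coeffs R f d I" for r a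
  proof -
    from that(2) obtain g where g: "a \<in> R" "g \<in> poly_below R f d" "a * f ^ d + g \<in> I"
      by (auto simp: leading_coeffs_def)
    have "(r * a) * f ^ d + r * g \<in> I" using I(3)[OF that(1) g(3)] by (simp add: algebra_simps)
    then show ?thesis
      using poly_below_scale[OF R that(1) g(2)] subring_setD(6)[OF R that(1) g(1)]
      by (auto simp: leading_coeffs_def)
  qed
  show ?thesis unfolding ideal_set_def
    using 0 add mul by (auto simp: leading_coeffs_def)
qed

text \<open>The coefficient ideals \<open>L d k\<close> grow with the degree \<open>d\<close> and
  with the chain index \<open>k\<close>. Once the diagonal \<open>L k k\<close> is constant, all
  high degrees are settled, and the finitely many low degrees stabilize one by one. Equal
  coefficient ideals then force equal ideals, by cancelling top terms.\<close>

lemma hilbert_basis_chain: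
  assumes R: "subring_set R" and N: "noetherian_set R" and "mono I"
    and below: "\<And>k x. x \<in> I k \<Longrightarrow> \<exists>d. x \<in> poly_below R f d"
    and I0: "\<And>k. 0 \<in> I k" and Iadd: "\<And>k x y. x \<in> I k \<Longrightarrow> y \<in> I k \<Longrightarrow> x + y \<in> I k"
    and Imul: "\<And>k r x. r \<in> R \<Longrightarrow> x \<in> I k \<Longrightarrow> r * x \<in> I k"
    and If: "\<And>k x. x \<in> I k \<Longrightarrow> f * x \<in> I k"
  shows "\<exists>m::nat. \<forall>k\<ge>m. I k = I m"
proof -
  define L where "L d k = leading_coeffs R f d (I k)" for d k
  have Lid: "ideal_set R (L d k)" for d k
    unfolding L_def by (rule leading_coeffs_ideal[OF R I0 Iadd Imul])
  have Imono: "I k \<subseteq> I l" if "k \<le> l" for k l using monoD[OF \<open>mono I\<close> that] .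
  have Lk: "L d k \<subseteq> L d l" if "k \<le> l" for d k l
    using Imono[OF that] by (auto simp: L_def leading_coeffs_def)
  have Ld1: "L d k \<subseteq> L (Suc d) k" for d k
  proof
    fix a assume "a \<in> L d k"
    then obtain g where g: "a \<in> R" "g \<in> poly_below R f d" "a * f ^ d + g \<in> I k"
      by (auto simp: L_def leading_coeffs_def)
    have "a * f ^ Suc d + f * g \<in> I k" using If[OF g(3)] by (simp add: algebra_simps)
    then show "a \<in> L (Suc d) k" using g(1) poly_below_shift[OF R g(2)]
      unfolding L_def leading_coeffs_def by blast
  qed
  have Ld: "L d k \<subseteq> L e k" if "d \<le> e" for d e k
    by (rule lift_Suc_mono_le[of "\<lambda>d. L d k", OF Ld1 that])
  have stab: "\<exists>m. \<forall>k\<ge>m. J k = J m" if "\<And>k. ideal_set R (J k)" "mono J" for J :: "nat \<Rightarrow> 'a set"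
    using N that unfolding noetherian_set_def by blast
  have "\<exists>m. \<forall>k\<ge>m. L k k = L m m"
    by (rule stab[OF Lid]) (auto intro!: monoI dest: subsetD[OF Lk] subsetD[OF Ld])
  then obtain m where m: "\<And>k. k \<ge> m \<Longrightarrow> L k k = L m m" by blast
  have "\<exists>m. \<forall>k\<ge>m. L d k = L d m" for d
    by (rule stab) (auto intro!: monoI Lid Lk)
  then obtain md where md: "\<And>d k. k \<ge> md d \<Longrightarrow> L d k = L d (md d)" by metis
  \<comment> \<open>The sum serves as a common upper bound of \<open>m\<close> and of all
    \<open>md d\<close> with \<open>d < m\<close>.\<close>
  define M where "M = m + (\<Sum>d<m. md d)"
  have eq: "L d k \<subseteq> L d M" if "k \<ge> M" for d k
  proof (cases "d < m")
    case True
    then have "md d \<le> (\<Sum>d<m. md d)" by (intro member_le_sum) auto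
    then have "md d \<le> M" "md d \<le> k" using \<open>k \<ge> M\<close> by (auto simp: M_def)
    then show ?thesis using md[of d M] md[of d k] by simp
  next
    case False
    have "L d k \<subseteq> L (max d k) (max d k)"
      using Ld[of d "max d k" k] Lk[of k "max d k" "max d k"] by simp
    also have "\<dots> = L m m" by (rule m) (use False in simp)
    also have "\<dots> \<subseteq> L d M" using Ld[of m d m] Lk[of m M d] False by (auto simp: M_def)
    finally show ?thesis .
  qed
  \<comment> \<open>Induction on the degree bound: an element of \<open>I M\<close> with the same
    top coefficient is subtracted, and the bound drops by one.\<close>
  have sub: "x \<in> I M" if "k \<ge> M" "x \<in> I k" "x \<in> poly_below R f d" for x k d
    using that
  proof (induction d arbitrary: x)
    case 0
    then show ?case using I0 by simp
  next
    case (Suc d)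
    obtain a g where x: "x = a * f ^ d + g" "a \<in> R" "g \<in> poly_below R f d"
      using Suc.prems(3) by auto
    have "a \<in> L d k" using x Suc.prems(2) by (auto simp: L_def leading_coeffs_def)
    then have "a \<in> L d M" using eq[OF Suc.prems(1)] by blast
    then obtain h where h: "h \<in> poly_below R f d" "a * f ^ d + h \<in> I M"
      by (auto simp: L_def leading_coeffs_def)
    have n1: "- 1 \<in> R" by (rule subring_setD(4)[OF R subring_setD(1)[OF R]])
    have "-1 * (a * f ^ d + h) \<in> I k"
      by (rule Imul[OF n1 subsetD[OF Imono[OF Suc.prems(1)] h(2)]])
    from Iadd[OF Suc.prems(2) this] have k: "g + -1 * h \<in> I k" by (simp add: x algebra_simps)
    have "g + -1 * h \<in> poly_below R f d"
      by (rule poly_below_add[OF R x(3) poly_below_scale[OF R n1 h(1)]])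
    from Suc.IH[OF Suc.prems(1) k this] have "g + -1 * h \<in> I M" .
    from Iadd[OF this h(2)] show ?case by (simp add: x algebra_simps)
  qed
  have "I k = I M" if "k \<ge> M" for k
    using sub[OF that] below[of _ k] Imono[OF that] by blast
  then show ?thesis by blast
qed

lemma polynomial_functions_subring: "subring_set (polynomial_functions coords)"
proof -
  let ?P = "polynomial_functions coords"
  have one: "1 \<in> ?P" using polynomial_functions.const[of 1 coords]
    by (simp add: one_fun_def)
  have m1: "- f \<in> ?P" if "f \<in> ?P" for f
    using polynomial_functions.mult[OF polynomial_functions.const[of "-1" coords] that]
    by (simp add: fun_Compl_def)
  have "f - g \<in> ?P" if "f \<in> ?P" "g \<in> ?P" for f g
    using polynomial_functions.add[OF that(1) m1[OF that(2)]] by (simp add: fun_diff_def)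
  moreover have "f * g \<in> ?P" if "f \<in> ?P" "g \<in> ?P" for f g
    using polynomial_functions.mult[OF that] by (simp add: times_fun_def)
  ultimately show ?thesis using one by (auto simp: subring_set_def)
qed

lemma polynomial_functions_mono:
  assumes "coords \<subseteq> coords'"
  shows "polynomial_functions coords \<subseteq> polynomial_functions coords'"
proof
  fix f assume "f \<in> polynomial_functions coords"
  then show "f \<in> polynomial_functions coords'"
    by induction (use assms in \<open>auto intro: polynomial_functions.intros\<close>)
qed

lemma poly_below_mult:
  assumes R: "subring_set R" and y: "\<exists>e. y \<in> poly_below R f e" and x: "x \<in> poly_below R f d"
  shows "\<exists>e. x * y \<in> poly_below R f e"
  using x
proof (induction d arbitrary: x)
  case 0
  then show ?case by (auto intro: exI[of _ 0])
next
  case (Suc d)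
  obtain a g where x: "x = a * f ^ d + g" "a \<in> R" "g \<in> poly_below R f d"
    using Suc.prems by auto
  obtain e1 where e1: "g * y \<in> poly_below R f e1" using Suc.IH[OF x(3)] by blast
  have "\<exists>e. f ^ d * y \<in> poly_below R f e" for d
  proof (induction d)
    case (Suc d)
    then obtain e where "f ^ d * y \<in> poly_below R f e" by blast
    from poly_below_shift[OF R this] show ?case by (metis mult.assoc power_Suc)
  qed (use y in simp)
  then obtain e2 where "f ^ d * y \<in> poly_below R f e2" by blast
  then have e2: "a * (f ^ d * y) \<in> poly_below R f e2" by (rule poly_below_scale[OF R x(2)])
  have "a * (f ^ d * y) + g * y \<in> poly_below R f (max e1 e2)"
    using poly_below_add[OF R] subsetD[OF poly_below_mono[OF R, of e2 "max e1 e2"] e2]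
      subsetD[OF poly_below_mono[OF R, of e1 "max e1 e2"] e1] by simp
  then show ?case by (auto simp: x algebra_simps)
qed

text \<open>Places the polynomial functions in one more coordinate \<open>f\<close> inside
  \<open>R[f]\<close>, the form in which the chain argument for ideals takes its elements.\<close>

lemma polynomial_functions_insert:
  assumes "g \<in> polynomial_functions (insert f coords)"
  shows "\<exists>d. g \<in> poly_below (polynomial_functions coords) f d"
proof -
  let ?P = "polynomial_functions coords"
  note R = polynomial_functions_subring[of coords]
  have base: "\<exists>d. g \<in> poly_below ?P f d" if "g \<in> ?P" for g
    using that by (intro exI[of _ 1]) (auto intro!: exI[of _ g])
  from assms show ?thesis
  proof induction
    case (const c)
    then show ?case by (intro base polynomial_functions.const)
  next
    case (coord g)
    show ?case
    proof (cases "g = f")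
      case True
      have "f = 1 * f ^ 1 + 0" "0 \<in> poly_below ?P f 1"
        using poly_below_mono[OF R, of 0 1 f] by auto
      then show ?thesis using True subring_setD(1)[OF R] poly_below.simps(2)[of ?P f 1] by blast
    next
      case False
      with coord show ?thesis by (intro base polynomial_functions.coord) auto
    qed
  next
    case (add g h)
    then obtain d e where "g \<in> poly_below ?P f d" "h \<in> poly_below ?P f e" by blast
    then have "g \<in> poly_below ?P f (max d e)" "h \<in> poly_below ?P f (max d e)"
      using poly_below_mono[OF R, of d "max d e" f] poly_below_mono[OF R, of e "max d e" f] by auto
    from poly_below_add[OF R this] show ?case by (auto simp: plus_fun_def)
  next
    case (mult g h)
    then obtain d where "g \<in> poly_below ?P f d" by blast
    from poly_below_mult[OF R mult.IH(2) this] show ?case by (simp add: times_fun_def)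
  qed
qed

text \<open>Without coordinates the ring is the image of the field \<open>'e\<close>, so an ideal
  with a nonzero member is the whole ring.\<close>

lemma noetherian_constants: "noetherian_set (polynomial_functions {})"
proof -
  have cases: "\<exists>c. f = (\<lambda>_. to_ac c)" if "f \<in> polynomial_functions {}"
    for f :: "'x \<Rightarrow> 'e::field alg_closure"
    using that
  proof induction
    case (add f g)
    then obtain c d where "f = (\<lambda>_. to_ac c)" "g = (\<lambda>_. to_ac d)" by blast
    then show ?case by (intro exI[of _ "c + d"]) (simp add: )
  next
    case (mult f g)
    then obtain c d where "f = (\<lambda>_. to_ac c)" "g = (\<lambda>_. to_ac d)" by blast
    then show ?case by (intro exI[of _ "c * d"]) (simp add: )
  qed auto
  show ?thesis unfolding noetherian_set_def
  proof (intro allI impI, elim conjE)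
    fix I :: "nat \<Rightarrow> ('x \<Rightarrow> 'e::field alg_closure) set"
    assume I: "\<forall>k. ideal_set (polynomial_functions {}) (I k)" and "mono I"
    show "\<exists>m. \<forall>k\<ge>m. I k = I m"
    proof (cases "\<forall>k. I k \<subseteq> {0}")
      case True
      then have "I k = {0}" for k using I by (auto simp: ideal_set_def)
      then show ?thesis by simp
    next
      case False
      then obtain m f where f: "f \<in> I m" "f \<noteq> 0" by blast
      then have "f \<in> polynomial_functions {}" using I by (auto simp: ideal_set_def)
      then obtain c where c: "f = (\<lambda>_. to_ac c)" using cases by blast
      have "c \<noteq> 0" using f(2) c by (auto simp: zero_fun_def)
      have full: "I k = polynomial_functions {}" if "k \<ge> m" for k
      proof
        show "I k \<subseteq> polynomial_functions {}" using I by (auto simp: ideal_set_def)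
        show "polynomial_functions {} \<subseteq> I k"
        proof
          fix g :: "'x \<Rightarrow> 'e alg_closure" assume g: "g \<in> polynomial_functions {}"
          have fk: "f \<in> I k" using monoD[OF \<open>mono I\<close> that] f(1) by blast
          have "(\<lambda>x. g x * to_ac (inverse c)) \<in> polynomial_functions {}"
            by (intro polynomial_functions.mult g polynomial_functions.const)
          then have "(\<lambda>x. g x * to_ac (inverse c)) * f \<in> I k"
            using I fk by (auto simp: ideal_set_def)
          also have "(\<lambda>x. g x * to_ac (inverse c)) * f = g"
            using \<open>c \<noteq> 0\<close> by (auto simp: c times_fun_def fun_eq_iff simp flip: to_ac_mult)
          finally show "g \<in> I k" .
        qed
      qed
      then have "\<forall>k\<ge>m. I k = I m" using full[of m] by simp
      then show ?thesis by blast
    qed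
  qed
qed

theorem noetherian_polynomial_functions:
  "finite coords \<Longrightarrow> noetherian_set (polynomial_functions coords)"
proof (induction rule: finite_induct)
  case empty
  show ?case by (rule noetherian_constants)
next
  case (insert f coords)
  show ?case unfolding noetherian_set_def
  proof (intro allI impI, elim conjE)
    fix I assume I: "\<forall>k::nat. ideal_set (polynomial_functions (insert f coords)) (I k)" and "mono I"
    have sub: "polynomial_functions coords \<subseteq> polynomial_functions (insert f coords)"
      by (rule polynomial_functions_mono) auto
    have f: "f \<in> polynomial_functions (insert f coords)" by (rule polynomial_functions.coord) simp
    show "\<exists>m. \<forall>k\<ge>m. I k = I m"
      by (rule hilbert_basis_chain[OF polynomial_functions_subring insert.IH \<open>mono I\<close>
            polynomial_functions_insert])
        (use I f sub in \<open>unfold ideal_set_def, blast+\<close>)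
  qed
qed

section \<open>Noetherian spaces and the Zariski topology\<close>

definition noetherian_space :: "'x topology \<Rightarrow> bool" where
  "noetherian_space T \<longleftrightarrow> (\<forall>\<C>. \<C> \<noteq> {} \<and> (\<forall>C\<in>\<C>. closedin T C) \<longrightarrow>
    (\<exists>D\<in>\<C>. \<forall>C\<in>\<C>. C \<subseteq> D \<longrightarrow> C = D))"

lemma noetherian_space_minimal:
  assumes "noetherian_space T" "C0 \<in> \<C>" "\<And>C. C \<in> \<C> \<Longrightarrow> closedin T C"
  obtains D where "D \<in> \<C>" "\<And>C. C \<in> \<C> \<Longrightarrow> C \<subseteq> D \<Longrightarrow> C = D"
proof -
  have "\<C> \<noteq> {} \<and> (\<forall>C\<in>\<C>. closedin T C)" using assms(2,3) by blast
  from assms(1)[unfolded noetherian_space_def, rule_format, OF this]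
  obtain D where "D \<in> \<C>" "\<forall>C\<in>\<C>. C \<subseteq> D \<longrightarrow> C = D" by (elim bexE)
  then show thesis using that by simp
qed

lemma openin_zariski_nonzero:
  fixes coords :: "('x \<Rightarrow> 'e::field alg_closure) set"
  assumes "f \<in> polynomial_functions coords"
  shows "openin (zariski_topology coords V) {x \<in> V. f x \<noteq> 0}"
  unfolding zariski_topology_def
  by (rule topology_generated_by_Basis, rule CollectI, rule exI[of _ f], rule conjI[OF refl assms])

lemma topspace_zariski_topology [simp]:
  fixes coords :: "('x \<Rightarrow> 'e::field alg_closure) set"
  shows "topspace (zariski_topology coords V) = V"
proof
  have "openin (zariski_topology coords V) {x \<in> V. (to_ac 1 :: 'e alg_closure) \<noteq> 0}"
    by (rule openin_zariski_nonzero[OF polynomial_functions.const])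
  then show "V \<subseteq> topspace (zariski_topology coords V)" by (auto dest: openin_subset)
  show "topspace (zariski_topology coords V) \<subseteq> V"
    unfolding zariski_topology_def topology_generated_by_topspace by (rule Union_least) auto
qed

lemma closedin_zariski_zero:
  fixes coords :: "('x \<Rightarrow> 'e::field alg_closure) set"
  assumes "f \<in> polynomial_functions coords"
  shows "closedin (zariski_topology coords V) {x \<in> V. f x = 0}"
proof -
  have "V - {x \<in> V. f x = 0} = {x \<in> V. f x \<noteq> 0}" by auto
  then show ?thesis unfolding closedin_def topspace_zariski_topology
    using openin_zariski_nonzero[OF assms, of V] by (simp only: Collect_restrict simp_thms)
qed

text \<open>The nonvanishing sets of polynomials are a basis and not only a subbasis, since the
  product of two polynomials cuts out the intersection. So a single polynomial that vanishes on
  \<open>C\<close> separates off each outside point.\<close>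

lemma zariski_separating_polynomial:
  fixes coords :: "('x \<Rightarrow> 'e::field alg_closure) set"
  assumes C: "closedin (zariski_topology coords V) C" and x: "x \<in> V" "x \<notin> C"
  shows "\<exists>f\<in>polynomial_functions coords. f x \<noteq> 0 \<and> (\<forall>y\<in>C. f y = 0)"
proof -
  let ?S = "{{x \<in> V. f x \<noteq> 0} | f. f \<in> polynomial_functions coords}"
  have gen: "\<forall>x\<in>U. \<exists>f\<in>polynomial_functions coords. f x \<noteq> 0 \<and> (\<forall>y\<in>V. f y \<noteq> 0 \<longrightarrow> y \<in> U)"
    if "generate_topology_on ?S U" for U
    using that
  proof induction
    case (Int A B)
    show ?case
    proof
      fix x assume "x \<in> A \<inter> B"
      then have x: "x \<in> A" "x \<in> B" by auto
      obtain f where f: "f \<in> polynomial_functions coords" "f x \<noteq> 0" "\<forall>y\<in>V. f y \<noteq> 0 \<longrightarrow> y \<in> A"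
        using bspec[OF Int.IH(1) x(1)] by (elim bexE conjE)
      obtain g where g: "g \<in> polynomial_functions coords" "g x \<noteq> 0" "\<forall>y\<in>V. g y \<noteq> 0 \<longrightarrow> y \<in> B"
        using bspec[OF Int.IH(2) x(2)] by (elim bexE conjE)
      show "\<exists>f\<in>polynomial_functions coords. f x \<noteq> 0 \<and> (\<forall>y\<in>V. f y \<noteq> 0 \<longrightarrow> y \<in> A \<inter> B)"
        by (rule bexI[OF _ polynomial_functions.mult[OF f(1) g(1)]]) (use f g in auto)
    qed
  next
    case (UN K)
    show ?case
    proof
      fix x assume "x \<in> \<Union>K"
      then obtain k where k: "k \<in> K" "x \<in> k" by blast
      from bspec[OF UN.IH[OF k(1)] k(2)] obtain f where "f \<in> polynomial_functions coords" "f x \<noteq> 0"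
          "\<forall>y\<in>V. f y \<noteq> 0 \<longrightarrow> y \<in> k" by (elim bexE conjE)
      with k(1) show "\<exists>f\<in>polynomial_functions coords. f x \<noteq> 0 \<and> (\<forall>y\<in>V. f y \<noteq> 0 \<longrightarrow> y \<in> \<Union>K)"
        by (intro bexI[of _ f]) auto
    qed
  next
    case (Basis U)
    then obtain f where "f \<in> polynomial_functions coords" "U = {x \<in> V. f x \<noteq> 0}"
      unfolding mem_Collect_eq by (elim exE conjE)
    then show ?case by (intro ballI bexI[of _ f]) simp_all
  qed simp
  have "generate_topology_on ?S (V - C)"
    using C unfolding closedin_def topspace_zariski_topology
    unfolding zariski_topology_def openin_topology_generated_by_iff by (rule conjunct2)
  from bspec[OF gen[OF this] DiffI[OF x]] obtain f where f: "f \<in> polynomial_functions coords"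
    "f x \<noteq> 0" "\<forall>y\<in>V. f y \<noteq> 0 \<longrightarrow> y \<in> V - C" by (elim bexE conjE)
  have "f y = 0" if "y \<in> C" for y
  proof -
    have "y \<in> V" using closedin_subset[OF C] that by auto
    then show ?thesis using f(3) that by blast
  qed
  with f show ?thesis by blast
qed

text \<open>A strictly descending chain of closed sets gives a strictly ascending chain of vanishing
  ideals: a polynomial that separates a lost point lies in the new ideal only.\<close>

lemma noetherian_zariski_topology:
  fixes coords :: "('x \<Rightarrow> 'e::field alg_closure) set"
  assumes "finite coords"
  shows "noetherian_space (zariski_topology coords V)"
proof -
  let ?T = "zariski_topology coords V" and ?P = "polynomial_functions coords"
  let ?r = "{(A, B). closedin ?T A \<and> closedin ?T B \<and> A \<subset> B}"
  have "wf ?r" unfolding wf_iff_no_infinite_down_chain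
  proof
    assume "\<exists>C. \<forall>k. (C (Suc k), C k) \<in> ?r"
    then obtain C where "\<forall>k::nat. (C (Suc k), C k) \<in> ?r" by blast
    then have C: "\<And>k::nat. closedin ?T (C k)" "\<And>k. C (Suc k) \<subset> C k" by auto
    define I where "I k = {f \<in> ?P. \<forall>x\<in>C k. f x = 0}" for k
    note P = subring_setD[OF polynomial_functions_subring[of coords]]
    have "ideal_set ?P (I k)" for k
      using P(2,5,6) by (auto simp: ideal_set_def I_def)
    moreover have "mono I"
    proof (rule monoI)
      fix k l :: nat assume "k \<le> l"
      then have "C l \<subseteq> C k" using lift_Suc_antimono_le[of C k l] C(2) by blast
      then show "I k \<subseteq> I l" by (auto simp: I_def)
    qed
    ultimately obtain m where m: "\<forall>k\<ge>m. I k = I m"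
      using noetherian_polynomial_functions[OF assms] unfolding noetherian_set_def by blast
    obtain x where x: "x \<in> C m" "x \<notin> C (Suc m)" using C(2)[of m] by blast
    have "x \<in> V" using closedin_subset[OF C(1)[of m]] x(1) by auto
    then obtain f where "f \<in> ?P" "f x \<noteq> 0" "\<forall>y\<in>C (Suc m). f y = 0"
      using zariski_separating_polynomial[OF C(1) _ x(2)] by blast
    then have "f \<in> I (Suc m)" "f \<notin> I m" using x(1) by (auto simp: I_def)
    moreover have "I (Suc m) = I m" by (rule m[rule_format]) simp
    ultimately show False by blast
  qed
  show ?thesis unfolding noetherian_space_def
  proof (intro allI impI, elim conjE)
    fix \<C> assume ne: "\<C> \<noteq> {}" and cl: "\<forall>C\<in>\<C>. closedin ?T C"
    then obtain C0 where "C0 \<in> \<C>" by blast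
    from wfE_min[OF \<open>wf ?r\<close> this] obtain D
      where "D \<in> \<C>" and D: "\<And>C. (C, D) \<in> ?r \<Longrightarrow> C \<notin> \<C>" by blast
    have "C = D" if "C \<in> \<C>" "C \<subseteq> D" for C
    proof (rule ccontr)
      assume "C \<noteq> D"
      then have "(C, D) \<in> ?r"
        using that(2) bspec[OF cl that(1)] bspec[OF cl \<open>D \<in> \<C>\<close>] by simp
      then show False using D that(1) by blast
    qed
    with \<open>D \<in> \<C>\<close> show "\<exists>D\<in>\<C>. \<forall>C\<in>\<C>. C \<subseteq> D \<longrightarrow> C = D" by blast
  qed
qed

section \<open>Polynomial maps and connected components\<close>

lemma polynomial_functions_compose:
  assumes "f \<in> polynomial_functions coords"
    and "\<And>h. h \<in> coords \<Longrightarrow> (\<lambda>x. h (\<phi> x)) \<in> polynomial_functions coords'"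
  shows "(\<lambda>x. f (\<phi> x)) \<in> polynomial_functions coords'"
  using assms(1) by induction (auto intro: polynomial_functions.intros assms(2))

lemma polynomial_functions_sum:
  assumes "finite A" "\<And>i. i \<in> A \<Longrightarrow> f i \<in> polynomial_functions coords"
  shows "(\<lambda>x. \<Sum>i\<in>A. f i x) \<in> polynomial_functions coords"
  using assms
proof (induction A rule: finite_induct)
  case empty
  show ?case using polynomial_functions.const[of 0] by simp
qed (auto intro: polynomial_functions.add)

lemma continuous_map_zariski:
  assumes "\<And>h. h \<in> coords' \<Longrightarrow> (\<lambda>x. h (\<phi> x)) \<in> polynomial_functions coords"
    and "\<And>x. x \<in> V \<Longrightarrow> \<phi> x \<in> V'"
  shows "continuous_map (zariski_topology coords V) (zariski_topology coords' V') \<phi>"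
proof -
  let ?T = "zariski_topology coords V"
  have "openin ?T (\<phi> -` U \<inter> V)"
    if U: "U \<in> {{x \<in> V'. f x \<noteq> 0} | f. f \<in> polynomial_functions coords'}" for U
  proof -
    obtain f where f: "f \<in> polynomial_functions coords'" "U = {x \<in> V'. f x \<noteq> 0}" using U by blast
    have "\<phi> -` U \<inter> V = {x \<in> V. f (\<phi> x) \<noteq> 0}" using assms(2) by (auto simp: f)
    then show ?thesis
      using openin_zariski_nonzero[OF polynomial_functions_compose[OF f(1) assms(1)]] by simp
  qed
  moreover have "\<phi> ` V \<subseteq> \<Union>{{x \<in> V'. f x \<noteq> 0} | f. f \<in> polynomial_functions coords'}"
    using topspace_zariski_topology[of coords' V'] assms(2)
    unfolding zariski_topology_def topology_generated_by_topspace by auto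
  ultimately show ?thesis
    unfolding zariski_topology_def[of coords' V'] continuous_on_generated_topo_iff
    by simp
qed

text \<open>A minimal clopen part \<open>D\<close> of \<open>H\<close> containing \<open>x\<close>
  exists by the Noetherian property. Minimality makes it connected, so it lies in the component;
  being clopen, it also contains the component.\<close>

lemma connected_component_clopen_noetherian:
  assumes T: "noetherian_space T" and H: "closedin T H" and x: "x \<in> H"
  defines "C \<equiv> connected_component_of_set (subtopology T H) x"
  shows "closedin T C" "closedin T (H - C)"
proof -
  have HT: "H \<subseteq> topspace T" using closedin_subset[OF H] .
  let ?F = "{D. x \<in> D \<and> D \<subseteq> H \<and> closedin T D \<and> closedin T (H - D)}"
  have "H \<in> ?F" using H x by simp
  then obtain D where D: "D \<in> ?F" and Dmin: "\<And>D'. D' \<in> ?F \<Longrightarrow> D' \<subseteq> D \<Longrightarrow> D' = D"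
    by (rule noetherian_space_minimal[OF T, where \<C> = ?F]) simp_all
  have conn: "connectedin T D"
    unfolding connectedin_closedin
  proof (intro conjI notI)
    show "D \<subseteq> topspace T" using D HT by auto
    assume "\<exists>E1 E2. closedin T E1 \<and> closedin T E2 \<and> D \<subseteq> E1 \<union> E2 \<and> E1 \<inter> E2 \<inter> D = {} \<and>
      E1 \<inter> D \<noteq> {} \<and> E2 \<inter> D \<noteq> {}"
    then obtain A B where AB: "closedin T A" "closedin T B" "D \<subseteq> A \<union> B" "A \<inter> B \<inter> D = {}"
      "A \<inter> D \<noteq> {}" "B \<inter> D \<noteq> {}" by blast
    \<comment> \<open>The part of a separation of \<open>D\<close> that contains \<open>x\<close>
      would be a strictly smaller member of \<open>?F\<close>.\<close>
    have half: False if "closedin T A" "closedin T B" "D \<subseteq> A \<union> B" "A \<inter> B \<inter> D = {}"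
      "B \<inter> D \<noteq> {}" "x \<in> A" for A B
    proof -
      have "H - (A \<inter> D) = (H - D) \<union> (B \<inter> D)" using that(3,4) D by auto
      then have "closedin T (H - (A \<inter> D))" using D that(2) by auto
      then have "A \<inter> D \<in> ?F" using D that(1,6) by auto
      then have "A \<inter> D = D" by (rule Dmin) auto
      then show False using that(4,5) by blast
    qed
    have "x \<in> D" using D by simp
    then consider "x \<in> A" | "x \<in> B" using AB(3) by blast
    then show False
    proof cases
      case 1
      show False by (rule half[OF AB(1,2,3,4,6) 1])
    next
      case 2
      show False by (rule half[OF AB(2,1) _ _ AB(5) 2]) (use AB(3,4) in auto)
    qed
  qed
  have "D \<subseteq> C" unfolding C_def
    by (rule connected_component_of_maximal) (use conn D in \<open>auto simp: connectedin_subtopology\<close>)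
  moreover have "C \<subseteq> D"
  proof -
    have cC: "connectedin (subtopology T H) C"
      unfolding C_def by (rule connectedin_connected_component_of)
    have "closedin (subtopology T H) D"
      using D by (auto simp: closedin_subtopology intro!: exI[of _ D])
    moreover have "closedin (subtopology T H) (H - D)"
      using D by (auto simp: closedin_subtopology intro!: exI[of _ "H - D"])
    then have "openin (subtopology T H) D"
      using D HT by (simp add: openin_closedin_eq Int_absorb1)
    moreover have "x \<in> C" using x HT unfolding C_def by (simp add: connected_component_of_refl in_mono)
    ultimately show ?thesis
      using connectedin_clopen_cases[OF cC, of D] D by (auto simp: disjnt_iff)
  qed
  ultimately have "C = D" by blast
  then show "closedin T C" "closedin T (H - C)" using D by auto
qed

lemma continuous_self_map_component:
  assumes f: "continuous_map Y Y f" and x: "x \<in> connected_component_of_set Y a"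
    and fx: "f x \<in> connected_component_of_set Y a"
  shows "f ` connected_component_of_set Y a \<subseteq> connected_component_of_set Y a"
proof -
  let ?C = "connected_component_of_set Y a"
  have "connectedin Y (f ` ?C)"
    by (rule connectedin_continuous_map_image[OF f connectedin_connected_component_of])
  then have "f ` ?C \<subseteq> connected_component_of_set Y (f x)"
    by (rule connected_component_of_maximal) (use x in auto)
  also have "\<dots> = ?C" using fx by (simp add: connected_component_of_equiv)
  finally show ?thesis .
qed

text \<open>Replaces the usual argument in an algebraic group: continuity is assumed only for left
  translations \<open>l s\<close> and conjugations \<open>c s\<close> by elements of
  \<open>G\<close>. Such a map preserves \<open>H\<close>, and it preserves \<open>C\<close> as soon
  as one point of \<open>C\<close> is sent into \<open>C\<close>.\<close>

lemma identity_component_preimage: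
  fixes G (structure) and r :: "'g \<Rightarrow> 'x"
  assumes G: "group G" and T: "noetherian_space T" and r: "r ` carrier G \<subseteq> topspace T"
    and l: "\<And>s. s \<in> carrier G \<Longrightarrow> continuous_map T T (l s)"
      "\<And>s t. s \<in> carrier G \<Longrightarrow> t \<in> carrier G \<Longrightarrow> l s (r t) = r (s \<otimes> t)"
    and c: "\<And>s. s \<in> carrier G \<Longrightarrow> continuous_map T T (c s)"
      "\<And>s t. s \<in> carrier G \<Longrightarrow> t \<in> carrier G \<Longrightarrow> c s (r t) = r (s \<otimes> t \<otimes> inv s)"
  defines "H \<equiv> Abstract_Topology.closure_of T (r ` carrier G)"
  defines "C \<equiv> connected_component_of_set (subtopology T H) (r \<one>)"
  defines "\<Gamma> \<equiv> {s \<in> carrier G. r s \<in> C}"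
  shows "closedin T (H - C)" "\<Gamma> \<lhd> G"
    "\<exists>F. finite F \<and> F \<subseteq> carrier G \<and> (\<forall>s\<in>carrier G. \<exists>t\<in>F. inv t \<otimes> s \<in> \<Gamma>)"
proof -
  interpret group G by (rule G)
  have H: "closedin T H" unfolding H_def by simp
  have HT: "H \<subseteq> topspace T" using closedin_subset[OF H] .
  have rH: "r s \<in> H" if "s \<in> carrier G" for s
    unfolding H_def using closure_of_subset[OF r] that by blast
  note clo = connected_component_clopen_noetherian[OF T H rH[OF one_closed], folded C_def]
  show "closedin T (H - C)" by (rule clo(2))
  have one: "r \<one> \<in> C" unfolding C_def using rH[OF one_closed] HT
    by (auto simp: connected_component_of_refl)
  have CH: "C \<subseteq> H"
    unfolding C_def using connected_component_of_subset_topspace[of "subtopology T H" "r \<one>"] by auto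
  have selfH: "f ` H \<subseteq> H" if "continuous_map T T f" "f ` r ` carrier G \<subseteq> r ` carrier G" for f
    using continuous_map_image_closure_subset[OF that(1), of "r ` carrier G"]
      closure_of_mono[OF that(2), of T] unfolding H_def by blast
  have self: "f ` C \<subseteq> C"
    if f: "continuous_map T T f" "f ` r ` carrier G \<subseteq> r ` carrier G" "x \<in> C" "f x \<in> C" for f x
    unfolding C_def
  proof (rule continuous_self_map_component)
    show "continuous_map (subtopology T H) (subtopology T H) f"
      using f(1) selfH[OF f(1,2)] by (auto simp: continuous_map_in_subtopology
          continuous_map_from_subtopology)
  qed (use f in \<open>auto simp: C_def\<close>)
  have lR: "l s ` r ` carrier G \<subseteq> r ` carrier G" if "s \<in> carrier G" for s
    using that by (auto simp: l(2))
  have cR: "c s ` r ` carrier G \<subseteq> r ` carrier G" if "s \<in> carrier G" for s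
    using that by (auto simp: c(2))
  \<comment> \<open>The test point for \<open>self\<close> is \<open>r \<one>\<close>, which
    \<open>l s\<close> sends to \<open>r s\<close>. For inverses it is \<open>r s\<close>, which
    \<open>l (inv s)\<close> sends to \<open>r \<one>\<close>.\<close>
  have mult: "s \<otimes> t \<in> \<Gamma>" if "s \<in> \<Gamma>" "t \<in> \<Gamma>" for s t
  proof -
    have s: "s \<in> carrier G" "r s \<in> C" "t \<in> carrier G" "r t \<in> C" using that by (auto simp: \<Gamma>_def)
    have "l s ` C \<subseteq> C"
      by (rule self[OF l(1) lR one]) (use s in \<open>auto simp: l(2)\<close>)
    then have "l s (r t) \<in> C" using s(4) by blast
    then show ?thesis using s by (simp add: \<Gamma>_def l(2))
  qed
  have inve: "inv s \<in> \<Gamma>" if "s \<in> \<Gamma>" for s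
  proof -
    have s: "s \<in> carrier G" "r s \<in> C" using that by (auto simp: \<Gamma>_def)
    have "l (inv s) ` C \<subseteq> C"
      by (rule self[OF l(1) lR s(2)]) (use s one in \<open>auto simp: l(2)\<close>)
    then have "l (inv s) (r \<one>) \<in> C" using one by blast
    then show ?thesis using s by (simp add: \<Gamma>_def l(2))
  qed
  have conj: "s \<otimes> t \<otimes> inv s \<in> \<Gamma>" if "s \<in> carrier G" "t \<in> \<Gamma>" for s t
  proof -
    have t: "t \<in> carrier G" "r t \<in> C" using that by (auto simp: \<Gamma>_def)
    have "c s ` C \<subseteq> C"
      by (rule self[OF c(1) cR one]) (use that one in \<open>auto simp: c(2)\<close>)
    then have "c s (r t) \<in> C" using t by blast
    then show ?thesis using that t by (simp add: \<Gamma>_def c(2))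
  qed
  have sub: "subgroup \<Gamma> G"
    by (rule subgroupI) (use one mult inve in \<open>auto simp: \<Gamma>_def\<close>)
  show "\<Gamma> \<lhd> G"
    by (auto simp: normal_inv_iff sub conj)
  \<comment> \<open>\<open>D F\<close> is what remains of \<open>H\<close> when the points sent into
    \<open>C\<close> by some \<open>l (inv s)\<close> with \<open>s\<close> in \<open>F\<close> are
    removed. These sets are closed because \<open>H - C\<close> is closed, so there is a minimal
    one. It contains no \<open>r s\<close>, since adding \<open>s\<close> to \<open>F\<close>
    removes \<open>r s\<close> and minimality forbids any loss.\<close>
  define D where "D F = {x \<in> H. \<forall>s\<in>F. l (inv s) x \<in> H - C}" for F
  define \<F> where "\<F> = {F. F \<subseteq> carrier G \<and> finite F}"
  have clD: "closedin T (D F)" if "F \<subseteq> carrier G" "finite F" for F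
    using that(2,1)
  proof (induction F rule: finite_induct)
    case empty
    show ?case using H by (simp add: D_def)
  next
    case (insert s F)
    have "closedin T {x \<in> topspace T. l (inv s) x \<in> H - C}"
      by (rule closedin_continuous_map_preimage[OF l(1) clo(2)]) (use insert.prems in auto)
    with insert have "closedin T (D F \<inter> {x \<in> topspace T. l (inv s) x \<in> H - C})"
      by (intro closedin_Int) auto
    moreover have "D (insert s F) = D F \<inter> {x \<in> topspace T. l (inv s) x \<in> H - C}"
      unfolding D_def using HT by blast
    ultimately show ?case by (simp only:)
  qed
  have "D {} \<in> D ` \<F>" by (auto simp: \<F>_def)
  then obtain E where "E \<in> D ` \<F>" and Emin: "\<And>E'. E' \<in> D ` \<F> \<Longrightarrow> E' \<subseteq> E \<Longrightarrow> E' = E"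
    by (rule noetherian_space_minimal[OF T]) (auto simp: \<F>_def intro: clD)
  then obtain F where FF: "F \<in> \<F>" and E: "E = D F" by (elim imageE)
  have min: "D F' = D F" if "F' \<subseteq> carrier G" "finite F'" "D F' \<subseteq> D F" for F'
    using Emin[of "D F'"] that by (simp add: E \<F>_def)
  have F: "F \<subseteq> carrier G" "finite F" using FF by (simp_all add: \<F>_def)
  have "\<exists>t\<in>F. inv t \<otimes> s \<in> \<Gamma>" if s: "s \<in> carrier G" for s
  proof -
    have "D (insert s F) = D F" by (rule min) (use F s in \<open>auto simp: D_def\<close>)
    moreover have "r s \<notin> D (insert s F)" using s one by (simp add: D_def l(2))
    ultimately have "r s \<notin> D F" by simp
    then have "\<exists>t\<in>F. l (inv t) (r s) \<notin> H - C"
      using rH[OF s] by (simp add: D_def del: Diff_iff)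
    then obtain t where t: "t \<in> F" "l (inv t) (r s) \<notin> H - C" by (elim bexE)
    have tG: "t \<in> carrier G" using F t by blast
    have "r (inv t \<otimes> s) \<in> H" by (rule rH) (use tG s in simp)
    then have "r (inv t \<otimes> s) \<in> C" using t(2) s tG by (simp add: l(2))
    then show ?thesis using t(1) s tG by (auto simp: \<Gamma>_def)
  qed
  then show "\<exists>F. finite F \<and> F \<subseteq> carrier G \<and> (\<forall>s\<in>carrier G. \<exists>t\<in>F. inv t \<otimes> s \<in> \<Gamma>)"
    using F by blast
qed

section \<open>Semisimple groups with operators\<close>

text \<open>Modules are abelian groups with a family of operators, so that vectors under a
  representation and pairs of matrices under left multiplication share one theory. Scalars enter as
  further operators.\<close>

definition op_sub :: "'i set \<Rightarrow> ('i \<Rightarrow> 'b \<Rightarrow> 'b) \<Rightarrow> 'b::ab_group_add set \<Rightarrow> bool" where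
  "op_sub I act U \<longleftrightarrow> 0 \<in> U \<and> (\<forall>x\<in>U. \<forall>y\<in>U. x - y \<in> U) \<and> (\<forall>i\<in>I. \<forall>x\<in>U. act i x \<in> U)"

definition op_simple :: "'i set \<Rightarrow> ('i \<Rightarrow> 'b \<Rightarrow> 'b) \<Rightarrow> 'b::ab_group_add set \<Rightarrow> bool" where
  "op_simple I act W \<longleftrightarrow> op_sub I act W \<and> W \<noteq> {0} \<and>
    (\<forall>U. op_sub I act U \<and> U \<subseteq> W \<longrightarrow> U = {0} \<or> U = W)"

text \<open>Says that the simple submodules generate everything, without choosing a direct sum
  decomposition; this form passes easily to other operator families.\<close>

definition op_semisimple :: "'i set \<Rightarrow> ('i \<Rightarrow> 'b \<Rightarrow> 'b::ab_group_add) \<Rightarrow> bool" where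
  "op_semisimple I act \<longleftrightarrow>
    (\<forall>T. op_sub I act T \<and> (\<forall>W. op_simple I act W \<longrightarrow> W \<subseteq> T) \<longrightarrow> T = UNIV)"

lemma op_subD:
  assumes "op_sub I act U"
  shows "0 \<in> U" "\<And>x y. x \<in> U \<Longrightarrow> y \<in> U \<Longrightarrow> x - y \<in> U" "\<And>x. x \<in> U \<Longrightarrow> - x \<in> U"
    "\<And>x y. x \<in> U \<Longrightarrow> y \<in> U \<Longrightarrow> x + y \<in> U" "\<And>i x. i \<in> I \<Longrightarrow> x \<in> U \<Longrightarrow> act i x \<in> U"
proof -
  show 0: "0 \<in> U" and d: "\<And>x y. x \<in> U \<Longrightarrow> y \<in> U \<Longrightarrow> x - y \<in> U"
    and "\<And>i x. i \<in> I \<Longrightarrow> x \<in> U \<Longrightarrow> act i x \<in> U"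
    using assms by (simp_all add: op_sub_def)
  show m: "- x \<in> U" if "x \<in> U" for x using d[OF 0 that] by simp
  show "x + y \<in> U" if "x \<in> U" "y \<in> U" for x y using d[OF that(1) m[OF that(2)]] by simp
qed

lemma op_subI:
  assumes "0 \<in> U" "\<And>x y. x \<in> U \<Longrightarrow> y \<in> U \<Longrightarrow> x - y \<in> U"
    "\<And>i x. i \<in> I \<Longrightarrow> x \<in> U \<Longrightarrow> act i x \<in> U"
  shows "op_sub I act U"
  using assms by (simp add: op_sub_def)

lemma op_simpleD:
  assumes "op_simple I act W"
  shows "op_sub I act W" "W \<noteq> {0}" "\<And>U. op_sub I act U \<Longrightarrow> U \<subseteq> W \<Longrightarrow> U = {0} \<or> U = W"
  using assms by (simp_all add: op_simple_def)

lemma op_semisimpleD: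
  assumes "op_semisimple I act" "op_sub I act T" "\<And>W. op_simple I act W \<Longrightarrow> W \<subseteq> T"
  shows "T = UNIV"
  using assms by (simp add: op_semisimple_def)

lemma op_sub_Int: "op_sub I act U \<Longrightarrow> op_sub I act V \<Longrightarrow> op_sub I act (U \<inter> V)"
  by (simp add: op_sub_def)

lemma op_sub_sum:
  assumes add: "\<And>i x y. i \<in> I \<Longrightarrow> act i (x + y) = act i x + act i y"
    and U: "op_sub I act U" and V: "op_sub I act V"
  shows "op_sub I act {u + v | u v. u \<in> U \<and> v \<in> V}"
proof (rule op_subI)
  show "0 \<in> {u + v | u v. u \<in> U \<and> v \<in> V}"
    using op_subD(1)[OF U] op_subD(1)[OF V] by (intro CollectI exI[of _ 0]) simp
next
  fix x y assume "x \<in> {u + v | u v. u \<in> U \<and> v \<in> V}" "y \<in> {u + v | u v. u \<in> U \<and> v \<in> V}"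
  then obtain u v u' v' where *: "x = u + v" "u \<in> U" "v \<in> V" "y = u' + v'" "u' \<in> U" "v' \<in> V"
    by (elim CollectE exE conjE)
  have "x - y = (u - u') + (v - v')" by (simp add: *)
  then show "x - y \<in> {u + v | u v. u \<in> U \<and> v \<in> V}"
    using op_subD(2)[OF U *(2,5)] op_subD(2)[OF V *(3,6)]
    by (intro CollectI exI[of _ "u - u'"] exI[of _ "v - v'"] conjI)
next
  fix i x assume i: "i \<in> I" and "x \<in> {u + v | u v. u \<in> U \<and> v \<in> V}"
  then obtain u v where *: "x = u + v" "u \<in> U" "v \<in> V" by (elim CollectE exE conjE)
  show "act i x \<in> {u + v | u v. u \<in> U \<and> v \<in> V}"
    using op_subD(5)[OF U i *(2)] op_subD(5)[OF V i *(3)]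
    by (intro CollectI exI[of _ "act i u"] exI[of _ "act i v"] conjI) (simp_all add: add[OF i] *)
qed

text \<open>Zorn's lemma gives a maximal \<open>V\<close> that meets \<open>U\<close> trivially.
  Every simple submodule lies in \<open>U + V\<close>, as otherwise it could be added to
  \<open>V\<close>; hence \<open>U + V\<close> is everything.\<close>

lemma op_semisimple_complement:
  assumes add: "\<And>i x y. i \<in> I \<Longrightarrow> act i (x + y) = act i x + act i y"
    and ss: "op_semisimple I act" and U: "op_sub I act U"
  obtains V where "op_sub I act V" "U \<inter> V = {0}" "\<forall>x. \<exists>u\<in>U. \<exists>v\<in>V. x = u + v"
proof -
  define A where "A = {V. op_sub I act V \<and> U \<inter> V = {0}}"
  have zero: "act i 0 = 0" if "i \<in> I" for i using add[OF that, of 0 0] by simp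
  have "{0} \<in> A" using op_subD(1)[OF U] zero by (auto simp: A_def op_sub_def)
  moreover have "\<Union>\<C> \<in> A" if "\<C> \<noteq> {}" and ch: "subset.chain A \<C>" for \<C>
  proof -
    obtain V0 where V0: "V0 \<in> \<C>" using \<open>\<C> \<noteq> {}\<close> by auto
    have sub: "op_sub I act V" "U \<inter> V = {0}" if "V \<in> \<C>" for V
      using ch that by (auto simp: subset_chain_def A_def)
    have "op_sub I act (\<Union>\<C>)"
    proof (rule op_subI)
      show "0 \<in> \<Union>\<C>" using V0 op_subD(1)[OF sub(1)[OF V0]] by auto
    next
      fix x y assume "x \<in> \<Union>\<C>" "y \<in> \<Union>\<C>"
      then obtain V W where VW: "V \<in> \<C>" "x \<in> V" "W \<in> \<C>" "y \<in> W" by auto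
      then have "V \<subseteq> W \<or> W \<subseteq> V" using ch by (auto simp: subset_chain_def)
      then show "x - y \<in> \<Union>\<C>"
      proof
        assume "V \<subseteq> W"
        then have "x - y \<in> W" using VW by (intro op_subD(2)[OF sub(1)]) auto
        then show ?thesis using VW by auto
      next
        assume "W \<subseteq> V"
        then have "x - y \<in> V" using VW by (intro op_subD(2)[OF sub(1)]) auto
        then show ?thesis using VW by auto
      qed
    next
      fix i x assume "i \<in> I" "x \<in> \<Union>\<C>"
      then show "act i x \<in> \<Union>\<C>" using op_subD(5)[OF sub(1)] by auto
    qed
    moreover have "U \<inter> \<Union>\<C> = {0}" using sub(2) V0 by auto
    ultimately show ?thesis by (simp add: A_def)
  qed
  ultimately have "\<exists>M\<in>A. \<forall>Y\<in>A. M \<subseteq> Y \<longrightarrow> Y = M"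
    by (intro subset_Zorn_nonempty) auto
  then obtain V where VA: "V \<in> A" and Vmax: "\<And>Y. Y \<in> A \<Longrightarrow> V \<subseteq> Y \<Longrightarrow> Y = V" by auto
  have V: "op_sub I act V" and UV: "U \<inter> V = {0}" using VA by (simp_all add: A_def)
  let ?T = "{u + v | u v. u \<in> U \<and> v \<in> V}"
  have T: "op_sub I act ?T" by (rule op_sub_sum[OF add U V])
  have UT: "u \<in> ?T" if "u \<in> U" for u
    using that op_subD(1)[OF V] by (intro CollectI exI[of _ u] exI[of _ 0]) simp
  have VT: "v \<in> ?T" if "v \<in> V" for v
    using that op_subD(1)[OF U] by (intro CollectI exI[of _ 0] exI[of _ v]) simp
  have "W \<subseteq> ?T" if W: "op_simple I act W" for W
  proof -
    have "W \<inter> ?T = {0} \<or> W \<inter> ?T = W"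
      by (rule op_simpleD(3)[OF W]) (auto intro: op_sub_Int op_simpleD(1)[OF W] T)
    then show ?thesis
    proof
      \<comment> \<open>In this case \<open>V + W\<close> still meets \<open>U\<close> trivially,
        and maximality of \<open>V\<close> puts \<open>W\<close> inside \<open>V\<close>.\<close>
      assume 0: "W \<inter> ?T = {0}"
      let ?V = "{v + w | v w. v \<in> V \<and> w \<in> W}"
      have "x = 0" if x: "x \<in> U" "x \<in> ?V" for x
      proof -
        obtain v w where *: "x = v + w" "v \<in> V" "w \<in> W" using x(2) by (elim CollectE exE conjE)
        have "x - v \<in> ?T" by (rule op_subD(2)[OF T UT[OF x(1)] VT[OF *(2)]])
        then have "w \<in> W \<inter> ?T" using * by simp
        then have "w = 0" unfolding 0 by simp
        then have "x \<in> U \<inter> V" using x(1) * by simp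
        then show ?thesis unfolding UV by simp
      qed
      moreover have VW: "op_sub I act ?V" by (rule op_sub_sum[OF add V op_simpleD(1)[OF W]])
      ultimately have 1: "U \<inter> ?V = {0}"
        by (intro equalityI subsetI IntI) (use op_subD(1)[OF VW] op_subD(1)[OF U] in simp_all)
      have "?V \<in> A" unfolding A_def using VW 1 by (intro CollectI conjI)
      moreover have "V \<subseteq> ?V"
      proof
        fix v assume "v \<in> V"
        then show "v \<in> ?V" using op_subD(1)[OF op_simpleD(1)[OF W]]
          by (intro CollectI exI[of _ v] exI[of _ 0]) simp
      qed
      ultimately have eq: "?V = V" by (rule Vmax)
      show "W \<subseteq> ?T"
      proof
        fix w assume "w \<in> W"
        then have "w \<in> ?V" using op_subD(1)[OF V]
          by (intro CollectI exI[of _ 0] exI[of _ w]) simp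
        then show "w \<in> ?T" unfolding eq by (rule VT)
      qed
    qed auto
  qed
  then have full: "?T = UNIV" by (rule op_semisimpleD[OF ss T])
  have "\<exists>u\<in>U. \<exists>v\<in>V. x = u + v" for x
  proof -
    have "x \<in> ?T" unfolding full by simp
    then obtain u v where "x = u + v" "u \<in> U" "v \<in> V" by (elim CollectE exE conjE)
    then show ?thesis by (intro bexI)
  qed
  then have "\<forall>x. \<exists>u\<in>U. \<exists>v\<in>V. x = u + v" by (rule allI)
  with V UV show thesis by (rule that)
qed

text \<open>The operators on the two sides only have to correspond in both directions. In Clifford's
  theorem \<open>\<phi>\<close> is an operator that conjugates the others; elsewhere it embeds
  vectors as matrix columns.\<close>

lemma op_simple_image:
  assumes W: "op_simple I act W"
    and add: "\<And>x y. \<phi> (x - y) = \<phi> x - \<phi> y" and inj: "\<And>x. \<phi> x = 0 \<Longrightarrow> x = 0"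
    and I: "\<And>i. i \<in> I \<Longrightarrow> \<exists>j\<in>J. \<forall>x. \<phi> (act i x) = act' j (\<phi> x)"
    and J: "\<And>j. j \<in> J \<Longrightarrow> \<exists>i\<in>I. \<forall>x. \<phi> (act i x) = act' j (\<phi> x)"
  shows "op_simple J act' (\<phi> ` W)"
proof -
  note W' = op_subD[OF op_simpleD(1)[OF W]]
  have z: "\<phi> 0 = 0" using add[of 0 0] by simp
  have sub: "op_sub J act' (\<phi> ` W)"
  proof (rule op_subI)
    show "0 \<in> \<phi> ` W" using W'(1) z by (intro image_eqI[of _ _ 0]) simp_all
  next
    fix x y assume "x \<in> \<phi> ` W" "y \<in> \<phi> ` W"
    then obtain a b where *: "x = \<phi> a" "a \<in> W" "y = \<phi> b" "b \<in> W" by (elim imageE)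
    show "x - y \<in> \<phi> ` W"
      by (rule image_eqI[of _ _ "a - b"]) (use * W'(2) add in simp_all)
  next
    fix j x assume "j \<in> J" "x \<in> \<phi> ` W"
    then obtain a where *: "x = \<phi> a" "a \<in> W" by (elim imageE)
    obtain i where i: "i \<in> I" "\<forall>x. \<phi> (act i x) = act' j (\<phi> x)" using J[OF \<open>j \<in> J\<close>] by (elim bexE)
    show "act' j x \<in> \<phi> ` W"
      by (rule image_eqI[of _ _ "act i a"]) (use i * W'(5) in simp_all)
  qed
  moreover have "\<phi> ` W \<noteq> {0}"
  proof
    assume 0: "\<phi> ` W = {0}"
    have "x = 0" if "x \<in> W" for x
    proof -
      have "\<phi> x \<in> {0}" using that unfolding 0[symmetric] by simp
      then show ?thesis using inj by simp
    qed
    then show False using op_simpleD(2)[OF W] W'(1) by auto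
  qed
  moreover have "U = {0} \<or> U = \<phi> ` W" if U: "op_sub J act' U" and UW: "U \<subseteq> \<phi> ` W" for U
  proof -
    let ?U = "{x \<in> W. \<phi> x \<in> U}"
    have im: "U = \<phi> ` ?U" using UW by auto
    have "op_sub I act ?U"
    proof (rule op_subI)
      show "0 \<in> ?U" using W'(1) z op_subD(1)[OF U] by simp
    next
      fix x y assume "x \<in> ?U" "y \<in> ?U"
      then show "x - y \<in> ?U" using W'(2) op_subD(2)[OF U] by (simp add: add)
    next
      fix i x assume i: "i \<in> I" and x: "x \<in> ?U"
      obtain j where "j \<in> J" "\<forall>x. \<phi> (act i x) = act' j (\<phi> x)" using I[OF i] by (elim bexE)
      then show "act i x \<in> ?U" using x W'(5)[OF i] op_subD(5)[OF U] by simp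
    qed
    then have "?U = {0} \<or> ?U = W" by (rule op_simpleD(3)[OF W]) auto
    then show ?thesis
    proof
      assume "?U = {0}"
      then show ?thesis using im z by simp
    next
      assume "?U = W"
      then show ?thesis using im by simp
    qed
  qed
  ultimately show ?thesis by (simp add: op_simple_def)
qed

lemma op_sub_vimage:
  assumes U: "op_sub J act' U" and add: "\<And>x y. \<phi> (x - y) = \<phi> x - \<phi> y"
    and I: "\<And>i. i \<in> I \<Longrightarrow> \<exists>j\<in>J. \<forall>x. \<phi> (act i x) = act' j (\<phi> x)"
  shows "op_sub I act {x. \<phi> x \<in> U}"
proof (rule op_subI)
  show "0 \<in> {x. \<phi> x \<in> U}" using add[of 0 0] op_subD(1)[OF U] by simp
next
  fix x y assume "x \<in> {x. \<phi> x \<in> U}" "y \<in> {x. \<phi> x \<in> U}"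
  then show "x - y \<in> {x. \<phi> x \<in> U}" using op_subD(2)[OF U] by (simp add: add)
next
  fix i x assume i: "i \<in> I" and x: "x \<in> {x. \<phi> x \<in> U}"
  obtain j where "j \<in> J" "\<forall>x. \<phi> (act i x) = act' j (\<phi> x)" using I[OF i] by (elim bexE)
  then show "act i x \<in> {x. \<phi> x \<in> U}" using x op_subD(5)[OF U] by simp
qed

text \<open>Clifford's theorem: the socle of the restricted action is stable under the full action.\<close>

lemma op_semisimple_clifford:
  assumes ss: "op_semisimple I act" and JI: "J \<subseteq> I"
    and add: "\<And>i x y. i \<in> I \<Longrightarrow> act i (x - y) = act i x - act i y"
    and conj: "\<And>i. i \<in> I \<Longrightarrow> (\<forall>x. act i x = 0) \<or> (\<forall>x. act i x = 0 \<longrightarrow> x = 0) \<and>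
      (\<forall>j\<in>J. \<exists>k\<in>J. \<forall>x. act i (act j x) = act k (act i x)) \<and>
      (\<forall>k\<in>J. \<exists>j\<in>J. \<forall>x. act i (act j x) = act k (act i x))"
    and min: "\<And>W. op_simple I act W \<Longrightarrow> \<exists>V. op_simple J act V \<and> V \<subseteq> W"
  shows "op_semisimple J act"
proof -
  \<comment> \<open>The socle is taken as an intersection, so that \<open>T\<close> lies in any
    submodule containing all simple ones.\<close>
  define T where "T = \<Inter>{T. op_sub J act T \<and> (\<forall>W. op_simple J act W \<longrightarrow> W \<subseteq> T)}"
  have TJ: "op_sub J act T"
    unfolding T_def by (rule op_subI) (auto simp: op_sub_def)
  have Tmin: "T \<subseteq> U" if "op_sub J act U" "\<And>W. op_simple J act W \<Longrightarrow> W \<subseteq> U" for U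
    unfolding T_def by (rule Inter_lower) (use that in simp)
  have simpT: "W \<subseteq> T" if "op_simple J act W" for W
    unfolding T_def by (rule Inter_greatest) (use that in simp)
  have stable: "act i x \<in> T" if i: "i \<in> I" and x: "x \<in> T" for i x
    using conj[OF i]
  proof (elim disjE conjE)
    \<comment> \<open>The case of the scalar \<open>0\<close>, which is among the operators and is
      not injective.\<close>
    assume "\<forall>x. act i x = 0"
    then show ?thesis using op_subD(1)[OF TJ] by simp
  next
    assume inj: "\<forall>x. act i x = 0 \<longrightarrow> x = 0"
      and 1: "\<forall>j\<in>J. \<exists>k\<in>J. \<forall>x. act i (act j x) = act k (act i x)"
      and 2: "\<forall>k\<in>J. \<exists>j\<in>J. \<forall>x. act i (act j x) = act k (act i x)"
    have "T \<subseteq> {x. act i x \<in> T}"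
    proof (rule Tmin)
      show "op_sub J act {x. act i x \<in> T}"
        by (rule op_sub_vimage[OF TJ add[OF i]]) (rule bspec[OF 1])
      fix W assume W: "op_simple J act W"
      have "op_simple J act (act i ` W)"
      proof (rule op_simple_image[OF W])
        show "act i (x - y) = act i x - act i y" for x y by (rule add[OF i])
        show "act i x = 0 \<Longrightarrow> x = 0" for x using inj by simp
        show "\<exists>k\<in>J. \<forall>x. act i (act j x) = act k (act i x)" if "j \<in> J" for j by (rule bspec[OF 1 that])
        show "\<exists>j\<in>J. \<forall>x. act i (act j x) = act k (act i x)" if "k \<in> J" for k by (rule bspec[OF 2 that])
      qed
      from simpT[OF this] show "W \<subseteq> {x. act i x \<in> T}" by auto
    qed
    then show ?thesis using x by auto
  qed
  have TI: "op_sub I act T"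
    by (rule op_subI) (use op_subD[OF TJ] stable in simp_all)
  \<comment> \<open>A simple submodule for \<open>I\<close> contains one for \<open>J\<close>, which
    lies in \<open>T\<close>. So it meets the \<open>I\<close>-stable \<open>T\<close> nontrivially
    and is contained in it.\<close>
  have "W \<subseteq> T" if W: "op_simple I act W" for W
  proof -
    obtain V where V: "op_simple J act V" "V \<subseteq> W" using min[OF W] by (elim exE conjE)
    have "T \<inter> W = {0} \<or> T \<inter> W = W"
      by (rule op_simpleD(3)[OF W]) (auto intro: op_sub_Int TI op_simpleD(1)[OF W])
    moreover have "V \<subseteq> T \<inter> W" using simpT[OF V(1)] V(2) by simp
    moreover have "V \<noteq> {0}" "0 \<in> V" using op_simpleD(1,2)[OF V(1)] by (auto dest: op_subD(1))
    ultimately show ?thesis by auto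
  qed
  then have "T = UNIV" by (rule op_semisimpleD[OF ss TI])
  then show ?thesis
    unfolding op_semisimple_def using Tmin by (intro allI impI equalityI subset_UNIV) (elim conjE, simp)
qed

section \<open>Determinants on the linear span of a semigroup\<close>

definition scaled_lift :: "nat \<Rightarrow> 'a::comm_ring_1 ^'n ^'n \<Rightarrow> 'a poly ^'n ^'n" where
  "scaled_lift e A = map_matrix (\<lambda>a. Polynomial.monom a e) A"

text \<open>\<open>A\<close> and \<open>B\<close> are one and the same sum of terms
  \<open>t ^ e s\<close> with \<open>e \<ge> d\<close>, read in the first and in the second
  components of the pairs \<open>s\<close>. The bound \<open>d\<close> records the order in the
  indeterminate \<open>t\<close>.\<close>

inductive lifted_sum :: "(('a::comm_ring_1 ^'n ^'n) \<times> ('a ^'n ^'n)) set \<Rightarrow> nat \<Rightarrow>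
    'a poly ^'n ^'n \<Rightarrow> 'a poly ^'n ^'n \<Rightarrow> bool" for S d where
  zero: "lifted_sum S d 0 0"
| add: "s \<in> S \<Longrightarrow> d \<le> e \<Longrightarrow> lifted_sum S d A B \<Longrightarrow>
    lifted_sum S d (scaled_lift e (fst s) + A) (scaled_lift e (snd s) + B)"

inductive_set additive_span :: "'b::monoid_add set \<Rightarrow> 'b set" for S where
  zero: "0 \<in> additive_span S"
| add: "s \<in> S \<Longrightarrow> x \<in> additive_span S \<Longrightarrow> s + x \<in> additive_span S"

lemma mat_mult_entry: "(mat c ** A) $ i $ j = c * (A::'a::comm_ring_1 ^'n ^'m) $ i $ j"
  by (simp add: matrix_matrix_mult_def mat_def if_distrib[of "\<lambda>x. x * _"] sum.delta' cong: if_cong)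

lemma mat_commute: "mat c ** A = A ** mat c" for A :: "'a::comm_ring_1 ^'n ^'n"
  by (simp add: vec_eq_iff mat_mult_entry)
    (simp add: matrix_matrix_mult_def mat_def if_distrib[of "\<lambda>x. _ * x"] mult.commute cong: if_cong)

lemma poly_det: "poly (det A) x = det (map_matrix (\<lambda>p. poly p x) A)"
  for A :: "'a::comm_ring_1 poly ^'n ^'n"
proof -
  have "poly (of_int (sign p)) x = of_int (sign p)" for p :: "'n \<Rightarrow> 'n"
    by (simp add: sign_def)
  then show ?thesis
    by (simp add: det_def map_matrix_def poly_sum poly_prod)
qed

lemma dvd_prod_diff:
  fixes f g :: "'i \<Rightarrow> 'a::comm_ring_1"
  assumes "\<And>i. i \<in> I \<Longrightarrow> q dvd f i - g i"
  shows "q dvd prod f I - prod g I"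
proof (cases "finite I")
  case True
  then show ?thesis using assms
  proof (induction I rule: finite_induct)
    case (insert i I)
    have "prod f (insert i I) - prod g (insert i I) =
        (f i - g i) * prod f I + g i * (prod f I - prod g I)"
      using insert.hyps by (simp add: algebra_simps)
    moreover have "q dvd (f i - g i) * prod f I" by (rule dvd_mult2) (use insert.prems in simp)
    moreover have "q dvd g i * (prod f I - prod g I)"
      by (rule dvd_mult) (use insert in simp)
    ultimately show ?case by (simp only: dvd_add)
  qed simp
qed simp

lemma dvd_det_diff:
  fixes A B :: "'a::comm_ring_1 ^'n ^'n"
  assumes "\<And>i j. q dvd A $ i $ j - B $ i $ j"
  shows "q dvd det A - det B"
proof -
  have "det A - det B = (\<Sum>p | p permutes (UNIV::'n set). of_int (sign p) *
      ((\<Prod>i\<in>UNIV. A $ i $ p i) - (\<Prod>i\<in>UNIV. B $ i $ p i)))"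
    by (simp add: det_def sum_subtractf right_diff_distrib)
  also have "q dvd \<dots>"
    by (intro dvd_sum dvd_mult dvd_prod_diff assms)
  finally show ?thesis .
qed

lemma scaled_lift_mult: "scaled_lift (d + e) (A ** B) = scaled_lift d A ** scaled_lift e B"
  by (simp add: scaled_lift_def map_matrix_def matrix_matrix_mult_def vec_eq_iff monom_sum mult_monom)

lemma lifted_sum_mono: "lifted_sum S d A B \<Longrightarrow> d' \<le> d \<Longrightarrow> lifted_sum S d' A B"
  by (induction rule: lifted_sum.induct) (auto intro: lifted_sum.intros)

lemma lifted_sum_add:
  "lifted_sum S d A B \<Longrightarrow> lifted_sum S d A' B' \<Longrightarrow> lifted_sum S d (A + A') (B + B')"
proof (induction rule: lifted_sum.induct)
  case (add s e A B)
  have "lifted_sum S d (scaled_lift e (fst s) + (A + A')) (scaled_lift e (snd s) + (B + B'))"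
    by (rule lifted_sum.add) (use add in simp_all)
  then show ?case by (simp only: add.assoc)
qed simp

lemma lifted_sum_mult:
  assumes mult: "\<And>s t. s \<in> S \<Longrightarrow> t \<in> S \<Longrightarrow> (fst s ** fst t, snd s ** snd t) \<in> S" and s: "s \<in> S"
  shows "lifted_sum S d A B \<Longrightarrow>
    lifted_sum S (e + d) (scaled_lift e (fst s) ** A) (scaled_lift e (snd s) ** B)"
proof (induction rule: lifted_sum.induct)
  case zero
  have "(C :: 'a poly ^'b ^'b) ** 0 = 0" for C
    by (simp add: matrix_matrix_mult_def vec_eq_iff)
  then show ?case by (simp add: lifted_sum.zero)
next
  case (add t f A B)
  have "lifted_sum S (e + d)
      (scaled_lift (e + f) (fst (fst s ** fst t, snd s ** snd t)) + scaled_lift e (fst s) ** A)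
      (scaled_lift (e + f) (snd (fst s ** fst t, snd s ** snd t)) + scaled_lift e (snd s) ** B)"
    by (rule lifted_sum.add) (use add s in \<open>simp_all add: mult\<close>)
  then show ?case by (simp add: scaled_lift_mult matrix_add_ldistrib)
qed

lemma lifted_sum_dvd:
  "lifted_sum S d A B \<Longrightarrow> Polynomial.monom 1 d dvd A $ i $ j \<and> Polynomial.monom 1 d dvd B $ i $ j"
proof (induction rule: lifted_sum.induct)
  case (add s e A B)
  have "Polynomial.monom 1 d dvd Polynomial.monom a e" for a :: 'a
    using \<open>d \<le> e\<close> by (intro dvdI[of _ _ "Polynomial.monom a (e - d)"]) (simp add: mult_monom)
  then show ?case using add by (simp add: scaled_lift_def map_matrix_def)
qed simp

text \<open>The sum of \<open>a ^ j b\<close> over \<open>j < k\<close>; correspondingly,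
  \<open>matrix_power a b k\<close> is \<open>a ^ k b\<close> with \<open>b\<close> as starting
  value. Both are built by left multiplication with \<open>a\<close>, under which lifted sums are
  stable.\<close>

primrec geometric :: "'a::comm_ring_1 ^'n ^'n \<Rightarrow> 'a ^'n ^'n \<Rightarrow> nat \<Rightarrow> 'a ^'n ^'n" where
  "geometric a b 0 = 0"
| "geometric a b (Suc k) = b + a ** geometric a b k"

primrec matrix_power :: "'a::comm_ring_1 ^'n ^'n \<Rightarrow> 'a ^'n ^'n \<Rightarrow> nat \<Rightarrow> 'a ^'n ^'n" where
  "matrix_power a b 0 = b"
| "matrix_power a b (Suc k) = a ** matrix_power a b k"

lemma matrix_diff_ldistrib: "A ** (B - C) = A ** B - A ** (C::'a::comm_ring_1 ^'n ^'m)"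
  by (simp add: matrix_matrix_mult_def vec_eq_iff right_diff_distrib sum_subtractf)

lemma matrix_diff_rdistrib: "(B - C) ** A = B ** A - C ** (A::'a::comm_ring_1 ^'n ^'m)"
  by (simp add: matrix_matrix_mult_def vec_eq_iff left_diff_distrib sum_subtractf)

lemma geometric_telescope:
  "geometric a b k - a ** geometric a b k = b - matrix_power a b k"
proof (induction k)
  case 0
  have "a ** 0 = 0" by (simp add: matrix_matrix_mult_def vec_eq_iff)
  then show ?case by simp
next
  case (Suc k)
  have "geometric a b (Suc k) - a ** geometric a b (Suc k) =
      b - a ** b + a ** (geometric a b k - a ** geometric a b k)"
    by (simp add: matrix_add_ldistrib matrix_diff_ldistrib algebra_simps)
  also have "\<dots> = b - matrix_power a b (Suc k)" unfolding Suc by (simp add: matrix_diff_ldistrib)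
  finally show ?case .
qed

text \<open>An exact identity that holds without commutation of \<open>a\<close> and
  \<open>b\<close>. The product differs from \<open>1 - a - b\<close> by the tail
  \<open>a ^ k b\<close>, which is divisible by a high power of \<open>t\<close> when
  \<open>a\<close> is divisible by \<open>t\<close>.\<close>

lemma geometric_factor:
  "(mat 1 - a) ** (mat 1 - geometric a b k) = mat 1 - (a + b) + matrix_power a b k"
proof -
  have "(mat 1 - a) ** (mat 1 - geometric a b k) =
      mat 1 - a - (geometric a b k - a ** geometric a b k)"
    by (simp add: matrix_diff_ldistrib matrix_diff_rdistrib algebra_simps)
  then show ?thesis by (simp add: geometric_telescope algebra_simps)
qed

text \<open>Since \<open>S\<close> contains the scalars and is closed under products,
  \<open>det_eq\<close> also compares \<open>det (1 - c s)\<close> for every scalar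
  \<open>c\<close>. Over an infinite field this is an identity of polynomials in
  \<open>c\<close>.\<close>

locale matrix_pair_semigroup =
  fixes S :: "(('a::field ^'n ^'n) \<times> ('a ^'n ^'n)) set"
  assumes inf: "infinite (UNIV :: 'a set)"
    and mult: "s \<in> S \<Longrightarrow> t \<in> S \<Longrightarrow> (fst s ** fst t, snd s ** snd t) \<in> S"
    and scalar: "(mat c, mat c) \<in> S"
    and det_eq: "s \<in> S \<Longrightarrow> det (mat 1 - fst s) = det (mat 1 - snd s)"
begin

lemma det_scaled_lift:
  assumes s: "s \<in> S"
  shows "det (mat 1 - scaled_lift d (fst s)) = det (mat 1 - scaled_lift d (snd s))"
    (is "?p = ?q")
proof -
  have ev: "map_matrix (\<lambda>p. poly p x) (mat 1 - scaled_lift d A) = mat 1 - mat (x ^ d) ** A"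
    for x and A :: "'a ^'n ^'n"
  proof -
    have "poly ((mat 1 :: 'a poly ^'n ^'n) $ i $ j) x = (mat 1 :: 'a ^'n ^'n) $ i $ j" for i j
      by (simp add: mat_def)
    then show ?thesis
      by (simp add: vec_eq_iff map_matrix_def scaled_lift_def mat_mult_entry poly_monom mult.commute)
  qed
  have "poly ?p x = poly ?q x" for x
    unfolding poly_det ev using det_eq[OF mult[OF scalar s, of "x ^ d"]] by simp
  then have "{x. poly (?p - ?q) x = 0} = UNIV" by simp
  then have "?p - ?q = 0" using poly_roots_finite[of "?p - ?q"] inf by auto
  then show ?thesis by simp
qed

text \<open>
  Modulo \<open>t ^ N\<close>, the factorization \<open>1 - a - b = (1 - a) (1 - \<Sum>j\<le>N. a ^ j b)\<close> removes one term of
  the lowest degree at the cost of new terms of higher degree.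
\<close>

lemma lifted_sum_det:
  assumes "lifted_sum S d A B" "1 \<le> d"
  shows "Polynomial.monom 1 N dvd det (mat 1 - A) - det (mat 1 - B)"
  using assms
proof (induction "N - d" arbitrary: d A B)
  \<comment> \<open>Here \<open>d \<ge> N\<close>, so \<open>t ^ N\<close> divides all entries of
    \<open>A\<close> and \<open>B\<close>, and both determinants are congruent to
    \<open>det 1\<close>.\<close>
  case 0
  have *: "Polynomial.monom 1 N dvd C" if "Polynomial.monom 1 d dvd C" for C :: "'a poly"
  proof -
    have "Polynomial.monom (1::'a) d = Polynomial.monom 1 N * Polynomial.monom 1 (d - N)" using 0 by (simp add: mult_monom)
    then have "Polynomial.monom (1::'a) N dvd Polynomial.monom 1 d" by (rule dvdI)
    then show ?thesis using that by (rule dvd_trans)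
  qed
  have 1: "Polynomial.monom 1 N dvd det (mat 1 - A) - det (mat 1 :: 'a poly ^'n ^'n)"
    by (rule dvd_det_diff) (simp add: *[OF conjunct1[OF lifted_sum_dvd[OF 0(2)]]])
  have 2: "Polynomial.monom 1 N dvd det (mat 1 - B) - det (mat 1 :: 'a poly ^'n ^'n)"
    by (rule dvd_det_diff) (simp add: *[OF conjunct2[OF lifted_sum_dvd[OF 0(2)]]])
  from dvd_diff[OF 1 2] show ?case by simp
next
  case (Suc m)
  have IH: "Polynomial.monom 1 N dvd det (mat 1 - A) - det (mat 1 - B)" if "lifted_sum S (Suc d) A B" for A B
    by (rule Suc.hyps(1)[OF _ that]) (use Suc.hyps(2) in auto)
  \<comment> \<open>Inner induction over the terms of \<open>A\<close>, with \<open>A'\<close>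
    collecting everything of order above \<open>d\<close>. When no term of \<open>A\<close> is left,
    the outer hypothesis for \<open>Suc d\<close> applies to \<open>A'\<close>.\<close>
  have "Polynomial.monom 1 N dvd det (mat 1 - (A + A')) - det (mat 1 - (B + B'))"
    if "lifted_sum S d A B" "lifted_sum S (Suc d) A' B'" for A A' B B'
    using that
  proof (induction arbitrary: A' B' rule: lifted_sum.induct)
    case zero
    then show ?case using IH by simp
  next
    case (add s e A B)
    show ?case
    proof (cases "Suc d \<le> e")
      case True
      have "lifted_sum S (Suc d) (scaled_lift e (fst s) + A') (scaled_lift e (snd s) + B')"
        by (rule lifted_sum.add[OF add.hyps(1) True add.prems])
      from add.IH[OF this] show ?thesis by (simp only: ac_simps)
    next
      case False
      then have e: "e = d" using add.hyps(2) by simp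
      define a b where "a = scaled_lift d (fst s)" and "b = A + A'"
      define a' b' where "a' = scaled_lift d (snd s)" and "b' = B + B'"
      have b: "lifted_sum S d b b'" unfolding b_def b'_def
        by (rule lifted_sum_add[OF add.hyps(3) lifted_sum_mono[OF add.prems]]) simp
      have am: "lifted_sum S (d + k) (a ** C) (a' ** D)" if "lifted_sum S k C D" for k C D
        unfolding a_def a'_def by (rule lifted_sum_mult[OF mult add.hyps(1) that])
      have geo: "lifted_sum S d (geometric a b k) (geometric a' b' k)" for k
      proof (induction k)
        case (Suc k)
        show ?case unfolding geometric.simps
          by (rule lifted_sum_add[OF b lifted_sum_mono[OF am[OF Suc]]]) simp
      qed (simp add: lifted_sum.zero)
      have pow: "lifted_sum S k (matrix_power a b k) (matrix_power a' b' k)" for k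
      proof (induction k)
        case 0
        show ?case using lifted_sum_mono[OF b] by simp
      next
        case (Suc k)
        show ?case unfolding matrix_power.simps
          by (rule lifted_sum_mono[OF am[OF Suc]]) (use \<open>1 \<le> d\<close> in simp)
      qed
      \<comment> \<open>With length \<open>Suc N\<close>, \<open>g\<close> unfolds to
        \<open>A + A' + a ** geometric a b N\<close>. The last summand has order at least
        \<open>2 d\<close>, hence at least \<open>Suc d\<close> because \<open>d \<ge> 1\<close>, so
        it joins \<open>A'\<close> and the inner hypothesis for the shorter sum \<open>A\<close>
        covers \<open>g\<close>. The tail of the factorization has order at least
        \<open>Suc N\<close>.\<close>
      define g g' where "g = geometric a b (Suc N)" and "g' = geometric a' b' (Suc N)"
      have "lifted_sum S (d + d) (a ** geometric a b N) (a' ** geometric a' b' N)"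
        by (rule am[OF geo])
      then have "lifted_sum S (Suc d) (a ** geometric a b N) (a' ** geometric a' b' N)"
        by (rule lifted_sum_mono) (use \<open>1 \<le> d\<close> in simp)
      from add.IH[OF lifted_sum_add[OF add.prems this]]
      have gg: "Polynomial.monom 1 N dvd det (mat 1 - g) - det (mat 1 - g')"
        by (simp add: g_def g'_def b_def b'_def add.assoc)
      have aa: "det (mat 1 - a) = det (mat 1 - a')"
        unfolding a_def a'_def by (rule det_scaled_lift[OF add.hyps(1)])
      have dN: "Polynomial.monom 1 N dvd C" if "Polynomial.monom 1 (Suc N) dvd C" for C :: "'a poly"
      proof -
        have "Polynomial.monom (1::'a) (Suc N) = Polynomial.monom 1 N * Polynomial.monom 1 1" by (simp add: mult_monom)
        then have "Polynomial.monom (1::'a) N dvd Polynomial.monom 1 (Suc N)" by (rule dvdI)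
        then show ?thesis using that by (rule dvd_trans)
      qed
      have pN: "Polynomial.monom 1 N dvd matrix_power a b (Suc N) $ i $ j"
        "Polynomial.monom 1 N dvd matrix_power a' b' (Suc N) $ i $ j" for i j
        using lifted_sum_dvd[OF pow[of "Suc N"], of i j] dN by auto
      have 1: "Polynomial.monom 1 N dvd det (mat 1 - (a + b)) - det ((mat 1 - a) ** (mat 1 - g))"
        unfolding g_def geometric_factor by (rule dvd_det_diff) (use pN(1) in simp)
      have 2: "Polynomial.monom 1 N dvd det (mat 1 - (a' + b')) - det ((mat 1 - a') ** (mat 1 - g'))"
        unfolding g'_def geometric_factor by (rule dvd_det_diff) (use pN(2) in simp)
      have 3: "Polynomial.monom 1 N dvd det (mat 1 - a) * (det (mat 1 - g) - det (mat 1 - g'))"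
        by (rule dvd_mult[OF gg])
      have "det (mat 1 - (a + b)) - det (mat 1 - (a' + b')) =
          (det (mat 1 - (a + b)) - det ((mat 1 - a) ** (mat 1 - g)))
          - (det (mat 1 - (a' + b')) - det ((mat 1 - a') ** (mat 1 - g')))
          + det (mat 1 - a) * (det (mat 1 - g) - det (mat 1 - g'))"
        by (simp add: det_mul aa[symmetric] algebra_simps)
      also have "Polynomial.monom 1 N dvd \<dots>" by (rule dvd_add[OF dvd_diff[OF 1 2] 3])
      finally show ?thesis by (simp add: e a_def a'_def b_def b'_def add.assoc)
    qed
  qed
  from this[OF Suc.prems(1) lifted_sum.zero] show ?case by simp
qed

text \<open>After multiplication by \<open>t\<close>, the two determinants agree modulo every power
  of \<open>t\<close>. They are polynomials, hence equal, and setting \<open>t = 1\<close> removes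
  the auxiliary factor.\<close>

theorem det_additive_span:
  assumes "x \<in> additive_span S"
  shows "det (mat 1 - fst x) = det (mat 1 - snd x)"
proof -
  have lift_add: "scaled_lift 1 (A + B) = scaled_lift 1 A + scaled_lift 1 B" for A B :: "'a ^'n ^'n"
    by (simp add: scaled_lift_def map_matrix_def vec_eq_iff add_monom)
  have "lifted_sum S 1 (scaled_lift 1 (fst x)) (scaled_lift 1 (snd x))"
    using assms
  proof induction
    case zero
    have "scaled_lift 1 (0 :: 'a ^'n ^'n) = 0" by (simp add: scaled_lift_def map_matrix_def vec_eq_iff)
    then show ?case by (simp add: lifted_sum.zero)
  next
    case (add s x)
    show ?case unfolding fst_add snd_add lift_add
      by (rule lifted_sum.add[OF add.hyps(1) order_refl add.IH])
  qed
  from lifted_sum_det[OF this]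
  have dvd: "Polynomial.monom 1 N dvd det (mat 1 - scaled_lift 1 (fst x)) - det (mat 1 - scaled_lift 1 (snd x))"
    (is "_ dvd ?p") for N by simp
  have "?p = 0"
  proof (rule ccontr)
    assume "?p \<noteq> 0"
    from dvd_imp_degree_le[OF dvd[of "Suc (Polynomial.degree ?p)"] this] show False
      by (simp add: degree_monom_eq)
  qed
  then have "poly ?p 1 = 0" by simp
  moreover have "map_matrix (\<lambda>p. poly p 1) (mat 1 - scaled_lift 1 A) = mat 1 - A" for A :: "'a ^'n ^'n"
    by (simp add: vec_eq_iff map_matrix_def scaled_lift_def poly_monom mat_def)
  ultimately show ?thesis by (simp add: poly_det)
qed

end

text \<open>Range and kernel of \<open>e\<close> are complementary, so in a basis adapted to them
  \<open>e\<close> is diagonal with entries \<open>1\<close> and \<open>0\<close>.\<close>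

lemma det_idempotent:
  fixes e :: "'a::field ^'n ^'n"
  assumes e: "e ** e = e"
  shows "det (mat 1 - mat x ** e) = (1 - x) ^ vec.dim (range ((*v) e))"
proof -
  let ?R = "range ((*v) e)" and ?K = "{v. e *v v = 0}"
  have ee: "e *v (e *v v) = e *v v" for v by (simp add: matrix_vector_mul_assoc e)
  have R: "vec.subspace ?R"
  proof (rule vec.subspaceI)
    show "0 \<in> ?R" by (rule range_eqI[of _ _ 0]) simp
    fix c u v assume "u \<in> ?R" "v \<in> ?R"
    then obtain u' v' where *: "u = e *v u'" "v = e *v v'" by (elim rangeE)
    show "c *s u \<in> ?R" by (rule range_eqI[of _ _ "c *s u'"]) (simp add: * vector_scalar_commute)
    show "u + v \<in> ?R"
      by (rule range_eqI[of _ _ "u' + v'"]) (simp add: * matrix_vector_right_distrib)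
  qed
  have K: "vec.subspace ?K" unfolding vec.subspace_def
    by (auto simp: matrix_vector_right_distrib vector_scalar_commute)
  obtain B1 where B1: "B1 \<subseteq> ?R" "vec.independent B1" "?R \<subseteq> vec.span B1" "card B1 = vec.dim ?R"
    by (rule vec.basis_exists[of ?R])
  obtain B2 where B2: "B2 \<subseteq> ?K" "vec.independent B2" "?K \<subseteq> vec.span B2" "card B2 = vec.dim ?K"
    by (rule vec.basis_exists[of ?K])
  have fin: "finite B1" "finite B2" using B1(2) B2(2) by (auto intro: vec.finiteI_independent)
  have RK: "?R \<inter> ?K = {0}" using ee vec.subspace_0[OF R] vec.subspace_0[OF K] by auto
  have decomp: "v = e *v v + (v - e *v v)" "v - e *v v \<in> ?K" for v
    by (simp_all add: matrix_vector_mult_diff_distrib ee)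
  have "{u + v | u v. u \<in> ?R \<and> v \<in> ?K} = UNIV"
    using decomp by (intro equalityI subset_UNIV subsetI CollectI) blast
  then have dim: "CARD('n) = vec.dim ?R + vec.dim ?K"
    using vec.dim_sums_Int[OF R K] by (simp add: RK card_cart_basis)
  have disj: "B1 \<inter> B2 = {}"
  proof -
    have "B1 \<inter> B2 \<subseteq> {0}" using B1(1) B2(1) RK by blast
    moreover have "0 \<notin> B1" using B1(2) vec.dependent_zero by blast
    ultimately show ?thesis by blast
  qed
  have "card (B1 \<union> B2) = CARD('n)"
    using fin disj by (simp add: card_Un_disjoint B1(4) B2(4) dim)
  then obtain f where f: "bij_betw f (UNIV :: 'n set) (B1 \<union> B2)"
    using finite_same_card_bij[of "UNIV :: 'n set" "B1 \<union> B2"] fin by auto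
  define P :: "'a ^'n ^'n" where "P = (\<chi> i j. f j $ i)"
  define d :: "'n \<Rightarrow> 'a" where "d = (\<lambda>j. if f j \<in> B1 then 1 else 0)"
  have col: "column j P = f j" for j by (simp add: column_def P_def)
  have "columns P = B1 \<union> B2" using f by (auto simp: columns_def col bij_betw_def)
  moreover have "vec.span (B1 \<union> B2) = UNIV"
  proof (intro equalityI subset_UNIV subsetI)
    fix v
    have "e *v v \<in> vec.span (B1 \<union> B2)" using B1(3) vec.span_mono[of B1 "B1 \<union> B2"] by blast
    moreover have "v - e *v v \<in> vec.span (B1 \<union> B2)"
      using decomp(2)[of v] B2(3) vec.span_mono[of B2 "B1 \<union> B2"] by blast
    ultimately show "v \<in> vec.span (B1 \<union> B2)" using decomp(1)[of v] by (metis vec.span_add)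
  qed
  ultimately have "\<exists>Q. P ** Q = mat 1" by (simp add: matrix_right_invertible_span_columns)
  then have "invertible P" by (simp add: invertible_right_inverse)
  then have P0: "det P \<noteq> 0" by (simp add: invertible_det_nz)
  define D :: "'a ^'n ^'n" where "D = (\<chi> i j. if i = j then 1 - x * d i else 0)"
  have ef: "e *v f j = d j *s f j" for j
  proof (cases "f j \<in> B1")
    case True
    then have "f j \<in> ?R" using B1(1) by blast
    then show ?thesis using True ee by (auto simp: d_def)
  next
    case False
    then have "f j \<in> B2" using f by (auto simp: bij_betw_def)
    then show ?thesis using False B2(1) by (auto simp: d_def)
  qed
  have "(mat 1 - mat x ** e) ** P = P ** D"
  proof -
    have "((mat 1 - mat x ** e) ** P) $ i $ j = (P ** D) $ i $ j" for i j
    proof -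
      have "(e ** P) $ i $ j = (e *v f j) $ i"
        by (simp add: matrix_matrix_mult_def matrix_vector_mult_def P_def)
      then have "(e ** P) $ i $ j = d j * f j $ i" by (simp add: ef)
      moreover have "(P ** D) $ i $ j = f j $ i * (1 - x * d j)"
        by (simp add: matrix_matrix_mult_def P_def D_def if_distrib[of "\<lambda>x. _ * x"] cong: if_cong)
      ultimately show ?thesis
        by (simp add: matrix_diff_rdistrib mat_mult_entry P_def algebra_simps
            flip: matrix_mul_assoc)
    qed
    then show ?thesis by (simp add: vec_eq_iff)
  qed
  then have "det (mat 1 - mat x ** e) * det P = det P * det D" by (metis det_mul)
  then have "det (mat 1 - mat x ** e) = det D" using P0 by simp
  also have "det D = (\<Prod>i\<in>UNIV. 1 - x * d i)" by (subst det_diagonal) (simp_all add: D_def)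
  also have "\<dots> = (\<Prod>i\<in>UNIV. if f i \<in> B1 then 1 - x else 1)"
    by (rule prod.cong) (simp_all add: d_def)
  also have "\<dots> = (1 - x) ^ card {i. f i \<in> B1}" by (simp add: prod.If_cases)
  also have "card {i. f i \<in> B1} = card B1"
  proof -
    have "f ` {i. f i \<in> B1} = B1" using f by (auto simp: bij_betw_def)
    moreover have "inj_on f {i. f i \<in> B1}" using f by (auto simp: bij_betw_def inj_on_def)
    ultimately show ?thesis by (metis card_image)
  qed
  finally show ?thesis by (simp add: B1(4))
qed

text \<open>The rank is read off as the degree of \<open>(1 - x) ^ rank\<close>, which recovers it
  as a natural number in every characteristic.\<close>

lemma idempotent_rank_eq:
  fixes e f :: "'a::field ^'n ^'n"
  assumes inf: "infinite (UNIV :: 'a set)" and "e ** e = e" "f ** f = f"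
    and det: "\<And>x. det (mat 1 - mat x ** e) = det (mat 1 - mat x ** f)"
  shows "vec.dim (range ((*v) e)) = vec.dim (range ((*v) f))"
proof -
  let ?m = "vec.dim (range ((*v) e))" and ?n = "vec.dim (range ((*v) f))"
  let ?p = "[:1, -1:] ^ ?m - [:1, -1:] ^ ?n :: 'a poly"
  have "poly ?p x = 0" for x
    using det[of x] unfolding det_idempotent[OF assms(2)] det_idempotent[OF assms(3)] by simp
  then have "{x. poly ?p x = 0} = UNIV" by simp
  then have "?p = 0" using poly_roots_finite[of ?p] inf by auto
  then have "Polynomial.degree ([:1, -1:] ^ ?m :: 'a poly) = Polynomial.degree ([:1, -1:] ^ ?n :: 'a poly)"
    by simp
  then show ?thesis by (simp add: degree_power_eq)
qed

section \<open>The Brauer--Nesbitt theorem\<close>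

definition pair_mult :: "('a::comm_ring_1 ^'n ^'n) \<times> ('a ^'n ^'n) \<Rightarrow>
    ('a ^'n ^'n) \<times> ('a ^'n ^'n) \<Rightarrow> ('a ^'n ^'n) \<times> ('a ^'n ^'n)" where
  "pair_mult a b = (fst a ** fst b, snd a ** snd b)"

lemma pair_mult_simps [simp]:
  "fst (pair_mult a b) = fst a ** fst b" "snd (pair_mult a b) = snd a ** snd b"
  by (simp_all add: pair_mult_def)

lemma pair_mult_add_left: "pair_mult (a + b) c = pair_mult a c + pair_mult b c"
  by (simp add: pair_mult_def matrix_matrix_mult_def vec_eq_iff distrib_right sum.distrib)

lemma pair_mult_add_right: "pair_mult a (b + c) = pair_mult a b + pair_mult a c"
  by (simp add: pair_mult_def matrix_add_ldistrib)

lemma pair_mult_diff_right: "pair_mult a (b - c) = pair_mult a b - pair_mult a c"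
  by (simp add: pair_mult_def matrix_diff_ldistrib)

lemma pair_mult_diff_left: "pair_mult (a - b) c = pair_mult a c - pair_mult b c"
  by (simp add: pair_mult_def matrix_diff_rdistrib)

lemma pair_mult_zero_left: "pair_mult 0 a = 0"
  by (simp add: pair_mult_def matrix_matrix_mult_def vec_eq_iff prod_eq_iff)

lemma op_sub_finite_sum:
  assumes "op_sub I act U" "finite A" "\<And>i. i \<in> A \<Longrightarrow> f i \<in> U"
  shows "sum f A \<in> U"
  using assms(2,3)
  by (induction A rule: finite_induct) (simp_all add: op_subD(1,4)[OF assms(1)])

context matrix_pair_semigroup
begin

lemma one_S: "(mat 1, mat 1) \<in> S" by (rule scalar)

lemma pair_mult_S: "s \<in> S \<Longrightarrow> t \<in> S \<Longrightarrow> pair_mult s t \<in> S"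
  unfolding pair_mult_def by (rule mult)

lemma S_subset_span: "s \<in> S \<Longrightarrow> s \<in> additive_span S"
  using additive_span.add[OF _ additive_span.zero] by force

lemma span_add: "x \<in> additive_span S \<Longrightarrow> y \<in> additive_span S \<Longrightarrow> x + y \<in> additive_span S"
  by (induction rule: additive_span.induct) (auto simp: add.assoc intro: additive_span.intros)

lemma span_mult_S: "x \<in> additive_span S \<Longrightarrow> s \<in> S \<Longrightarrow> pair_mult s x \<in> additive_span S"
proof (induction rule: additive_span.induct)
  case zero
  have "pair_mult s 0 = 0" by (simp add: pair_mult_def matrix_matrix_mult_def vec_eq_iff prod_eq_iff)
  then show ?case by (simp add: additive_span.zero)
next
  case (add t x)
  have "pair_mult s t + pair_mult s x \<in> additive_span S"
    by (rule additive_span.add[OF pair_mult_S[OF add.prems add.hyps(1)] add.IH[OF add.prems]])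
  then show ?case by (simp only: pair_mult_add_right)
qed

lemma span_op_sub: "op_sub S pair_mult (additive_span S)"
proof (rule op_subI)
  fix x y assume xy: "x \<in> additive_span S" "y \<in> additive_span S"
  have "pair_mult (mat (-1), mat (-1)) y = - y"
    by (simp add: prod_eq_iff vec_eq_iff mat_mult_entry)
  then have "- y \<in> additive_span S" using span_mult_S[OF xy(2) scalar[of "-1"]] by simp
  from span_add[OF xy(1) this] show "x - y \<in> additive_span S" by simp
qed (auto intro: additive_span.zero span_mult_S)

lemma span_stable:
  assumes "a \<in> additive_span S" "op_sub S act U" "x \<in> U"
    and "\<And>x. act 0 x = 0" "\<And>a b x. act (a + b) x = act a x + act b x"
  shows "act a x \<in> U"
  using assms(1)
proof induction
  case zero
  show ?case using op_subD(1)[OF assms(2)] by (simp add: assms(4))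
next
  case (add s a)
  show ?case unfolding assms(5)
    by (rule op_subD(4)[OF assms(2) op_subD(5)[OF assms(2) add.hyps(1) assms(3)] add.IH])
qed

lemmas span_stable_pair =
  span_stable[where act = pair_mult, OF _ _ _ pair_mult_zero_left pair_mult_add_left]

lemma span_stable_snd:
  assumes "a \<in> additive_span S" "op_sub S (\<lambda>s v. snd s *v v) U" "x \<in> U"
  shows "snd a *v x \<in> U"
  by (rule span_stable[OF assms]) (simp_all add: matrix_vector_mult_add_rdistrib)

end

locale semisimple_matrix_pairs = matrix_pair_semigroup +
  assumes ss1: "op_semisimple S (\<lambda>s v. fst s *v v)"
    and ss2: "op_semisimple S (\<lambda>s v. snd s *v v)"
begin

text \<open>Left multiplication acts on each column separately, so the pairs of matrices are a sum
  of copies of the first and of the second representation, one for each column.\<close>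

lemma op_semisimple_pair_mult: "op_semisimple S pair_mult"
  unfolding op_semisimple_def
proof (intro allI impI, elim conjE)
  fix T :: "(('a ^'b ^'b) \<times> ('a ^'b ^'b)) set"
  assume T: "op_sub S pair_mult T" and simp_T: "\<forall>W. op_simple S pair_mult W \<longrightarrow> W \<subseteq> T"
  define col where "col j v = (\<chi> i k. if k = j then v $ i else 0)" for j :: 'b and v :: "'a ^'b"
  have col_diff: "col j (v - w) = col j v - col j w" for j v w
    by (simp add: col_def vec_eq_iff)
  have col_0: "v = 0" if "col j v = 0" for j v
    using that by (simp add: col_def vec_eq_iff) (metis (full_types))
  have col_mult: "A ** col j v = col j (A *v v)" for A j v
    by (simp add: col_def vec_eq_iff matrix_matrix_mult_def matrix_vector_mult_def)
  have zero_mult: "A ** (0 :: 'a ^'b ^'b) = 0" for A :: "'a ^'b ^'b"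
    by (simp add: matrix_matrix_mult_def vec_eq_iff)
  have 1: "(col j v, 0) \<in> T" for j v
  proof -
    let ?\<phi> = "\<lambda>v. (col j v, 0 :: 'a ^'b ^'b)"
    have eqv: "\<exists>t\<in>S. \<forall>x. ?\<phi> (fst s *v x) = pair_mult t (?\<phi> x)" if "s \<in> S" for s
      by (rule bexI[OF _ that]) (simp add: pair_mult_def col_mult zero_mult)
    have eqv': "\<exists>s\<in>S. \<forall>x. ?\<phi> (fst s *v x) = pair_mult t (?\<phi> x)" if "t \<in> S" for t
      by (rule bexI[OF _ that]) (simp add: pair_mult_def col_mult zero_mult)
    have diff: "?\<phi> (v - w) = ?\<phi> v - ?\<phi> w" for v w by (simp add: col_diff)
    have inj: "v = 0" if "?\<phi> v = 0" for v
      by (rule col_0[of j]) (use that in \<open>simp add: zero_prod_def\<close>)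
    have "op_sub S (\<lambda>s v. fst s *v v) {v. ?\<phi> v \<in> T}"
      by (rule op_sub_vimage[OF T diff eqv])
    then have "{v. ?\<phi> v \<in> T} = UNIV"
    proof (rule op_semisimpleD[OF ss1])
      fix W assume "op_simple S (\<lambda>s v. fst s *v v) W"
      then have "op_simple S pair_mult (?\<phi> ` W)"
        by (rule op_simple_image) (rule diff inj eqv eqv', assumption?)+
      then have "?\<phi> ` W \<subseteq> T" using simp_T by simp
      then show "W \<subseteq> {v. ?\<phi> v \<in> T}" by auto
    qed
    then show ?thesis by auto
  qed
  have 2: "(0, col j v) \<in> T" for j v
  proof -
    let ?\<phi> = "\<lambda>v. (0 :: 'a ^'b ^'b, col j v)"
    have eqv: "\<exists>t\<in>S. \<forall>x. ?\<phi> (snd s *v x) = pair_mult t (?\<phi> x)" if "s \<in> S" for s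
      by (rule bexI[OF _ that]) (simp add: pair_mult_def col_mult zero_mult)
    have eqv': "\<exists>s\<in>S. \<forall>x. ?\<phi> (snd s *v x) = pair_mult t (?\<phi> x)" if "t \<in> S" for t
      by (rule bexI[OF _ that]) (simp add: pair_mult_def col_mult zero_mult)
    have diff: "?\<phi> (v - w) = ?\<phi> v - ?\<phi> w" for v w by (simp add: col_diff)
    have inj: "v = 0" if "?\<phi> v = 0" for v
      by (rule col_0[of j]) (use that in \<open>simp add: zero_prod_def\<close>)
    have "op_sub S (\<lambda>s v. snd s *v v) {v. ?\<phi> v \<in> T}"
      by (rule op_sub_vimage[OF T diff eqv])
    then have "{v. ?\<phi> v \<in> T} = UNIV"
    proof (rule op_semisimpleD[OF ss2])
      fix W assume "op_simple S (\<lambda>s v. snd s *v v) W"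
      then have "op_simple S pair_mult (?\<phi> ` W)"
        by (rule op_simple_image) (rule diff inj eqv eqv', assumption?)+
      then have "?\<phi> ` W \<subseteq> T" using simp_T by simp
      then show "W \<subseteq> {v. ?\<phi> v \<in> T}" by auto
    qed
    then show ?thesis by auto
  qed
  have col_sum: "(\<Sum>j\<in>UNIV. col j (column j A)) = A" for A
    by (simp add: col_def vec_eq_iff column_def)
  have "x \<in> T" for x
  proof -
    have "(\<Sum>j\<in>UNIV. (col j (column j (fst x)), 0)) + (\<Sum>j\<in>UNIV. (0, col j (column j (snd x)))) \<in> T"
      by (intro op_subD(4)[OF T] op_sub_finite_sum[OF T] 1 2 finite)
    also have "(\<Sum>j\<in>UNIV. (col j (column j (fst x)), 0)) + (\<Sum>j\<in>UNIV. (0, col j (column j (snd x)))) = x"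
      by (simp add: prod_eq_iff fst_sum snd_sum col_sum)
    finally show ?thesis .
  qed
  then show "T = UNIV" by auto
qed

text \<open>
  The idempotent of the complement of the annihilator of \<open>s\<close> identifies the submodule generated
  by \<open>s\<close> with a left ideal that is a direct summand.
\<close>

lemma annihilator_idempotent:
  obtains e where "e \<in> additive_span S" "pair_mult e e = e" "fst e *v s = s"
    "\<forall>a\<in>additive_span S. fst a *v s = 0 \<longrightarrow> pair_mult a e = 0"
proof -
  let ?A = "additive_span S" and ?one = "(mat 1, mat 1) :: ('a ^'b ^'b) \<times> ('a ^'b ^'b)"
  define L where "L = {a \<in> ?A. fst a *v s = 0}"
  note A = op_subD[OF span_op_sub]
  have L: "op_sub S pair_mult L"
  proof (rule op_subI)
    show "0 \<in> L" using A(1) by (simp add: L_def)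
    show "x - y \<in> L" if "x \<in> L" "y \<in> L" for x y
      using that A(2) by (simp add: L_def matrix_vector_mult_diff_rdistrib)
    show "pair_mult i x \<in> L" if "i \<in> S" "x \<in> L" for i x
      using that A(5) by (simp add: L_def flip: matrix_vector_mul_assoc)
  qed
  \<comment> \<open>The complement is taken among all pairs of matrices, but
    \<open>e = 1 - l\<close> falls back into the span.\<close>
  obtain V where V: "op_sub S pair_mult V" "L \<inter> V = {0}" "\<forall>x. \<exists>u\<in>L. \<exists>v\<in>V. x = u + v"
    by (rule op_semisimple_complement[OF pair_mult_add_right op_semisimple_pair_mult L])
  obtain l e where le: "l \<in> L" "e \<in> V" "?one = l + e" using spec[OF V(3), of ?one] by (elim bexE)
  have e: "e = ?one - l" using le(3) by (simp add: algebra_simps)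
  have eA: "e \<in> ?A" unfolding e
    by (rule A(2)) (use le(1) S_subset_span[OF one_S] in \<open>simp_all add: L_def\<close>)
  have one_left: "pair_mult ?one a = a" "pair_mult a ?one = a" for a
    by (simp_all add: prod_eq_iff)
  \<comment> \<open>The product \<open>a e = a - a l\<close> lies in \<open>L\<close> and, by
    stability of \<open>V\<close>, also in \<open>V\<close>.\<close>
  have ann: "pair_mult a e = 0" if a: "a \<in> ?A" "fst a *v s = 0" for a
  proof -
    have aL: "a \<in> L" using a by (simp add: L_def)
    have "pair_mult a e = a - pair_mult a l" by (simp add: e pair_mult_diff_right one_left)
    also have "\<dots> \<in> L" by (rule op_subD(2)[OF L aL span_stable_pair[OF a(1) L le(1)]])
    finally have "pair_mult a e \<in> L \<inter> V" using span_stable_pair[OF a(1) V(1) le(2)] by simp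
    then show ?thesis unfolding V(2) by simp
  qed
  show thesis
  proof (rule that[OF eA])
    show "\<forall>a\<in>?A. fst a *v s = 0 \<longrightarrow> pair_mult a e = 0" using ann by simp
    \<comment> \<open>As \<open>l\<close> kills \<open>s\<close>, the annihilation property applies
      to \<open>l = 1 - e\<close> itself and yields idempotence.\<close>
    have "pair_mult l e = 0" by (rule ann) (use le(1) in \<open>simp_all add: L_def\<close>)
    then have "pair_mult (?one - e) e = 0" by (simp add: e)
    then show "pair_mult e e = e" by (simp add: pair_mult_diff_left one_left)
    show "fst e *v s = s"
      using le(1) by (simp add: e L_def matrix_vector_mult_diff_rdistrib)
  qed
qed

text \<open>Linearity is implied: the scalar pairs belong to \<open>S\<close>, so equivariance
  contains homogeneity.\<close>

definition intertwiner :: "('a ^'b \<Rightarrow> 'a ^'b) \<Rightarrow> bool" where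
  "intertwiner f \<longleftrightarrow> (\<forall>u v. f (u + v) = f u + f v) \<and> (\<forall>s\<in>S. \<forall>v. f (fst s *v v) = snd s *v f v)"

lemma intertwinerD:
  assumes "intertwiner f"
  shows "f (u + v) = f u + f v" "f 0 = 0" "f (u - v) = f u - f v" "s \<in> S \<Longrightarrow> f (fst s *v v) = snd s *v f v"
    "f (c *s v) = c *s f v" "a \<in> additive_span S \<Longrightarrow> f (fst a *v v) = snd a *v f v"
proof -
  show add: "f (u + v) = f u + f v" for u v using assms by (simp add: intertwiner_def)
  show zero: "f 0 = 0" using add[of 0 0] by simp
  have minus: "f (- v) = - f v" for v using add[of v "- v"] zero by (simp add: eq_neg_iff_add_eq_0 add.commute)
  show "f (u - v) = f u - f v" using add[of u "- v"] minus by simp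
  show eqv: "f (fst s *v v) = snd s *v f v" if "s \<in> S" for s v
    using assms that by (simp add: intertwiner_def)
  have scal: "mat c *v v = c *s v" for v :: "'a ^'b" and c
    by (simp add: vec_eq_iff matrix_vector_mult_def mat_def if_distrib[of "\<lambda>x. x * _"] cong: if_cong)
  show "f (c *s v) = c *s f v" using eqv[OF scalar, of c v] by (simp add: scal)
  show "f (fst a *v v) = snd a *v f v" if "a \<in> additive_span S"
    using that by induction (simp_all add: zero add matrix_vector_mult_add_rdistrib eqv)
qed

lemma intertwiner_linear: "intertwiner f \<Longrightarrow> Vector_Spaces.linear (*s) (*s) f"
  by (simp add: Vector_Spaces.linear_iff vec.vector_space_axioms intertwinerD)

lemma intertwiner_ker_subspace: "intertwiner f \<Longrightarrow> vec.subspace {v. f v = 0}"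
  by (rule vec.subspaceI) (simp_all add: intertwinerD)

text \<open>
  Comparing the ranks of the two components of \<open>e\<close> shows that \<open>snd e\<close> does not vanish on a
  complement \<open>N\<close> of the range of \<open>f\<close>. Hence there is a second intertwiner, with values in \<open>N\<close>,
  that does not kill \<open>s\<close>, and adding it to \<open>f\<close> shrinks the kernel.
\<close>

lemma intertwiner_smaller_kernel:
  assumes f: "intertwiner f" and s: "f s = 0" "s \<noteq> 0"
  shows "\<exists>h. intertwiner h \<and> vec.dim {v. h v = 0} < vec.dim {v. f v = 0}"
proof -
  let ?A = "additive_span S"
  note A = op_subD[OF span_op_sub]
  obtain e where e: "e \<in> ?A" "pair_mult e e = e" "fst e *v s = s"
    and ann': "\<forall>a\<in>?A. fst a *v s = 0 \<longrightarrow> pair_mult a e = 0"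
    by (rule annihilator_idempotent[of s])
  have ann: "pair_mult a e = 0" if "a \<in> ?A" "fst a *v s = 0" for a using ann' that by simp
  have e1: "fst e ** fst e = fst e" and e2: "snd e ** snd e = snd e"
    using arg_cong[OF e(2), of fst] arg_cong[OF e(2), of snd] by simp_all
  \<comment> \<open>The multiples \<open>c e\<close> stay in the span, which gives the determinant
    identity for all \<open>c\<close> and hence equality of ranks.\<close>
  have rank: "vec.dim (range ((*v) (fst e))) = vec.dim (range ((*v) (snd e)))"
  proof (rule idempotent_rank_eq[OF inf e1 e2])
    fix c
    have "pair_mult (mat c, mat c) e \<in> ?A" by (rule A(5)[OF scalar e(1)])
    from det_additive_span[OF this]
    show "det (mat 1 - mat c ** fst e) = det (mat 1 - mat c ** snd e)" by simp
  qed
  have im: "op_sub S (\<lambda>s v. snd s *v v) (range f)"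
  proof (rule op_subI)
    show "0 \<in> range f" by (rule range_eqI[of _ _ 0]) (simp add: intertwinerD[OF f])
    show "x - y \<in> range f" if xy: "x \<in> range f" "y \<in> range f" for x y
    proof -
      obtain u v where "x = f u" "y = f v" using xy by (elim rangeE)
      then show ?thesis by (intro range_eqI[of _ _ "u - v"]) (simp add: intertwinerD[OF f])
    qed
    show "snd i *v x \<in> range f" if ix: "i \<in> S" "x \<in> range f" for i x
    proof -
      obtain u where "x = f u" using ix(2) by (elim rangeE)
      then show ?thesis using ix(1)
        by (intro range_eqI[of _ _ "fst i *v u"]) (simp add: intertwinerD[OF f])
    qed
  qed
  obtain N where N: "op_sub S (\<lambda>s v. snd s *v v) N" "range f \<inter> N = {0}"
      "\<forall>x. \<exists>u\<in>range f. \<exists>v\<in>N. x = u + v"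
    by (rule op_semisimple_complement[OF matrix_vector_right_distrib ss2 im])
  \<comment> \<open>If \<open>snd e\<close> vanished on \<open>N\<close>, its range would be
    contained in the image under \<open>f\<close> of the range of \<open>fst e\<close>. The latter
    contains \<open>s\<close>, which \<open>f\<close> kills, so the dimension would drop, against
    equality of ranks.\<close>
  have "\<exists>v\<in>N. snd e *v v \<noteq> 0"
  proof (rule ccontr)
    assume "\<not> (\<exists>v\<in>N. snd e *v v \<noteq> 0)"
    then have N0: "snd e *v v = 0" if "v \<in> N" for v using that by simp
    let ?R = "range ((*v) (fst e))"
    have "s \<in> ?R" using e(3) by (metis rangeI)
    \<comment> \<open>A basis starting with \<open>s\<close>, so that \<open>f\<close> loses at
      least one basis vector.\<close>
    then obtain B where B: "{s} \<subseteq> B" "B \<subseteq> ?R" "vec.independent B" "?R \<subseteq> vec.span B"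
      using vec.maximal_independent_subset_extend[of "{s}" ?R] s(2) by auto
    have finB: "finite B" by (rule vec.finiteI_independent[OF B(3)])
    have "range ((*v) (snd e)) \<subseteq> vec.span (f ` (B - {s}))"
    proof
      fix y assume "y \<in> range ((*v) (snd e))"
      then obtain w where w: "y = snd e *v w" by (elim rangeE)
      obtain u v where uv: "u \<in> range f" "v \<in> N" "w = u + v" using spec[OF N(3), of w] by (elim bexE)
      obtain u' where u': "u = f u'" using uv(1) by (elim rangeE)
      have "y = f (fst e *v u')"
        by (simp add: w uv(3) matrix_vector_right_distrib N0[OF uv(2)] u' intertwinerD(6)[OF f e(1)])
      moreover have "fst e *v u' \<in> vec.span B" using B(4) by auto
      moreover have "f ` vec.span B = vec.span (f ` B)"
        by (rule vec.linear_span_image[OF intertwiner_linear[OF f], symmetric])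
      ultimately have "y \<in> vec.span (f ` B)" by auto
      also have "f ` B = insert 0 (f ` (B - {s}))" using B(1) s(1) by auto
      finally show "y \<in> vec.span (f ` (B - {s}))" by (simp only: vec.span_insert_0)
    qed
    then have "vec.dim (range ((*v) (snd e))) \<le> card (f ` (B - {s}))"
      by (rule vec.dim_le_card) (simp add: finB)
    also have "\<dots> \<le> card (B - {s})" by (rule card_image_le) (simp add: finB)
    also have "\<dots> < card B" using B(1) finB by (intro psubset_card_mono) auto
    also have "card B = vec.dim ?R" by (rule vec.basis_card_eq_dim[OF B(2,4,3)])
    finally show False using rank by simp
  qed
  then obtain v1 where v1: "v1 \<in> N" "snd e *v v1 \<noteq> 0" by (elim bexE)
  \<comment> \<open>Now \<open>snd e\<close> fixes \<open>v0\<close> as \<open>fst e\<close> fixes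
    \<open>s\<close>. Therefore \<open>fst a *v s = 0\<close> implies \<open>a e = 0\<close> and so
    \<open>snd a *v v0 = 0\<close>.\<close>
  define v0 where "v0 = snd e *v v1"
  have v0: "v0 \<in> N" "v0 \<noteq> 0" "snd e *v v0 = v0"
    unfolding v0_def using span_stable_snd[OF e(1) N(1) v1(1)] v1(2)
    by (simp_all add: matrix_vector_mul_assoc e2)
  let ?M = "{fst a *v s | a. a \<in> ?A}"
  have MI: "fst a *v s \<in> ?M" if "a \<in> ?A" for a
    using that by (intro CollectI exI[of _ a] conjI refl)
  have M: "op_sub S (\<lambda>s v. fst s *v v) ?M"
  proof (rule op_subI)
    show "0 \<in> ?M" using MI[OF A(1)] by simp
    show "x - y \<in> ?M" if xy: "x \<in> ?M" "y \<in> ?M" for x y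
    proof -
      obtain a b where "x = fst a *v s" "a \<in> ?A" "y = fst b *v s" "b \<in> ?A"
        using xy by (elim CollectE exE conjE)
      then show ?thesis using MI[OF A(2)[of a b]] by (simp add: matrix_vector_mult_diff_rdistrib)
    qed
    show "fst i *v x \<in> ?M" if ix: "i \<in> S" "x \<in> ?M" for i x
    proof -
      obtain a where "x = fst a *v s" "a \<in> ?A" using ix(2) by (elim CollectE exE conjE)
      then show ?thesis using MI[OF A(5)[OF ix(1), of a]] by (simp add: matrix_vector_mul_assoc)
    qed
  qed
  obtain Q where Q: "op_sub S (\<lambda>s v. fst s *v v) Q" "?M \<inter> Q = {0}"
      "\<forall>x. \<exists>u\<in>?M. \<exists>v\<in>Q. x = u + v"
    by (rule op_semisimple_complement[OF matrix_vector_right_distrib ss1 M])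
  \<comment> \<open>The map \<open>a s + q \<mapsto> a v0\<close> on the cyclic module
    \<open>?M\<close> plus its complement \<open>Q\<close>. The representing \<open>a\<close> is
    chosen arbitrarily; fact \<open>g\<close> shows that the value does not depend on it.\<close>
  define g where "g u = snd (SOME a. a \<in> ?A \<and> u - fst a *v s \<in> Q) *v v0" for u
  have ex: "\<exists>a. a \<in> ?A \<and> u - fst a *v s \<in> Q" for u
  proof -
    obtain m q where mq: "m \<in> ?M" "q \<in> Q" "u = m + q" using spec[OF Q(3), of u] by (elim bexE)
    obtain a where "m = fst a *v s" "a \<in> ?A" using mq(1) by (elim CollectE exE conjE)
    then show ?thesis using mq(2,3) by (intro exI[of _ a]) simp
  qed
  have g: "g u = snd a *v v0" if a: "a \<in> ?A" "u - fst a *v s \<in> Q" for u a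
  proof -
    let ?b = "SOME a. a \<in> ?A \<and> u - fst a *v s \<in> Q"
    have b: "?b \<in> ?A" "u - fst ?b *v s \<in> Q" using someI_ex[OF ex[of u]] by simp_all
    have d: "?b - a \<in> ?A" by (rule A(2)[OF b(1) a(1)])
    have "fst (?b - a) *v s = (u - fst a *v s) - (u - fst ?b *v s)"
      by (simp add: matrix_vector_mult_diff_rdistrib)
    then have "fst (?b - a) *v s \<in> ?M \<inter> Q" using MI[OF d] op_subD(2)[OF Q(1) a(2) b(2)] by simp
    then have "fst (?b - a) *v s = 0" unfolding Q(2) by simp
    from ann[OF d this] have "snd (?b - a) ** snd e = 0" by (simp add: prod_eq_iff)
    then have "snd (?b - a) *v (snd e *v v0) = 0" by (simp only: matrix_vector_mul_assoc) simp
    then have "snd ?b *v v0 = snd a *v v0" by (simp add: v0(3) matrix_vector_mult_diff_rdistrib)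
    then show ?thesis by (simp add: g_def)
  qed
  have gI: "intertwiner g"
    unfolding intertwiner_def
  proof (intro conjI allI ballI)
    fix u v
    obtain a where a: "a \<in> ?A" "u - fst a *v s \<in> Q" using ex[of u] by (elim exE conjE)
    obtain b where b: "b \<in> ?A" "v - fst b *v s \<in> Q" using ex[of v] by (elim exE conjE)
    have eq: "(u + v) - fst (a + b) *v s = (u - fst a *v s) + (v - fst b *v s)"
      by (simp add: matrix_vector_mult_add_rdistrib)
    have "(u + v) - fst (a + b) *v s \<in> Q" unfolding eq by (rule op_subD(4)[OF Q(1) a(2) b(2)])
    from g[OF A(4)[OF a(1) b(1)] this] show "g (u + v) = g u + g v"
      by (simp add: g[OF a] g[OF b] matrix_vector_mult_add_rdistrib)
  next
    fix t u assume t: "t \<in> S"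
    obtain a where a: "a \<in> ?A" "u - fst a *v s \<in> Q" using ex[of u] by (elim exE conjE)
    have eq: "fst t *v u - fst (pair_mult t a) *v s = fst t *v (u - fst a *v s)"
      by (simp add: matrix_vector_mult_diff_distrib matrix_vector_mul_assoc)
    have "fst t *v u - fst (pair_mult t a) *v s \<in> Q" unfolding eq by (rule op_subD(5)[OF Q(1) t a(2)])
    from g[OF A(5)[OF t a(1)] this] show "g (fst t *v u) = snd t *v g u"
      by (simp add: g[OF a] matrix_vector_mul_assoc)
  qed
  have gN: "g u \<in> N" for u
  proof -
    obtain a where a: "a \<in> ?A" "u - fst a *v s \<in> Q" using ex[of u] by (elim exE conjE)
    show ?thesis unfolding g[OF a] by (rule span_stable_snd[OF a(1) N(1) v0(1)])
  qed
  have gs: "g s = v0"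
    using g[OF S_subset_span[OF one_S], of s] op_subD(1)[OF Q(1)] by simp
  let ?h = "\<lambda>u. f u + g u"
  have h: "intertwiner ?h"
    unfolding intertwiner_def
    using intertwinerD(1,4)[OF f] intertwinerD(1,4)[OF gI]
    by (simp add: matrix_vector_right_distrib algebra_simps)
  \<comment> \<open>\<open>f\<close> and \<open>g\<close> take values in submodules that meet only
    in \<open>0\<close>, so no cancellation between them is possible.\<close>
  have sub: "{v. ?h v = 0} \<subseteq> {v. f v = 0}"
  proof
    fix v assume "v \<in> {v. ?h v = 0}"
    then have eq: "f v = - g v" by (simp add: eq_neg_iff_add_eq_0)
    have "f v \<in> N" unfolding eq by (rule op_subD(3)[OF N(1) gN])
    then have "f v \<in> range f \<inter> N" by simp
    then show "v \<in> {v. f v = 0}" unfolding N(2) by simp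
  qed
  moreover have "s \<in> {v. f v = 0}" "s \<notin> {v. ?h v = 0}" using s gs v0(2) by simp_all
  ultimately have "{v. ?h v = 0} \<subset> {v. f v = 0}" unfolding psubset_eq by metis
  moreover have "vec.span {v. ?h v = 0} = {v. ?h v = 0}"
    unfolding vec.span_eq_iff by (rule intertwiner_ker_subspace[OF h])
  moreover have "vec.span {v. f v = 0} = {v. f v = 0}"
    unfolding vec.span_eq_iff by (rule intertwiner_ker_subspace[OF f])
  ultimately have "vec.dim {v. ?h v = 0} < vec.dim {v. f v = 0}"
    by (intro vec.dim_psubset) (simp only:)
  with h show ?thesis by (intro exI[of _ ?h] conjI)
qed

text \<open>An intertwiner whose kernel has least dimension is injective, as otherwise its kernel
  could be shrunk; the zero map starts the minimization. Both spaces have the same dimension, so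
  injective means invertible.\<close>

theorem brauer_nesbitt: "\<exists>P. invertible P \<and> (\<forall>s\<in>S. P ** fst s = snd s ** P)"
proof -
  have "intertwiner (\<lambda>_. 0)" by (simp add: intertwiner_def)
  then obtain f where f: "intertwiner f"
    and min: "\<And>h. intertwiner h \<Longrightarrow> vec.dim {v. f v = 0} \<le> vec.dim {v. h v = 0}"
    using ex_has_least_nat[of intertwiner _ "\<lambda>f. vec.dim {v. f v = 0}"] by auto
  have ker: "v = 0" if v: "f v = 0" for v
  proof (rule ccontr)
    assume "v \<noteq> 0"
    obtain h where "intertwiner h" "vec.dim {v. h v = 0} < vec.dim {v. f v = 0}"
      using intertwiner_smaller_kernel[OF f v \<open>v \<noteq> 0\<close>] by (elim exE conjE)
    then show False using min[of h] by simp
  qed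
  let ?P = "matrix f"
  have P: "?P *v v = f v" for v by (rule matrix_works[OF intertwiner_linear[OF f]])
  have "inj ((*v) ?P)"
  proof (rule injI)
    fix u v assume "?P *v u = ?P *v v"
    then have "f (u - v) = 0" by (simp add: P intertwinerD[OF f])
    then show "u = v" using ker by fastforce
  qed
  then have "invertible ?P" by (simp add: invertible_left_inverse matrix_left_invertible_injective)
  moreover have "?P ** fst s = snd s ** ?P" if "s \<in> S" for s
    unfolding matrix_eq using intertwinerD(4)[OF f that] by (simp add: P flip: matrix_vector_mul_assoc)
  ultimately show ?thesis by (intro exI[of _ ?P] conjI ballI)
qed

end

section \<open>The absolute Galois group\<close>

text \<open>The compositum is generated by bases of \<open>E\<close> and \<open>F\<close>, which are
  finitely many algebraic elements.\<close>

lemma (in field) finite_dimension_compositum: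
  assumes K: "subfield K R" and E: "subfield E R" "finite_dimension K E"
    and F: "subfield F R" "finite_dimension K F"
  shows "\<exists>L. subfield L R \<and> K \<subseteq> L \<and> finite_dimension K L \<and> E \<subseteq> L \<and> F \<subseteq> L"
proof -
  obtain us where us: "set us \<subseteq> carrier R" "Span K us = E"
    using exists_base[OF K finite_dimensionE[OF K E(2)]] by (elim exE conjE)
  obtain vs where vs: "set vs \<subseteq> carrier R" "Span K vs = F"
    using exists_base[OF K finite_dimensionE[OF K F(2)]] by (elim exE conjE)
  have set: "set (us @ vs) \<subseteq> carrier R" using us(1) vs(1) by simp
  have incl: "set us \<subseteq> E" "set vs \<subseteq> F"
    using Span_base_incl[OF K us(1)] Span_base_incl[OF K vs(1)] us(2) vs(2) by simp_all
  have alg: "(algebraic over K) x" if "x \<in> set (us @ vs)" for x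
  proof -
    from that consider "x \<in> set us" | "x \<in> set vs" by auto
    then show ?thesis
    proof cases
      case 1
      then show ?thesis using incl(1)
        by (intro finite_dimension_imp_algebraic[OF K subfieldE(1)[OF E(1)] E(2)]) auto
    next
      case 2
      then show ?thesis using incl(2)
        by (intro finite_dimension_imp_algebraic[OF K subfieldE(1)[OF F(1)] F(2)]) auto
    qed
  qed
  let ?L = "finite_extension K (us @ vs)"
  have fd: "finite_dimension K ?L" by (rule finite_extension_finite_dimension(1)[OF K set alg])
  have mem: "set (us @ vs) \<subseteq> ?L" by (rule finite_extension_mem[OF subfieldE(1)[OF K] set])
  note sub = finite_dimension_imp_subalgebra[OF K fd]
  have "E \<subseteq> ?L" using subalgebra_Span_incl[OF K sub, of us] mem us(2) by simp
  moreover have "F \<subseteq> ?L" using subalgebra_Span_incl[OF K sub, of vs] mem vs(2) by simp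
  ultimately show ?thesis
    using finite_extension_is_subfield[OF K set alg] fd finite_extension_incl[OF subfieldE(3)[OF K] set]
    by (intro exI[of _ ?L] conjI)
qed

lemma subfield_range_to_ac:
  "subfield (range (to_ac :: 'k::field \<Rightarrow> 'k alg_closure)) ring_of_type_algebra"
proof -
  interpret field "ring_of_type_algebra :: 'k alg_closure ring" by (rule field_from_type_algebra)
  have inv: "inv\<^bsub>ring_of_type_algebra\<^esub> to_ac a = to_ac (inverse a)"
    if "a \<noteq> 0" for a :: 'k
    by (rule comm_inv_char) (use that in \<open>simp_all add: ring_of_type_algebra_def flip: to_ac_mult\<close>)
  show ?thesis
  proof (rule subfieldI', rule subringI)
    show "range to_ac \<subseteq> carrier ring_of_type_algebra" by (simp add: ring_of_type_algebra_def)
    show "\<one>\<^bsub>ring_of_type_algebra\<^esub> \<in> range (to_ac :: 'k \<Rightarrow> _)"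
      by (rule range_eqI[of _ _ 1]) (simp add: ring_of_type_algebra_def)
    fix h :: "'k alg_closure" assume "h \<in> range to_ac"
    then obtain a where a: "h = to_ac a" by (elim rangeE)
    have "\<ominus>\<^bsub>ring_of_type_algebra\<^esub> h = to_ac (- a)"
      by (rule minus_equality) (simp_all add: ring_of_type_algebra_def a)
    then show "\<ominus>\<^bsub>ring_of_type_algebra\<^esub> h \<in> range to_ac" by (rule range_eqI)
  next
    fix h g :: "'k alg_closure" assume "h \<in> range to_ac" "g \<in> range to_ac"
    then obtain a b where *: "h = to_ac a" "g = to_ac b" by (elim rangeE)
    show "h \<otimes>\<^bsub>ring_of_type_algebra\<^esub> g \<in> range to_ac"
      by (rule range_eqI[of _ _ "a * b"]) (simp add: ring_of_type_algebra_def *)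
    show "h \<oplus>\<^bsub>ring_of_type_algebra\<^esub> g \<in> range to_ac"
      by (rule range_eqI[of _ _ "a + b"]) (simp add: ring_of_type_algebra_def *)
  next
    fix k :: "'k alg_closure" assume k: "k \<in> range to_ac - {\<zero>\<^bsub>ring_of_type_algebra\<^esub>}"
    then obtain a where a: "k = to_ac a" by auto
    have "a \<noteq> 0" using k by (auto simp: a ring_of_type_algebra_def)
    from inv[OF this] show "inv\<^bsub>ring_of_type_algebra\<^esub> k \<in> range to_ac"
      unfolding a by (rule range_eqI)
  qed
qed

lemma finite_extension_compositum:
  fixes L M :: "'k::field alg_closure set"
  assumes "finite_extension L" "finite_extension M"
  shows "\<exists>N. finite_extension N \<and> L \<subseteq> N \<and> M \<subseteq> N"
proof -
  interpret field "ring_of_type_algebra :: 'k alg_closure ring" by (rule field_from_type_algebra)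
  have "\<exists>N. subfield N ring_of_type_algebra \<and> range to_ac \<subseteq> N \<and>
      ring.finite_dimension ring_of_type_algebra (range to_ac) N \<and> L \<subseteq> N \<and> M \<subseteq> N"
    by (rule finite_dimension_compositum[OF subfield_range_to_ac])
      (use assms in \<open>simp_all add: finite_extension_def\<close>)
  then show ?thesis unfolding finite_extension_def by (elim exE conjE) (intro exI conjI)
qed

section \<open>The Krull topology\<close>

lemma absolute_galois_group_iff:
  "\<sigma> \<in> carrier absolute_galois_group \<longleftrightarrow> bij \<sigma> \<and> (\<forall>x y. \<sigma> (x + y) = \<sigma> x + \<sigma> y) \<and>
    (\<forall>x y. \<sigma> (x * y) = \<sigma> x * \<sigma> y) \<and> (\<forall>a. \<sigma> (to_ac a) = to_ac a)"
  using to_ac_1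
  by (auto simp: absolute_galois_group_def ring_iso_def ring_hom_def ring_of_type_algebra_def)
    (metis to_ac_1)

lemma absolute_galois_group_simps [simp]:
  "\<sigma> \<otimes>\<^bsub>absolute_galois_group\<^esub> \<tau> = \<sigma> \<circ> \<tau>" "\<one>\<^bsub>absolute_galois_group\<^esub> = id"
  by (simp_all add: absolute_galois_group_def)

lemma group_absolute_galois_group:
  "group (absolute_galois_group :: ('k::field alg_closure \<Rightarrow> 'k alg_closure) monoid)"
proof (rule groupI)
  fix \<sigma> :: "'k alg_closure \<Rightarrow> 'k alg_closure" assume s: "\<sigma> \<in> carrier absolute_galois_group"
  let ?t = "inv_into UNIV \<sigma>"
  have b: "bij \<sigma>" and hom: "\<And>x y. \<sigma> (x + y) = \<sigma> x + \<sigma> y" "\<And>x y. \<sigma> (x * y) = \<sigma> x * \<sigma> y"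
    and const: "\<And>a. \<sigma> (to_ac a) = to_ac a" using s by (simp_all add: absolute_galois_group_iff)
  have inv1: "?t (\<sigma> x) = x" for x by (rule inv_f_f[OF bij_is_inj[OF b]])
  have inv2: "\<sigma> (?t x) = x" for x by (rule surj_f_inv_f[OF bij_is_surj[OF b]])
  have "?t (x + y) = ?t x + ?t y" "?t (x * y) = ?t x * ?t y" for x y
    using inv1[of "?t x + ?t y"] inv1[of "?t x * ?t y"] by (simp_all add: hom inv2)
  moreover have "?t (to_ac a) = to_ac a" for a using inv1[of "to_ac a"] by (simp add: const)
  ultimately have "?t \<in> carrier absolute_galois_group"
    using bij_imp_bij_inv[OF b] by (simp add: absolute_galois_group_iff)
  moreover have "?t \<circ> \<sigma> = id" by (simp add: fun_eq_iff inv1)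
  ultimately show "\<exists>\<tau>\<in>carrier absolute_galois_group.
      \<tau> \<otimes>\<^bsub>absolute_galois_group\<^esub> \<sigma> = \<one>\<^bsub>absolute_galois_group\<^esub>"
    by (intro bexI[of _ ?t]) simp_all
qed (simp_all add: absolute_galois_group_iff bij_comp comp_assoc)

lemma galois_subgroup_comp:
  assumes "\<sigma> \<in> galois_subgroup L" "\<tau> \<in> galois_subgroup L"
  shows "\<sigma> \<circ> \<tau> \<in> galois_subgroup L"
  using assms by (simp add: galois_subgroup_def absolute_galois_group_iff bij_comp)

lemma id_galois_subgroup: "id \<in> galois_subgroup L"
  by (simp add: galois_subgroup_def absolute_galois_group_iff)

lemma galois_subgroup_antimono: "L \<subseteq> M \<Longrightarrow> galois_subgroup M \<subseteq> galois_subgroup L"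
  by (auto simp: galois_subgroup_def)

lemma openin_krull_coset:
  "\<sigma> \<in> carrier absolute_galois_group \<Longrightarrow> finite_extension L \<Longrightarrow>
    openin krull_topology ((\<lambda>\<tau>. \<sigma> \<circ> \<tau>) ` galois_subgroup L)"
  unfolding krull_topology_def
  by (rule topology_generated_by_Basis, rule CollectI, rule exI[of _ \<sigma>], rule exI[of _ L])
    (intro conjI refl)

lemma topspace_krull_topology:
  "topspace krull_topology \<subseteq> carrier (absolute_galois_group :: ('k::field alg_closure \<Rightarrow> 'k alg_closure) monoid)"
  unfolding krull_topology_def topology_generated_by_topspace
proof (rule Union_least, elim CollectE exE conjE)
  fix U \<sigma> and L :: "'k alg_closure set"
  assume "U = (\<lambda>\<tau>. \<sigma> \<circ> \<tau>) ` galois_subgroup L" "\<sigma> \<in> carrier absolute_galois_group"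
  then show "U \<subseteq> carrier absolute_galois_group"
    by (auto simp: galois_subgroup_def absolute_galois_group_iff bij_comp)
qed

text \<open>The generating cosets form a basis: composita handle intersections, and a coset can be
  rewritten with any of its elements as representative.\<close>

lemma krull_open_coset:
  fixes U :: "('k::field alg_closure \<Rightarrow> 'k alg_closure) set"
  assumes "openin krull_topology U" "\<sigma> \<in> U"
  shows "\<exists>L. finite_extension L \<and> (\<forall>\<tau>\<in>galois_subgroup L. \<sigma> \<circ> \<tau> \<in> U)"
proof -
  let ?S = "{(\<lambda>\<tau>. \<sigma> \<circ> \<tau>) ` galois_subgroup L | \<sigma> (L :: 'k alg_closure set).
       \<sigma> \<in> carrier absolute_galois_group \<and> finite_extension L}"
  have "generate_topology_on ?S U"
    using assms(1) by (simp only: krull_topology_def openin_topology_generated_by_iff)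
  then show ?thesis using assms(2)
  proof (induction arbitrary: \<sigma>)
    case (Int A B)
    from Int.prems have s: "\<sigma> \<in> A" "\<sigma> \<in> B" by simp_all
    obtain L where L: "finite_extension L" "\<forall>\<tau>\<in>galois_subgroup L. \<sigma> \<circ> \<tau> \<in> A"
      using Int.IH(1)[OF s(1)] by (elim exE conjE)
    obtain M where M: "finite_extension M" "\<forall>\<tau>\<in>galois_subgroup M. \<sigma> \<circ> \<tau> \<in> B"
      using Int.IH(2)[OF s(2)] by (elim exE conjE)
    obtain N where N: "finite_extension N" "L \<subseteq> N" "M \<subseteq> N"
      using finite_extension_compositum[OF L(1) M(1)] by (elim exE conjE)
    have "\<sigma> \<circ> \<tau> \<in> A \<inter> B" if "\<tau> \<in> galois_subgroup N" for \<tau>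
      using galois_subgroup_antimono[OF N(2)] galois_subgroup_antimono[OF N(3)] that L(2) M(2)
      by (simp add: subset_iff)
    with N(1) show ?case by (intro exI[of _ N] conjI ballI)
  next
    case (UN K)
    from UN.prems obtain A where A: "A \<in> K" "\<sigma> \<in> A" by (elim UnionE)
    obtain L where L: "finite_extension L" "\<forall>\<tau>\<in>galois_subgroup L. \<sigma> \<circ> \<tau> \<in> A"
      using UN.IH[OF A] by (elim exE conjE)
    show ?case
      by (intro exI[of _ L] conjI ballI UnionI[OF A(1)]) (rule L(1), rule bspec[OF L(2)])
  next
    case (Basis A)
    then obtain \<rho> L where L: "A = (\<lambda>\<tau>. \<rho> \<circ> \<tau>) ` galois_subgroup L" "finite_extension L"
      by (elim CollectE exE conjE)
    obtain \<tau> where t: "\<sigma> = \<rho> \<circ> \<tau>" "\<tau> \<in> galois_subgroup L"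
      using Basis.prems unfolding L(1) by (elim imageE)
    have "\<sigma> \<circ> \<upsilon> \<in> A" if "\<upsilon> \<in> galois_subgroup L" for \<upsilon>
      unfolding L(1) t(1) comp_assoc using galois_subgroup_comp[OF t(2) that] by (rule imageI)
    with L(2) show ?case by (intro exI[of _ L] conjI ballI)
  qed simp
qed

section \<open>Restriction of semisimple representations to normal subgroups\<close>

text \<open>An operator is indexed by a scalar and a group element, so that a stable subgroup is
  automatically a subspace.\<close>

definition scaled_action :: "('g \<Rightarrow> 'a::field ^'n ^'n) \<Rightarrow> 'a \<times> 'g \<Rightarrow> 'a ^'n \<Rightarrow> 'a ^'n" where
  "scaled_action \<rho> i v = fst i *s (\<rho> (snd i) *v v)"

lemma op_sub_scaled_action:
  assumes one: "e \<in> G" "\<rho> e = mat 1"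
  shows "op_sub (UNIV \<times> G) (scaled_action \<rho>) W \<longleftrightarrow> subrepresentation G \<rho> W"
proof
  assume W: "op_sub (UNIV \<times> G) (scaled_action \<rho>) W"
  note W' = op_subD[OF W]
  have "c *s v \<in> W" if "v \<in> W" for c v
    using W'(5)[of "(c, e)" v] that one by (simp add: scaled_action_def)
  moreover have "\<rho> g *v v \<in> W" if "v \<in> W" "g \<in> G" for g v
    using W'(5)[of "(1, g)" v] that by (simp add: scaled_action_def)
  ultimately show "subrepresentation G \<rho> W"
    using W'(1,4) by (simp add: subrepresentation_def vec.subspace_def)
next
  assume W: "subrepresentation G \<rho> W"
  then have sub: "vec.subspace W" and st: "\<And>g v. g \<in> G \<Longrightarrow> v \<in> W \<Longrightarrow> \<rho> g *v v \<in> W"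
    by (simp_all add: subrepresentation_def)
  show "op_sub (UNIV \<times> G) (scaled_action \<rho>) W"
  proof (rule op_subI)
    show "0 \<in> W" by (rule vec.subspace_0[OF sub])
    show "x - y \<in> W" if "x \<in> W" "y \<in> W" for x y by (rule vec.subspace_diff[OF sub that])
    show "scaled_action \<rho> i x \<in> W" if "i \<in> UNIV \<times> G" "x \<in> W" for i x
      unfolding scaled_action_def
      by (rule vec.subspace_scale[OF sub st]) (use that in auto)
  qed
qed

lemma op_simple_scaled_action:
  assumes one: "e \<in> G" "\<rho> e = mat 1"
  shows "op_simple (UNIV \<times> G) (scaled_action \<rho>) W \<longleftrightarrow> irreducible_subrepresentation G \<rho> W"
  unfolding op_simple_def irreducible_subrepresentation_def op_sub_scaled_action[where e = e and \<rho> = \<rho>, OF one] ..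

lemma op_semisimple_scaled_action:
  assumes one: "e \<in> G" "\<rho> e = mat 1" and ss: "semisimple_representation G \<rho>"
  shows "op_semisimple (UNIV \<times> G) (scaled_action \<rho>)"
  unfolding op_semisimple_def
proof (intro allI impI, elim conjE)
  fix T assume T: "op_sub (UNIV \<times> G) (scaled_action \<rho>) T"
    and simp: "\<forall>W. op_simple (UNIV \<times> G) (scaled_action \<rho>) W \<longrightarrow> W \<subseteq> T"
  obtain m :: nat and W where W: "\<forall>i<m. irreducible_subrepresentation G \<rho> (W i)"
    and dec: "\<forall>v. \<exists>!w. w \<in> (\<Pi>\<^sub>E i\<in>{..<m}. W i) \<and> v = (\<Sum>i<m. w i)"
    using ss unfolding semisimple_representation_def by (elim exE conjE)
  have "v \<in> T" for v
  proof -
    obtain w where w: "w \<in> (\<Pi>\<^sub>E i\<in>{..<m}. W i)" "v = (\<Sum>i<m. w i)"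
      using spec[OF dec, of v] by (elim ex1E conjE)
    have "w i \<in> T" if "i \<in> {..<m}" for i
    proof -
      have "W i \<subseteq> T" using W simp that by (simp add: op_simple_scaled_action[where e = e and \<rho> = \<rho>, OF one])
      moreover have "w i \<in> W i" using w(1) that by (rule PiE_mem)
      ultimately show ?thesis by (rule subsetD)
    qed
    then show ?thesis unfolding w(2) by (intro op_sub_finite_sum[OF T]) simp_all
  qed
  then show "T = UNIV" by auto
qed

text \<open>By finite dimension, a nonzero submodule of least dimension exists, and it is
  simple.\<close>

lemma exists_op_simple:
  assumes one: "e \<in> G" "\<rho> e = mat 1"
    and U: "op_sub (UNIV \<times> G) (scaled_action \<rho>) U" "U \<noteq> {0}"
  shows "\<exists>V. op_simple (UNIV \<times> G) (scaled_action \<rho>) V \<and> V \<subseteq> U"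
proof -
  let ?P = "\<lambda>V. op_sub (UNIV \<times> G) (scaled_action \<rho>) V \<and> V \<noteq> {0} \<and> V \<subseteq> U"
  have "?P U" using U by simp
  then obtain V where V: "?P V" and min: "\<And>V'. ?P V' \<Longrightarrow> vec.dim V \<le> vec.dim V'"
    using ex_has_least_nat[of ?P U vec.dim] by auto
  have span: "vec.span V' = V'" if "op_sub (UNIV \<times> G) (scaled_action \<rho>) V'" for V'
    using that unfolding op_sub_scaled_action[where e = e and \<rho> = \<rho>, OF one]
    by (simp add: subrepresentation_def vec.span_eq_iff)
  have "V' = {0} \<or> V' = V" if V': "op_sub (UNIV \<times> G) (scaled_action \<rho>) V'" "V' \<subseteq> V" for V'
  proof (rule ccontr)
    assume "\<not> (V' = {0} \<or> V' = V)"
    then have ne: "V' \<noteq> {0}" "V' \<subset> V" using V'(2) by auto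
    have "vec.span V' \<subset> vec.span V" unfolding span[OF V'(1)] span[OF conjunct1[OF V]] by (rule ne(2))
    then have "vec.dim V' < vec.dim V" by (rule vec.dim_psubset)
    moreover have "?P V'" using V V' ne(1) by auto
    ultimately show False using min[of V'] by simp
  qed
  with V show ?thesis unfolding op_simple_def by (intro exI[of _ V]) simp
qed

lemma hom_GL_one:
  fixes G (structure) and \<rho> :: "'g \<Rightarrow> 'a::field ^'n ^'n"
  assumes "group G" and \<rho>: "\<rho> \<in> hom G general_linear_group"
  shows "\<rho> \<one> = mat 1"
proof -
  interpret group G by (rule assms(1))
  have "invertible (\<rho> \<one>)"
    using hom_in_carrier[OF \<rho> one_closed] by (simp add: general_linear_group_def)
  then obtain B where B: "B ** \<rho> \<one> = mat 1" by (auto simp: invertible_def)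
  have "\<rho> \<one> ** \<rho> \<one> = \<rho> \<one>"
    using hom_mult[OF \<rho> one_closed one_closed] by (simp add: general_linear_group_def)
  then have "B ** (\<rho> \<one> ** \<rho> \<one>) = mat 1" by (simp only: B)
  then show ?thesis by (simp add: matrix_mul_assoc B)
qed

text \<open>Clifford's theorem for the scaled action: the operator of \<open>(c, g)\<close> is zero
  or injective, and in the latter case it carries the operators from \<open>N\<close> to one another
  through conjugation by \<open>g\<close>.\<close>

lemma op_semisimple_normal_subgroup:
  fixes G (structure) and \<rho> :: "'g \<Rightarrow> 'a::field ^'n ^'n"
  assumes N: "N \<lhd> G" and \<rho>: "\<rho> \<in> hom G general_linear_group"
    and ss: "semisimple_representation (carrier G) \<rho>"
  shows "op_semisimple (UNIV \<times> N) (scaled_action \<rho>)"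
proof -
  interpret normal N G by (rule N)
  have mult: "\<rho> (x \<otimes> y) = \<rho> x ** \<rho> y" if "x \<in> carrier G" "y \<in> carrier G" for x y
    using hom_mult[OF \<rho> that] by (simp add: general_linear_group_def)
  have inv: "invertible (\<rho> x)" if "x \<in> carrier G" for x
    using hom_in_carrier[OF \<rho> that] by (simp add: general_linear_group_def)
  have "\<rho> \<one> = mat 1" by (rule hom_GL_one[OF is_group \<rho>])
  note oneG = one_closed this and oneN = subgroup.one_closed[OF subgroup_axioms] this
  have scale: "scaled_action \<rho> (c, g) (scaled_action \<rho> (d, h) x) = scaled_action \<rho> (c * d, g \<otimes> h) x"
    if "g \<in> carrier G" "h \<in> carrier G" for c d g h x
    by (simp add: scaled_action_def mult that vector_scalar_commute matrix_vector_mul_assoc)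
  show ?thesis
  proof (rule op_semisimple_clifford[OF op_semisimple_scaled_action[where e = \<one> and \<rho> = \<rho>, OF oneG ss]])
    show "UNIV \<times> N \<subseteq> UNIV \<times> carrier G" using subset by auto
    show "scaled_action \<rho> i (x - y) = scaled_action \<rho> i x - scaled_action \<rho> i y" for i x y
      by (simp add: scaled_action_def matrix_vector_mult_diff_distrib vector_ssub_ldistrib)
    show "\<exists>V. op_simple (UNIV \<times> N) (scaled_action \<rho>) V \<and> V \<subseteq> W"
      if W: "op_simple (UNIV \<times> carrier G) (scaled_action \<rho>) W" for W
    proof (rule exists_op_simple[where e = \<one> and \<rho> = \<rho>, OF oneN])
      show "op_sub (UNIV \<times> N) (scaled_action \<rho>) W"
        using op_simpleD(1)[OF W] subset by (auto simp: op_sub_def)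
      show "W \<noteq> {0}" by (rule op_simpleD(2)[OF W])
    qed
    fix i :: "'a \<times> 'g" assume i: "i \<in> UNIV \<times> carrier G"
    obtain c g where ig: "i = (c, g)" "g \<in> carrier G" using i by auto
    show "(\<forall>x. scaled_action \<rho> i x = 0) \<or> (\<forall>x. scaled_action \<rho> i x = 0 \<longrightarrow> x = 0) \<and>
      (\<forall>j\<in>UNIV \<times> N. \<exists>k\<in>UNIV \<times> N. \<forall>x. scaled_action \<rho> i (scaled_action \<rho> j x) =
        scaled_action \<rho> k (scaled_action \<rho> i x)) \<and>
      (\<forall>k\<in>UNIV \<times> N. \<exists>j\<in>UNIV \<times> N. \<forall>x. scaled_action \<rho> i (scaled_action \<rho> j x) =
        scaled_action \<rho> k (scaled_action \<rho> i x))"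
    proof (cases "c = 0")
      case True
      then show ?thesis by (simp add: ig scaled_action_def)
    next
      case False
      have inj: "x = 0" if "scaled_action \<rho> i x = 0" for x
      proof -
        have "\<rho> g *v x = 0" using that False by (simp add: ig scaled_action_def)
        moreover obtain B where "B ** \<rho> g = mat 1" using inv[OF ig(2)] by (auto simp: invertible_def)
        ultimately show ?thesis by (metis matrix_vector_mul_assoc matrix_vector_mul_lid matrix_vector_mult_0_right)
      qed
      have 1: "\<exists>k\<in>UNIV \<times> N. \<forall>x. scaled_action \<rho> i (scaled_action \<rho> j x) =
        scaled_action \<rho> k (scaled_action \<rho> i x)" if j: "j \<in> UNIV \<times> N" for j
      proof -
        obtain d h where jh: "j = (d, h)" "h \<in> N" using j by auto
        have h: "h \<in> carrier G" using jh(2) subset by auto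
        have "(d, g \<otimes> h \<otimes> inv g) \<in> UNIV \<times> N" using inv_op_closed2[OF ig(2) jh(2)] by simp
        moreover have "g \<otimes> h \<otimes> inv g \<otimes> g = g \<otimes> h" using ig(2) h by (simp add: m_assoc)
        then have "scaled_action \<rho> i (scaled_action \<rho> j x) =
            scaled_action \<rho> (d, g \<otimes> h \<otimes> inv g) (scaled_action \<rho> i x)" for x
          using ig(2) h by (simp add: ig(1) jh(1) scale mult.commute)
        ultimately show ?thesis by (intro bexI[of _ "(d, g \<otimes> h \<otimes> inv g)"]) simp_all
      qed
      have 2: "\<exists>j\<in>UNIV \<times> N. \<forall>x. scaled_action \<rho> i (scaled_action \<rho> j x) =
        scaled_action \<rho> k (scaled_action \<rho> i x)" if k: "k \<in> UNIV \<times> N" for k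
      proof -
        obtain d h where kh: "k = (d, h)" "h \<in> N" using k by auto
        have h: "h \<in> carrier G" using kh(2) subset by auto
        have "(d, inv g \<otimes> h \<otimes> g) \<in> UNIV \<times> N" using inv_op_closed1[OF ig(2) kh(2)] by simp
        moreover have "g \<otimes> (inv g \<otimes> h \<otimes> g) = h \<otimes> g" using ig(2) h by (simp flip: m_assoc)
        then have "scaled_action \<rho> i (scaled_action \<rho> (d, inv g \<otimes> h \<otimes> g) x) =
            scaled_action \<rho> k (scaled_action \<rho> i x)" for x
          using ig(2) h by (simp add: ig(1) kh(1) scale mult.commute)
        ultimately show ?thesis by (intro bexI[of _ "(d, inv g \<otimes> h \<otimes> g)"]) simp_all
      qed
      show ?thesis using inj 1 2 by (intro disjI2 conjI ballI allI impI)
    qed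
  qed
qed

section \<open>From representations to pairs of matrices\<close>

lemma op_semisimple_reindex:
  assumes ss: "op_semisimple I act"
    and "\<And>i. i \<in> I \<Longrightarrow> \<exists>j\<in>J. \<forall>x. act i x = act' j x"
    and "\<And>j. j \<in> J \<Longrightarrow> \<exists>i\<in>I. \<forall>x. act i x = act' j x"
  shows "op_semisimple J act'"
proof -
  have "op_sub I act U \<longleftrightarrow> op_sub J act' U" for U
  proof
    assume U: "op_sub I act U"
    show "op_sub J act' U"
    proof (rule op_subI)
      fix j x assume "j \<in> J" "x \<in> U"
      obtain i where "i \<in> I" "\<forall>x. act i x = act' j x" using assms(3)[OF \<open>j \<in> J\<close>] by (elim bexE)
      then show "act' j x \<in> U" using op_subD(5)[OF U, of i x] \<open>x \<in> U\<close> by simp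
    qed (use op_subD[OF U] in simp_all)
  next
    assume U: "op_sub J act' U"
    show "op_sub I act U"
    proof (rule op_subI)
      fix i x assume "i \<in> I" "x \<in> U"
      obtain j where "j \<in> J" "\<forall>x. act i x = act' j x" using assms(2)[OF \<open>i \<in> I\<close>] by (elim bexE)
      then show "act i x \<in> U" using op_subD(5)[OF U, of j x] \<open>x \<in> U\<close> by simp
    qed (use op_subD[OF U] in simp_all)
  qed
  then show ?thesis using ss by (simp add: op_semisimple_def op_simple_def)
qed

lemma mat_mult_vector: "(mat c ** A) *v v = c *s (A *v (v :: 'a::comm_ring_1 ^'n))"
  by (simp add: vec_eq_iff matrix_vector_mult_def mat_mult_entry sum_distrib_left mult.assoc)

text \<open>The Brauer--Nesbitt locale is instantiated with the pairs
  \<open>c (\<rho>\<^sub>1 g, \<rho>\<^sub>2 g)\<close> for \<open>g\<close> in \<open>N\<close> and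
  all scalars \<open>c\<close>. Semisimplicity of both components is inherited from the full
  group.\<close>

theorem isomorphic_of_equal_det:
  fixes G (structure) and \<rho>\<^sub>1 \<rho>\<^sub>2 :: "'g \<Rightarrow> 'a::field ^'n ^'n"
  assumes inf: "infinite (UNIV :: 'a set)" and N: "N \<lhd> G"
    and \<rho>: "\<rho>\<^sub>1 \<in> hom G general_linear_group" "\<rho>\<^sub>2 \<in> hom G general_linear_group"
    and ss: "semisimple_representation (carrier G) \<rho>\<^sub>1" "semisimple_representation (carrier G) \<rho>\<^sub>2"
    and det: "\<And>g x. g \<in> N \<Longrightarrow> det (mat x - \<rho>\<^sub>1 g) = det (mat x - \<rho>\<^sub>2 g)"
  shows "isomorphic_representations N \<rho>\<^sub>1 \<rho>\<^sub>2"
proof -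
  interpret N: normal N G by (rule N)
  define s where "s c g = (mat c ** \<rho>\<^sub>1 g, mat c ** \<rho>\<^sub>2 g)" for c g
  define S where "S = {s c g | c g. g \<in> N}"
  have SI: "s c g \<in> S" if "g \<in> N" for c g
    unfolding S_def using that by (intro CollectI exI[of _ c] exI[of _ g] conjI refl)
  have mult: "\<rho> (x \<otimes> y) = \<rho> x ** \<rho> y" if "\<rho> \<in> hom G general_linear_group" "x \<in> N" "y \<in> N"
    for \<rho> :: "'g \<Rightarrow> 'a ^'n ^'n" and x y
    using hom_mult[OF that(1) subsetD[OF N.subset that(2)] subsetD[OF N.subset that(3)]]
    by (simp add: general_linear_group_def)
  note one = hom_GL_one[OF N.is_group]
  have matmat: "(mat c ** A) ** (mat d ** B) = mat (c * d) ** (A ** B)" for A B :: "'a ^'n ^'n" and c d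
  proof -
    have "(mat c ** A) ** (mat d ** B) = mat c ** (A ** mat d) ** B" by (simp add: matrix_mul_assoc)
    also have "\<dots> = (mat c ** mat d) ** (A ** B)" unfolding mat_commute[of d A, symmetric] by (simp add: matrix_mul_assoc)
    also have "(mat c :: 'a ^'n ^'n) ** mat d = mat (c * d)"
      by (simp add: vec_eq_iff mat_mult_entry) (simp add: mat_def)
    finally show ?thesis .
  qed
  interpret semisimple_matrix_pairs S
  proof unfold_locales
    show "infinite (UNIV :: 'a set)" by (rule inf)
    show "(fst t ** fst u, snd t ** snd u) \<in> S" if tu: "t \<in> S" "u \<in> S" for t u
    proof -
      obtain c g where t: "t = s c g" "g \<in> N" using tu(1) unfolding S_def by (elim CollectE exE conjE)
      obtain d h where u: "u = s d h" "h \<in> N" using tu(2) unfolding S_def by (elim CollectE exE conjE)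
      have "(fst t ** fst u, snd t ** snd u) = s (c * d) (g \<otimes> h)"
        by (simp add: t(1) u(1) s_def matmat mult[OF \<rho>(1) t(2) u(2)] mult[OF \<rho>(2) t(2) u(2)])
      then show ?thesis using SI[OF subgroup.m_closed[OF N.subgroup_axioms t(2) u(2)]] by simp
    qed
    show "(mat c, mat c) \<in> S" for c
      using SI[OF subgroup.one_closed[OF N.subgroup_axioms], of c] by (simp add: s_def one \<rho>)
    show "det (mat 1 - fst t) = det (mat 1 - snd t)" if t': "t \<in> S" for t
    proof -
      obtain c g where t: "t = s c g" "g \<in> N" using t' unfolding S_def by (elim CollectE exE conjE)
      show ?thesis
      proof (cases "c = 0")
        case True
        have "mat 0 ** A = 0" for A :: "'a ^'n ^'n" by (simp add: vec_eq_iff mat_mult_entry)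
        then show ?thesis by (simp add: t(1) s_def True)
      next
        case False
        \<comment> \<open>Moves the comparison from \<open>det (1 - c A)\<close> to
          \<open>det (1 / c - A)\<close>, where the hypothesis on characteristic polynomials
          applies.\<close>
        have "mat 1 - mat c ** A = mat c ** (mat (inverse c) - A)" for A :: "'a ^'n ^'n"
          using False by (simp add: vec_eq_iff mat_mult_entry right_diff_distrib) (simp add: mat_def)
        then show ?thesis by (simp add: t(1) s_def det_mul det[OF t(2)])
      qed
    qed
    have act: "scaled_action \<rho>\<^sub>1 (c, g) x = fst (s c g) *v x" "scaled_action \<rho>\<^sub>2 (c, g) x = snd (s c g) *v x"
      for c g x by (simp_all add: s_def scaled_action_def mat_mult_vector)
    have 1: "\<exists>t\<in>S. \<forall>x. scaled_action \<rho>\<^sub>1 i x = fst t *v x" "\<exists>t\<in>S. \<forall>x. scaled_action \<rho>\<^sub>2 i x = snd t *v x"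
      if i': "i \<in> UNIV \<times> N" for i
    proof -
      obtain c g where i: "i = (c, g)" "g \<in> N" using i' by (elim SigmaE)
      show "\<exists>t\<in>S. \<forall>x. scaled_action \<rho>\<^sub>1 i x = fst t *v x"
        "\<exists>t\<in>S. \<forall>x. scaled_action \<rho>\<^sub>2 i x = snd t *v x"
        unfolding i(1) by (rule bexI[OF _ SI[OF i(2), of c]], simp add: act)+
    qed
    have 2: "\<exists>i\<in>UNIV \<times> N. \<forall>x. scaled_action \<rho>\<^sub>1 i x = fst t *v x"
      "\<exists>i\<in>UNIV \<times> N. \<forall>x. scaled_action \<rho>\<^sub>2 i x = snd t *v x"
      if t': "t \<in> S" for t
    proof -
      obtain c g where t: "t = s c g" "g \<in> N" using t' unfolding S_def by (elim CollectE exE conjE)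
      show "\<exists>i\<in>UNIV \<times> N. \<forall>x. scaled_action \<rho>\<^sub>1 i x = fst t *v x"
        "\<exists>i\<in>UNIV \<times> N. \<forall>x. scaled_action \<rho>\<^sub>2 i x = snd t *v x"
        using t(2) by (intro bexI[of _ "(c, g)"]; simp add: act t(1))+
    qed
    show "op_semisimple S (\<lambda>s v. fst s *v v)"
      by (rule op_semisimple_reindex[OF op_semisimple_normal_subgroup[OF N \<rho>(1) ss(1)] 1(1) 2(1)])
    show "op_semisimple S (\<lambda>s v. snd s *v v)"
      by (rule op_semisimple_reindex[OF op_semisimple_normal_subgroup[OF N \<rho>(2) ss(2)] 1(2) 2(2)])
  qed
  obtain P where P: "invertible P" "\<forall>t\<in>S. P ** fst t = snd t ** P"
    using brauer_nesbitt by (elim exE conjE)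
  have "P ** \<rho>\<^sub>1 g = \<rho>\<^sub>2 g ** P" if "g \<in> N" for g
    using bspec[OF P(2) SI[OF that, of 1]] by (simp add: s_def)
  with P(1) show ?thesis unfolding isomorphic_representations_def by (intro exI[of _ P] conjI ballI)
qed

section \<open>Zariski closures of Galois images\<close>

lemma map_matrix_entry [simp]: "map_matrix f A $ i $ j = f (A $ i $ j)"
  by (simp add: map_matrix_def)

lemma base_change_entry [simp]: "base_change A $ i $ j = to_ac (A $ i $ j)"
  by (simp add: base_change_def)

lemma base_change_mult: "base_change (A ** B) = base_change A ** base_change B"
  by (simp add: vec_eq_iff matrix_matrix_mult_def to_ac_sum)

lemma base_change_mat: "base_change (mat c) = mat (to_ac c)"
  by (simp add: vec_eq_iff mat_def)

lemma base_change_eq_iff: "base_change A = base_change B \<longleftrightarrow> A = B"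
  by (simp add: vec_eq_iff)

lemma invertible_base_change: "invertible A \<Longrightarrow> invertible (base_change A)"
  unfolding invertible_def by (metis base_change_mult base_change_mat to_ac_1)

lemma det_base_change: "det (base_change A) = to_ac (det A)"
  by (simp add: det_def to_ac_sum to_ac_prod)

lemma poly_characteristic_polynomial: "poly (characteristic_polynomial A) x = det (mat x - A)"
proof -
  have "map_matrix (\<lambda>p. poly p x) (mat [:0, 1:] - map_matrix (\<lambda>a. [:a:]) A) = mat x - A"
    by (simp add: vec_eq_iff mat_def)
  then show ?thesis unfolding characteristic_polynomial_def poly_det by simp
qed

lemma equal_charpoly_det:
  assumes "(base_change A, base_change B) \<in> equal_charpoly_locus"
  shows "det (mat x - A) = det (mat x - B)"
proof -
  have *: "det (mat (to_ac x) - base_change C) = to_ac (det (mat x - C))" for C :: "'a ^'b ^'b"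
  proof -
    have "mat (to_ac x) - base_change C = base_change (mat x - C)"
      by (simp add: vec_eq_iff mat_def)
    then show ?thesis by (simp add: det_base_change)
  qed
  have "characteristic_polynomial (base_change A) = characteristic_polynomial (base_change B)"
    using assms by (simp add: equal_charpoly_locus_def)
  then have "det (mat (to_ac x) - base_change A) = det (mat (to_ac x) - base_change B)"
    by (simp flip: poly_characteristic_polynomial)
  then show ?thesis by (simp add: *)
qed

text \<open>The algebraic closure carries no topology here. Since both the coefficients and the
  coordinates of the points \<open>r \<sigma>\<close> come from \<open>'e\<close>, so do the values,
  and continuity is stated for their lifts \<open>F\<close> to \<open>'e\<close>.\<close>

lemma continuous_polynomial_function:
  fixes r :: "'s \<Rightarrow> 'x"
    and coords :: "('x \<Rightarrow> 'e::{field, topological_semigroup_mult, topological_monoid_add} alg_closure) set"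
  assumes f: "f \<in> polynomial_functions coords"
    and coords: "\<And>h. h \<in> coords \<Longrightarrow>
      \<exists>F. continuous_map T euclidean F \<and> (\<forall>\<sigma>\<in>topspace T. h (r \<sigma>) = to_ac (F \<sigma> :: 'e))"
  shows "\<exists>F. continuous_map T euclidean F \<and> (\<forall>\<sigma>\<in>topspace T. f (r \<sigma>) = to_ac (F \<sigma>))"
  using f
proof induction
  case (const c)
  then show ?case by (intro exI[of _ "\<lambda>_. c"]) simp
next
  case (coord h)
  then show ?case by (rule coords)
next
  case (add f g)
  obtain F where F: "continuous_map T euclidean F" "\<forall>\<sigma>\<in>topspace T. f (r \<sigma>) = to_ac (F \<sigma>)"
    using add.IH(1) by (elim exE conjE)
  obtain G where G: "continuous_map T euclidean G" "\<forall>\<sigma>\<in>topspace T. g (r \<sigma>) = to_ac (G \<sigma>)"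
    using add.IH(2) by (elim exE conjE)
  have "continuous_map T (prod_topology euclidean euclidean) (\<lambda>\<sigma>. (F \<sigma>, G \<sigma>))"
    by (rule continuous_map_pairedI[OF F(1) G(1)])
  moreover have "continuous_map (prod_topology euclidean euclidean) euclidean (\<lambda>p. fst p + snd p :: 'e)"
    unfolding prod_topology_euclidean continuous_map_iff_continuous2 by (intro continuous_intros)
  ultimately have "continuous_map T euclidean ((\<lambda>p. fst p + snd p) \<circ> (\<lambda>\<sigma>. (F \<sigma>, G \<sigma>)))"
    by (rule continuous_map_compose)
  then show ?case using F(2) G(2) by (intro exI[of _ "\<lambda>\<sigma>. F \<sigma> + G \<sigma>"]) (simp add: o_def)
next
  case (mult f g)
  obtain F where F: "continuous_map T euclidean F" "\<forall>\<sigma>\<in>topspace T. f (r \<sigma>) = to_ac (F \<sigma>)"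
    using mult.IH(1) by (elim exE conjE)
  obtain G where G: "continuous_map T euclidean G" "\<forall>\<sigma>\<in>topspace T. g (r \<sigma>) = to_ac (G \<sigma>)"
    using mult.IH(2) by (elim exE conjE)
  have "continuous_map T (prod_topology euclidean euclidean) (\<lambda>\<sigma>. (F \<sigma>, G \<sigma>))"
    by (rule continuous_map_pairedI[OF F(1) G(1)])
  moreover have "continuous_map (prod_topology euclidean euclidean) euclidean (\<lambda>p. fst p * snd p :: 'e)"
    unfolding prod_topology_euclidean continuous_map_iff_continuous2
    unfolding continuous_on_def by (intro ballI tendsto_mult tendsto_fst tendsto_snd tendsto_ident_at)
  ultimately have "continuous_map T euclidean ((\<lambda>p. fst p * snd p) \<circ> (\<lambda>\<sigma>. (F \<sigma>, G \<sigma>)))"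
    by (rule continuous_map_compose)
  then show ?case using F(2) G(2) by (intro exI[of _ "\<lambda>\<sigma>. F \<sigma> * G \<sigma>"]) (simp add: o_def)
qed

text \<open>Near a point outside the preimage of \<open>C\<close>, a separating polynomial stays
  nonzero, because its lift to \<open>'e\<close> is continuous and \<open>{0}\<close> is
  closed.\<close>

lemma openin_preimage_zariski:
  fixes r :: "'s \<Rightarrow> 'x"
    and coords :: "('x \<Rightarrow> 'e::{field, t1_space, topological_semigroup_mult, topological_monoid_add} alg_closure) set"
  assumes C: "closedin (zariski_topology coords V) C" and r: "r ` topspace T \<subseteq> V"
    and coords: "\<And>h. h \<in> coords \<Longrightarrow>
      \<exists>F. continuous_map T euclidean F \<and> (\<forall>\<sigma>\<in>topspace T. h (r \<sigma>) = to_ac (F \<sigma> :: 'e))"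
  shows "openin T {\<sigma> \<in> topspace T. r \<sigma> \<notin> C}"
proof (subst openin_subopen, rule ballI)
  fix \<sigma> assume "\<sigma> \<in> {\<sigma> \<in> topspace T. r \<sigma> \<notin> C}"
  then have s: "\<sigma> \<in> topspace T" "r \<sigma> \<notin> C" by simp_all
  have "r \<sigma> \<in> V" using r s(1) by auto
  from zariski_separating_polynomial[OF C this s(2)] obtain f
    where f: "f \<in> polynomial_functions coords" "f (r \<sigma>) \<noteq> 0" "\<forall>y\<in>C. f y = 0"
    by (elim bexE conjE)
  have "\<exists>F. continuous_map T euclidean F \<and> (\<forall>\<sigma>\<in>topspace T. f (r \<sigma>) = to_ac (F \<sigma>))"
    by (rule continuous_polynomial_function[OF f(1)]) (rule coords)
  then obtain F
    where F: "continuous_map T euclidean F" "\<forall>\<sigma>\<in>topspace T. f (r \<sigma>) = to_ac (F \<sigma>)"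
    by (elim exE conjE)
  show "\<exists>U. openin T U \<and> \<sigma> \<in> U \<and> U \<subseteq> {\<sigma> \<in> topspace T. r \<sigma> \<notin> C}"
  proof (intro exI conjI)
    show "openin T {\<tau> \<in> topspace T. F \<tau> \<in> - {0}}"
      by (rule openin_continuous_map_preimage[OF F(1)]) (simp add: open_openin[symmetric] open_Compl)
    show "\<sigma> \<in> {\<tau> \<in> topspace T. F \<tau> \<in> - {0}}" using s(1) f(2) F(2) by simp
    show "{\<tau> \<in> topspace T. F \<tau> \<in> - {0}} \<subseteq> {\<sigma> \<in> topspace T. r \<sigma> \<notin> C}"
    proof
      fix \<tau> assume t: "\<tau> \<in> {\<tau> \<in> topspace T. F \<tau> \<in> - {0}}"
      then have "f (r \<tau>) \<noteq> 0" using F(2) by simp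
      then have "r \<tau> \<notin> C" using f(3) by auto
      with t show "\<tau> \<in> {\<sigma> \<in> topspace T. r \<sigma> \<notin> C}" by simp
    qed
  qed
qed

section \<open>Translations and the preimage of the identity component\<close>

abbreviation matrix_coords :: "('x \<Rightarrow> 'a ^'n ^'n) \<Rightarrow> ('x \<Rightarrow> 'a) set" where
  "matrix_coords p \<equiv> {\<lambda>g. p g $ i $ j | i j. True}"

lemma finite_matrix_coords: "finite (matrix_coords p)"
proof -
  have "matrix_coords p = (\<lambda>(i, j) g. p g $ i $ j) ` UNIV" by auto
  then show ?thesis by simp
qed

lemma polynomial_matrix_product:
  assumes "matrix_coords p \<subseteq> coords"
  shows "(\<lambda>g. (base_change A ** p g ** base_change B) $ i $ j) \<in> polynomial_functions coords"
proof -
  have "(\<lambda>g. p g $ i $ j) \<in> coords" for i j using assms by (rule subsetD) auto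
  then show ?thesis
    unfolding matrix_matrix_mult_def vec_lambda_beta base_change_entry
    by (intro polynomial_functions_sum polynomial_functions.mult finite polynomial_functions.const
        polynomial_functions.coord)
qed

lemma noetherian_zariski_GL_GL: "noetherian_space zariski_GL_GL"
  unfolding zariski_GL_GL_def
  by (intro noetherian_zariski_topology finite_UnI finite_matrix_coords)

lemma topspace_zariski_GL_GL: "topspace zariski_GL_GL = {g. invertible g} \<times> {g. invertible g}"
  by (simp add: zariski_GL_GL_def)

text \<open>The factors have entries in the base field, so the new coordinates are polynomials with
  coefficients there. Two-sided products cover left translations and conjugations at once.\<close>

lemma continuous_map_translation:
  assumes inv: "invertible A" "invertible B" "invertible C" "invertible D"
  shows "continuous_map zariski_GL_GL zariski_GL_GL
    (\<lambda>g. (base_change A ** fst g ** base_change B, base_change C ** snd g ** base_change D))"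
  unfolding zariski_GL_GL_def
proof (rule continuous_map_zariski)
  fix h :: "('a alg_closure ^'b ^'b) \<times> ('a alg_closure ^'b ^'b) \<Rightarrow> 'a alg_closure"
  assume "h \<in> matrix_coords fst \<union> matrix_coords snd"
  then consider i j where "h = (\<lambda>g. fst g $ i $ j)" | i j where "h = (\<lambda>g. snd g $ i $ j)" by auto
  then show "(\<lambda>g. h (base_change A ** fst g ** base_change B, base_change C ** snd g ** base_change D))
      \<in> polynomial_functions (matrix_coords fst \<union> matrix_coords snd)"
    by cases (simp_all only: fst_conv snd_conv, (rule polynomial_matrix_product, simp)+)
next
  fix g :: "('a alg_closure ^'b ^'b) \<times> ('a alg_closure ^'b ^'b)"
  assume "g \<in> {g. invertible g} \<times> {g. invertible g}"
  then show "(base_change A ** fst g ** base_change B, base_change C ** snd g ** base_change D)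
      \<in> {g. invertible g} \<times> {g. invertible g}"
    using inv[THEN invertible_base_change] by (auto intro!: invertible_mult)
qed

lemma galois_representationD:
  assumes "galois_representation \<rho>"
  shows "\<rho> \<in> hom absolute_galois_group general_linear_group"
    "\<sigma> \<in> carrier absolute_galois_group \<Longrightarrow> \<tau> \<in> carrier absolute_galois_group \<Longrightarrow> \<rho> (\<sigma> \<circ> \<tau>) = \<rho> \<sigma> ** \<rho> \<tau>"
    "\<sigma> \<in> carrier absolute_galois_group \<Longrightarrow> invertible (\<rho> \<sigma>)" "\<rho> id = mat 1"
    "continuous_map krull_topology euclidean \<rho>"
proof -
  show hom: "\<rho> \<in> hom absolute_galois_group general_linear_group"
    using assms by (simp add: galois_representation_def)
  show "\<rho> (\<sigma> \<circ> \<tau>) = \<rho> \<sigma> ** \<rho> \<tau>"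
    if "\<sigma> \<in> carrier absolute_galois_group" "\<tau> \<in> carrier absolute_galois_group"
    using hom_mult[OF hom that] by (simp add: general_linear_group_def)
  show "invertible (\<rho> \<sigma>)" if "\<sigma> \<in> carrier absolute_galois_group"
    using hom_in_carrier[OF hom that] by (simp add: general_linear_group_def)
  show "\<rho> id = mat 1" using hom_GL_one[OF group_absolute_galois_group hom] by simp
  show "continuous_map krull_topology euclidean \<rho>"
    using assms by (simp add: galois_representation_def continuous_map_in_subtopology)
qed

lemma finite_extension_base: "finite_extension (range (to_ac :: 'k::field \<Rightarrow> 'k alg_closure))"
proof -
  interpret field "ring_of_type_algebra :: 'k alg_closure ring" by (rule field_from_type_algebra)
  show ?thesis unfolding finite_extension_def
    using subfield_range_to_ac finite_dimensionI[OF dimension_one[OF subfield_range_to_ac]] by simp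
qed

lemma id_in_topspace_krull: "id \<in> topspace krull_topology"
proof -
  have "openin krull_topology ((\<lambda>\<tau>. id \<circ> \<tau>) ` galois_subgroup (range to_ac))"
    by (rule openin_krull_coset[OF _ finite_extension_base]) (simp add: absolute_galois_group_iff)
  then show ?thesis using openin_subset id_galois_subgroup by fastforce
qed

text \<open>Openness comes from closedness of \<open>H - C\<close>: the image lies in
  \<open>H\<close>, so membership in \<open>C\<close> means avoiding that closed set. The set
  \<open>F\<close> contains representatives of all cosets of \<open>N\<close>.\<close>

theorem identity_component_open_normal_subgroup:
  fixes \<rho>\<^sub>1 \<rho>\<^sub>2 :: "('k::field alg_closure \<Rightarrow> 'k alg_closure) \<Rightarrow> 'e::local_field ^'n::finite ^'n"
  assumes rep: "galois_representation \<rho>\<^sub>1" "galois_representation \<rho>\<^sub>2"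
  defines "N \<equiv> {\<sigma> \<in> carrier absolute_galois_group. (base_change (\<rho>\<^sub>1 \<sigma>), base_change (\<rho>\<^sub>2 \<sigma>)) \<in>
    identity_component (joint_monodromy_group (carrier absolute_galois_group) \<rho>\<^sub>1 \<rho>\<^sub>2)}"
  shows "N \<lhd> absolute_galois_group" "\<exists>L. finite_extension L \<and> galois_subgroup L \<subseteq> N"
    "\<exists>F. finite F \<and> F \<subseteq> carrier absolute_galois_group \<and> (\<forall>\<sigma>\<in>carrier absolute_galois_group.
      \<exists>\<tau>\<in>F. inv\<^bsub>absolute_galois_group\<^esub> \<tau> \<otimes>\<^bsub>absolute_galois_group\<^esub> \<sigma> \<in> N)"
proof -
  let ?G = "absolute_galois_group :: ('k alg_closure \<Rightarrow> 'k alg_closure) monoid"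
  let ?T = "zariski_GL_GL :: (('e alg_closure ^'n ^'n) \<times> ('e alg_closure ^'n ^'n)) topology"
  interpret G: group ?G by (rule group_absolute_galois_group)
  note r1 = galois_representationD[OF rep(1)] and r2 = galois_representationD[OF rep(2)]
  define r where "r \<sigma> = (base_change (\<rho>\<^sub>1 \<sigma>), base_change (\<rho>\<^sub>2 \<sigma>))" for \<sigma>
  define H where "H = Abstract_Topology.closure_of ?T (r ` carrier ?G)"
  have Heq: "joint_monodromy_group (carrier ?G) \<rho>\<^sub>1 \<rho>\<^sub>2 = H"
    unfolding joint_monodromy_group_def H_def r_def ..
  have r_one: "r \<one>\<^bsub>?G\<^esub> = (mat 1, mat 1)" by (simp add: r_def r1(4) r2(4) base_change_mat)
  have rV: "r ` carrier ?G \<subseteq> topspace ?T"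
    using r1(3) r2(3) by (auto simp: topspace_zariski_GL_GL r_def intro!: invertible_base_change)
  define l where "l \<sigma> g = (base_change (\<rho>\<^sub>1 \<sigma>) ** fst g ** base_change (mat 1),
    base_change (\<rho>\<^sub>2 \<sigma>) ** snd g ** base_change (mat 1))"
    for \<sigma> and g :: "('e alg_closure ^'n ^'n) \<times> ('e alg_closure ^'n ^'n)"
  define c where "c \<sigma> g = (base_change (\<rho>\<^sub>1 \<sigma>) ** fst g ** base_change (\<rho>\<^sub>1 (inv\<^bsub>?G\<^esub> \<sigma>)),
    base_change (\<rho>\<^sub>2 \<sigma>) ** snd g ** base_change (\<rho>\<^sub>2 (inv\<^bsub>?G\<^esub> \<sigma>)))" for \<sigma> g
  have mult: "\<sigma> \<circ> \<tau> \<in> carrier ?G" if "\<sigma> \<in> carrier ?G" "\<tau> \<in> carrier ?G" for \<sigma> \<tau>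
    using G.m_closed[OF that] by simp
  have l: "continuous_map ?T ?T (l \<sigma>)" if "\<sigma> \<in> carrier ?G" for \<sigma>
    unfolding l_def by (intro continuous_map_translation r1(3) r2(3) that) (simp_all add: invertible_det_nz)
  have lr: "l \<sigma> (r \<tau>) = r (\<sigma> \<otimes>\<^bsub>?G\<^esub> \<tau>)" if "\<sigma> \<in> carrier ?G" "\<tau> \<in> carrier ?G" for \<sigma> \<tau>
    using that by (simp add: l_def r_def r1(2) r2(2) base_change_mult base_change_mat)
  have c: "continuous_map ?T ?T (c \<sigma>)" if "\<sigma> \<in> carrier ?G" for \<sigma>
    unfolding c_def by (intro continuous_map_translation r1(3) r2(3) that G.inv_closed)
  have cr: "c \<sigma> (r \<tau>) = r (\<sigma> \<otimes>\<^bsub>?G\<^esub> \<tau> \<otimes>\<^bsub>?G\<^esub> inv\<^bsub>?G\<^esub> \<sigma>)"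
    if "\<sigma> \<in> carrier ?G" "\<tau> \<in> carrier ?G" for \<sigma> \<tau>
    using that by (simp add: c_def r_def r1(2) r2(2) base_change_mult mult)
  define C where "C = connected_component_of_set (subtopology ?T H) (r \<one>\<^bsub>?G\<^esub>)"
  have N: "N = {\<sigma> \<in> carrier ?G. r \<sigma> \<in> C}"
    unfolding N_def Heq identity_component_def C_def r_one unfolding r_def ..
  note pre = identity_component_preimage[where G = ?G and T = ?T and r = r and l = l and c = c,
      OF G.is_group noetherian_zariski_GL_GL rV, folded H_def, folded C_def, folded N]
  have main: "closedin ?T (H - C)" "N \<lhd> ?G"
    "\<exists>F. finite F \<and> F \<subseteq> carrier ?G \<and> (\<forall>\<sigma>\<in>carrier ?G. \<exists>\<tau>\<in>F. inv\<^bsub>?G\<^esub> \<tau> \<otimes>\<^bsub>?G\<^esub> \<sigma> \<in> N)"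
    by (rule pre; rule l lr c cr; assumption)+
  show "N \<lhd> ?G" by (rule main(2))
  show "\<exists>F. finite F \<and> F \<subseteq> carrier ?G \<and> (\<forall>\<sigma>\<in>carrier ?G. \<exists>\<tau>\<in>F. inv\<^bsub>?G\<^esub> \<tau> \<otimes>\<^bsub>?G\<^esub> \<sigma> \<in> N)"
    by (rule main(3))
  have clC: "closedin ?T (H - C)" by (rule main(1))
  have coord: "\<exists>F. continuous_map krull_topology euclidean F \<and>
      (\<forall>\<sigma>\<in>topspace krull_topology. base_change (\<rho> \<sigma>) $ i $ j = to_ac (F \<sigma>))"
    if "continuous_map krull_topology euclidean \<rho>"
    for \<rho> :: "('k alg_closure \<Rightarrow> 'k alg_closure) \<Rightarrow> 'e ^'n ^'n" and i j
  proof -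
    have "continuous_map euclidean euclidean (\<lambda>A :: 'e ^'n ^'n. A $ i $ j)"
      unfolding continuous_map_iff_continuous2 by (intro continuous_intros)
    from continuous_map_compose[OF that this] show ?thesis
      by (intro exI[of _ "\<lambda>\<sigma>. \<rho> \<sigma> $ i $ j"]) (simp add: o_def)
  qed
  have "openin krull_topology {\<sigma> \<in> topspace krull_topology. r \<sigma> \<notin> H - C}"
  proof (rule openin_preimage_zariski[OF clC[unfolded zariski_GL_GL_def]])
    show "r ` topspace krull_topology \<subseteq> {g. invertible g} \<times> {g. invertible g}"
      using rV topspace_krull_topology unfolding topspace_zariski_GL_GL by auto
    fix h :: "('e alg_closure ^'n ^'n) \<times> ('e alg_closure ^'n ^'n) \<Rightarrow> 'e alg_closure"
    assume "h \<in> matrix_coords fst \<union> matrix_coords snd"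
    then consider i j where "h = (\<lambda>g. fst g $ i $ j)" | i j where "h = (\<lambda>g. snd g $ i $ j)" by auto
    then show "\<exists>F. continuous_map krull_topology euclidean F \<and>
        (\<forall>\<sigma>\<in>topspace krull_topology. h (r \<sigma>) = to_ac (F \<sigma>))"
    proof cases
      case (1 i j)
      then show ?thesis using coord[OF r1(5), of i j] by (simp add: r_def)
    next
      case (2 i j)
      then show ?thesis using coord[OF r2(5), of i j] by (simp add: r_def)
    qed
  qed
  moreover have rH: "r \<sigma> \<in> H" if "\<sigma> \<in> carrier ?G" for \<sigma>
    unfolding H_def using closure_of_subset[OF rV] that by auto
  moreover have "r id \<in> C"
    using rH[OF G.one_closed] rV unfolding C_def H_def
    by (simp add: connected_component_of_refl closure_of_subset_topspace[THEN subsetD])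
  ultimately obtain L where L: "finite_extension L"
    "\<forall>\<tau>\<in>galois_subgroup L. id \<circ> \<tau> \<in> {\<sigma> \<in> topspace krull_topology. r \<sigma> \<notin> H - C}"
    using krull_open_coset[of "{\<sigma> \<in> topspace krull_topology. r \<sigma> \<notin> H - C}" id] id_in_topspace_krull
    by auto
  have "galois_subgroup L \<subseteq> N"
  proof
    fix \<sigma> assume s: "\<sigma> \<in> galois_subgroup L"
    then have G: "\<sigma> \<in> carrier ?G" by (simp add: galois_subgroup_def)
    have "r \<sigma> \<notin> H - C" using bspec[OF L(2) s] by simp
    then show "\<sigma> \<in> N" using rH[OF G] G unfolding N by simp
  qed
  with L(1) show "\<exists>L. finite_extension L \<and> galois_subgroup L \<subseteq> N" by (intro exI conjI)
qed

section \<open>Schur's lemma and the twisting character\<close>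

text \<open>The point is that the characteristic polynomial is not constant. If it were a constant
  \<open>d\<close>, then \<open>det (1 - t M)\<close> would equal \<open>d t ^ n\<close> for all
  nonzero \<open>t\<close>, hence everywhere over an infinite field; but at \<open>0\<close> its
  value is \<open>1\<close>.\<close>

lemma exists_eigenvalue:
  fixes M :: "'a::alg_closed_field ^'n ^'n"
  assumes inf: "infinite (UNIV :: 'a set)"
  shows "\<exists>c. det (mat c - M) = 0"
proof (rule ccontr)
  assume "\<nexists>c. det (mat c - M) = 0"
  then have nz: "det (mat c - M) \<noteq> 0" for c by simp
  let ?p = "characteristic_polynomial M"
  have "Polynomial.degree ?p = 0"
  proof (rule ccontr)
    assume "Polynomial.degree ?p \<noteq> 0"
    then obtain z where "poly ?p z = 0" using alg_closed_imp_poly_has_root[of ?p] by auto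
    then show False using nz by (simp add: poly_characteristic_polynomial)
  qed
  then obtain d where d: "?p = [:d:]" by (elim degree_eq_zeroE)
  have const: "det (mat c - M) = d" for c
    using d poly_characteristic_polynomial[of M c] by simp
  define q where "q = det (mat 1 - mat [:0, 1:] ** map_matrix (\<lambda>a. [:a:]) M)"
  have q: "poly q t = det (mat 1 - mat t ** M)" for t
  proof -
    have "poly ((mat 1 :: 'a poly ^'n ^'n) $ i $ j) t = (mat 1 :: 'a ^'n ^'n) $ i $ j" for i j
      by (simp add: mat_def)
    then have "map_matrix (\<lambda>p. poly p t) (mat 1 - mat [:0, 1:] ** map_matrix (\<lambda>a. [:a:]) M) =
        mat 1 - mat t ** M"
      by (simp add: vec_eq_iff mat_mult_entry)
    then show ?thesis unfolding q_def poly_det by simp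
  qed
  have nonzero: "poly q t = poly (Polynomial.monom d CARD('n)) t" if "t \<noteq> 0" for t
  proof -
    have "mat 1 - mat t ** M = mat t ** (mat (inverse t) - M)"
      using that by (simp add: vec_eq_iff mat_mult_entry right_diff_distrib) (simp add: mat_def)
    moreover have "det (mat t :: 'a ^'n ^'n) = t ^ CARD('n)"
      by (subst det_diagonal) (simp_all add: mat_def)
    ultimately show ?thesis by (simp add: q det_mul const poly_monom)
  qed
  have "- {0} \<subseteq> {t. poly (q - Polynomial.monom d CARD('n)) t = 0}"
    using nonzero by auto
  moreover have "infinite (- {0} :: 'a set)" using inf by (simp add: Compl_eq_Diff_UNIV)
  ultimately have "q - Polynomial.monom d CARD('n) = 0"
    using poly_roots_finite[of "q - Polynomial.monom d CARD('n)"] by (meson finite_subset)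
  then have "poly q 0 = poly (Polynomial.monom d CARD('n)) 0" by simp
  moreover have "poly q 0 = 1"
  proof -
    have "mat 0 ** M = 0" by (simp add: vec_eq_iff mat_mult_entry)
    then show ?thesis by (simp add: q)
  qed
  moreover have "(0 :: 'a) ^ CARD('n) = 0" by (simp add: zero_power)
  ultimately show False by (simp add: poly_monom)
qed

lemma schur:
  fixes \<rho> :: "'g \<Rightarrow> 'a::alg_closed_field ^'n ^'n"
  assumes inf: "infinite (UNIV :: 'a set)"
    and irr: "irreducible_subrepresentation G \<rho> UNIV"
    and comm: "\<And>g. g \<in> G \<Longrightarrow> M ** \<rho> g = \<rho> g ** M"
  shows "\<exists>c. M = mat c"
proof -
  obtain c where c: "det (mat c - M) = 0" using exists_eigenvalue[OF inf, of M] by (elim exE)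
  let ?A = "mat c - M"
  let ?K = "{v. ?A *v v = 0}"
  have comm': "?A ** \<rho> g = \<rho> g ** ?A" if "g \<in> G" for g
    using comm[OF that] mat_commute[of c "\<rho> g"]
    by (simp add: matrix_diff_ldistrib matrix_diff_rdistrib)
  have "subrepresentation G \<rho> ?K"
    unfolding subrepresentation_def
  proof (intro conjI ballI)
    show "vec.subspace ?K"
      by (rule vec.subspaceI) (simp_all add: matrix_vector_right_distrib vector_scalar_commute)
    fix g v assume "g \<in> G" "v \<in> ?K"
    have "?A *v (\<rho> g *v v) = \<rho> g *v (?A *v v)"
      by (simp only: matrix_vector_mul_assoc comm'[OF \<open>g \<in> G\<close>])
    also have "\<dots> = 0" using \<open>v \<in> ?K\<close> by simp
    finally show "\<rho> g *v v \<in> ?K" by simp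
  qed
  then have "?K = {0} \<or> ?K = UNIV"
    using irr unfolding irreducible_subrepresentation_def by simp
  moreover have "?K \<noteq> {0}"
  proof
    assume K: "?K = {0}"
    have "v = 0" if "?A *v v = 0" for v
    proof -
      have "v \<in> ?K" using that by simp
      then show ?thesis unfolding K by simp
    qed
    then have "\<exists>B. B ** ?A = mat 1" unfolding matrix_left_invertible_ker by simp
    then have "invertible ?A" by (simp add: invertible_left_inverse)
    then show False using c by (simp add: invertible_det_nz)
  qed
  ultimately have K: "?K = UNIV" by simp
  have "?A *v v = 0" for v
  proof -
    have "v \<in> ?K" unfolding K by simp
    then show ?thesis by simp
  qed
  then have "?A = 0" by (simp add: matrix_eq)
  then show ?thesis by (intro exI[of _ c]) simp
qed

text \<open>
  The monodromy group is covered by finitely many cosets of the centralizer of \<open>M\<close>. They are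
  Zariski closed and pairwise disjoint, so connectedness leaves only one of them.
\<close>

lemma commutes_of_connected_monodromy:
  fixes \<rho> :: "'g \<Rightarrow> 'e::field ^'n ^'n" and G (structure)
  assumes G: "group G" and \<rho>: "\<rho> \<in> hom G general_linear_group"
    and conn: "connectedin zariski_GL (monodromy_group (carrier G) \<rho>)"
    and F: "finite F" "F \<subseteq> carrier G" "\<And>\<sigma>. \<sigma> \<in> carrier G \<Longrightarrow> \<exists>\<tau>\<in>F. inv \<tau> \<otimes> \<sigma> \<in> N"
    and N: "\<And>\<sigma>. \<sigma> \<in> N \<Longrightarrow> M ** \<rho> \<sigma> = \<rho> \<sigma> ** M"
    and \<sigma>: "\<sigma> \<in> carrier G"
  shows "M ** \<rho> \<sigma> = \<rho> \<sigma> ** M"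
proof -
  interpret group G by (rule G)
  let ?V = "{g :: 'e alg_closure ^'n ^'n. invertible g}" and ?T = zariski_GL
  define b where "b \<sigma> = base_change (\<rho> \<sigma>)" for \<sigma>
  have mult: "\<rho> (\<sigma> \<otimes> \<tau>) = \<rho> \<sigma> ** \<rho> \<tau>" if "\<sigma> \<in> carrier G" "\<tau> \<in> carrier G" for \<sigma> \<tau>
    using hom_mult[OF \<rho> that] by (simp add: general_linear_group_def)
  have one: "\<rho> \<one> = mat 1" by (rule hom_GL_one[OF G \<rho>])
  have b_V: "b \<sigma> \<in> ?V" if "\<sigma> \<in> carrier G" for \<sigma>
    using hom_in_carrier[OF \<rho> that] by (simp add: b_def general_linear_group_def invertible_base_change)
  have topT: "topspace ?T = ?V" by (simp add: zariski_GL_def)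
  \<comment> \<open>For \<open>A = \<rho> (inv \<tau>)\<close> this is the coset of
    \<open>\<rho> \<tau>\<close> modulo the centralizer of \<open>M\<close>. As \<open>M\<close> and
    \<open>A\<close> are defined over the base field, so are the equations.\<close>
  define Z where "Z A = {g \<in> ?V. base_change M ** (base_change A ** g) = (base_change A ** g) ** base_change M}" for A
  have Z: "closedin ?T (Z A)" for A
  proof -
    let ?P = "polynomial_functions (matrix_coords (\<lambda>g :: 'e alg_closure ^'n ^'n. g))"
    define f where "f i j g = (base_change (M ** A) ** g ** base_change (mat 1)) $ i $ j
      + to_ac (-1) * (base_change A ** g ** base_change M) $ i $ j" for i j and g :: "'e alg_closure ^'n ^'n"
    have "f i j \<in> ?P" for i j
      unfolding f_def
      by (intro polynomial_functions.add polynomial_functions.mult polynomial_functions.const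
          polynomial_matrix_product[where p = "\<lambda>g. g"] order_refl)
    then have "closedin ?T {g \<in> ?V. f i j g = 0}" for i j
      unfolding zariski_GL_def by (rule closedin_zariski_zero)
    then have "closedin ?T (\<Inter>(i, j)\<in>UNIV. {g \<in> ?V. f i j g = 0})"
      by (intro closedin_INT) auto
    also have "(\<Inter>(i, j)\<in>UNIV. {g \<in> ?V. f i j g = 0}) = Z A"
      by (auto simp: Z_def f_def vec_eq_iff base_change_mult base_change_mat matrix_mul_assoc)
    finally show ?thesis .
  qed
  define H where "H = Abstract_Topology.closure_of ?T (b ` carrier G)"
  have conn': "connectedin ?T H"
    using conn unfolding H_def b_def monodromy_group_def .
  have bH: "b \<sigma> \<in> H" if "\<sigma> \<in> carrier G" for \<sigma>
  proof -
    have "b ` carrier G \<subseteq> topspace ?T" using b_V unfolding topT by auto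
    then show ?thesis unfolding H_def using closure_of_subset that by blast
  qed
  \<comment> \<open>Representatives whose coset differs from the centralizer. Below,
    \<open>?A\<close> is the centralizer and \<open>?B\<close> the union of these other
    cosets.\<close>
  define F' where "F' = {\<tau> \<in> F. M ** \<rho> (inv \<tau>) \<noteq> \<rho> (inv \<tau>) ** M}"
  let ?A = "Z (mat 1)" and ?B = "\<Union>\<tau>\<in>F'. Z (\<rho> (inv \<tau>))"
  have A_iff: "g \<in> ?A \<longleftrightarrow> g \<in> ?V \<and> base_change M ** g = g ** base_change M" for g
    by (simp add: Z_def base_change_mat)
  \<comment> \<open>When the product \<open>\<rho> (inv \<tau>) g\<close> commutes with
    \<open>M\<close>, one factor commutes with \<open>M\<close> exactly if the other does. So a
    coset that meets the centralizer coincides with it.\<close>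
  have cancel: "M ** \<rho> (inv \<tau>) = \<rho> (inv \<tau>) ** M \<longleftrightarrow> g \<in> ?A"
    if g: "g \<in> Z (\<rho> (inv \<tau>))" and \<tau>: "\<tau> \<in> carrier G" for g \<tau>
  proof -
    let ?m = "base_change M" and ?r = "base_change (\<rho> (inv \<tau>))"
    have g': "g \<in> ?V" "?m ** (?r ** g) = (?r ** g) ** ?m" using g by (simp_all add: Z_def)
    obtain h where h: "g ** h = mat 1" using g'(1) by (auto simp: invertible_def)
    obtain s where s: "s ** ?r = mat 1"
      using b_V[OF inv_closed[OF \<tau>]] by (auto simp: b_def invertible_def)
    show ?thesis
    proof
      assume "M ** \<rho> (inv \<tau>) = \<rho> (inv \<tau>) ** M"
      then have "?m ** ?r = ?r ** ?m" by (simp flip: base_change_mult)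
      then have "?r ** (?m ** g) = ?r ** (g ** ?m)" using g'(2) by (simp add: matrix_mul_assoc)
      then have "s ** (?r ** (?m ** g)) = s ** (?r ** (g ** ?m))" by simp
      then have "?m ** g = g ** ?m" by (simp add: matrix_mul_assoc s)
      then show "g \<in> ?A" using g'(1) by (simp add: A_iff)
    next
      assume "g \<in> ?A"
      then have "?m ** g = g ** ?m" by (simp add: A_iff)
      then have "(?m ** ?r) ** g = (?r ** ?m) ** g" using g'(2) by (simp flip: matrix_mul_assoc)
      then have "((?m ** ?r) ** g) ** h = ((?r ** ?m) ** g) ** h" by simp
      then have "?m ** ?r = ?r ** ?m" by (simp add: h flip: matrix_mul_assoc)
      then show "M ** \<rho> (inv \<tau>) = \<rho> (inv \<tau>) ** M"
        by (simp add: base_change_eq_iff flip: base_change_mult)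
    qed
  qed
  have finF': "finite F'" "F' \<subseteq> carrier G" using F(1,2) by (auto simp: F'_def)
  have clB: "closedin ?T ?B" using finF'(1) Z by (intro closedin_Union) auto
  have cover: "b \<sigma> \<in> ?A \<union> ?B" if \<sigma>: "\<sigma> \<in> carrier G" for \<sigma>
  proof -
    obtain \<tau> where \<tau>: "\<tau> \<in> F" "inv \<tau> \<otimes> \<sigma> \<in> N" using F(3)[OF \<sigma>] by (elim bexE)
    have \<tau>G: "\<tau> \<in> carrier G" using \<tau>(1) F(2) by auto
    have "M ** \<rho> (inv \<tau> \<otimes> \<sigma>) = \<rho> (inv \<tau> \<otimes> \<sigma>) ** M" by (rule N[OF \<tau>(2)])
    then have "M ** (\<rho> (inv \<tau>) ** \<rho> \<sigma>) = (\<rho> (inv \<tau>) ** \<rho> \<sigma>) ** M"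
      by (simp add: mult \<tau>G \<sigma>)
    then have "base_change (M ** (\<rho> (inv \<tau>) ** \<rho> \<sigma>)) = base_change ((\<rho> (inv \<tau>) ** \<rho> \<sigma>) ** M)"
      by simp
    then have bZ: "b \<sigma> \<in> Z (\<rho> (inv \<tau>))" using b_V[OF \<sigma>] by (simp add: Z_def b_def base_change_mult)
    show ?thesis
    proof (cases "\<tau> \<in> F'")
      case True
      then show ?thesis using bZ by auto
    next
      case False
      then have "M ** \<rho> (inv \<tau>) = \<rho> (inv \<tau>) ** M" using \<tau>(1) by (simp add: F'_def)
      then show ?thesis using cancel[OF bZ \<tau>G] by simp
    qed
  qed
  have HAB: "H \<subseteq> ?A \<union> ?B" unfolding H_def
    by (rule closure_of_minimal) (use cover Z clB in auto)
  have disj: "?A \<inter> ?B \<inter> H = {}"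
  proof -
    have False if g: "g \<in> ?A" "\<tau> \<in> F'" "g \<in> Z (\<rho> (inv \<tau>))" for g \<tau>
    proof -
      have "\<tau> \<in> carrier G" using g(2) finF'(2) by auto
      from cancel[OF g(3) this] g(1,2) show False by (simp add: F'_def)
    qed
    then show ?thesis by auto
  qed
  \<comment> \<open>The identity decides which of the two disjoint closed parts of \<open>H\<close>
    is nonempty.\<close>
  have "b \<one> \<in> ?A \<inter> H"
    using bH[OF one_closed] b_V[OF one_closed] by (simp add: A_iff) (simp add: b_def one base_change_mat)
  then have "?A \<inter> H \<noteq> {}" by auto
  then have "?B \<inter> H = {}"
    using conn' Z[of "mat 1"] clB HAB disj unfolding connectedin_closedin by (metis (no_types, lifting))
  then have "b \<sigma> \<notin> ?B" using bH[OF \<sigma>] by (metis IntI empty_iff)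
  moreover have "b \<sigma> \<in> ?A \<union> ?B" by (rule subsetD[OF HAB bH[OF \<sigma>]])
  ultimately have "b \<sigma> \<in> ?A" by (metis UnE)
  then have "base_change M ** base_change (\<rho> \<sigma>) = base_change (\<rho> \<sigma>) ** base_change M"
    by (simp add: A_iff b_def)
  then show ?thesis by (simp add: base_change_eq_iff flip: base_change_mult)
qed

lemma infinite_local_field: "infinite (UNIV :: 'e::local_field set)"
proof
  assume "finite (UNIV :: 'e set)"
  then have "\<not> (0::'e) islimpt UNIV" by (rule islimpt_finite)
  then show False by simp
qed

text \<open>The character is trivial on \<open>N\<close>. Hence all its values occur on the finite
  set \<open>F\<close>, which gives finite order, and it is constant on the open cosets of
  \<open>galois_subgroup L\<close>, which gives continuity.\<close>

theorem finite_order_twist: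
  fixes \<rho>\<^sub>1 \<rho>\<^sub>2 :: "('k::field alg_closure \<Rightarrow> 'k alg_closure) \<Rightarrow> 'e::local_field ^'n::finite ^'n"
  assumes rep: "galois_representation \<rho>\<^sub>1" "galois_representation \<rho>\<^sub>2"
    and N: "N \<lhd> absolute_galois_group" and L: "finite_extension L" "galois_subgroup L \<subseteq> N"
    and F: "finite F" "F \<subseteq> carrier absolute_galois_group"
      "\<And>\<sigma>. \<sigma> \<in> carrier absolute_galois_group \<Longrightarrow>
        \<exists>\<tau>\<in>F. inv\<^bsub>absolute_galois_group\<^esub> \<tau> \<otimes>\<^bsub>absolute_galois_group\<^esub> \<sigma> \<in> N"
    and iso: "isomorphic_representations N \<rho>\<^sub>1 \<rho>\<^sub>2"
    and irr: "absolutely_irreducible (carrier absolute_galois_group) \<rho>\<^sub>1"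
    and conn: "connectedin zariski_GL (monodromy_group (carrier absolute_galois_group) \<rho>\<^sub>1)"
  shows "\<exists>\<psi>. finite_order_character \<psi> \<and>
    isomorphic_representations (carrier absolute_galois_group) \<rho>\<^sub>2 (twist \<rho>\<^sub>1 \<psi>)"
proof -
  let ?G = "absolute_galois_group :: ('k alg_closure \<Rightarrow> 'k alg_closure) monoid"
  interpret normal N ?G by (rule N)
  let ?inv = "\<lambda>\<sigma>. inv\<^bsub>?G\<^esub> \<sigma>"
  note r1 = galois_representationD[OF rep(1)] and r2 = galois_representationD[OF rep(2)]
  have NG: "\<tau> \<in> carrier ?G" if "\<tau> \<in> N" for \<tau> using subset that by auto
  have comp: "\<sigma> \<circ> \<tau> \<in> carrier ?G" if "\<sigma> \<in> carrier ?G" "\<tau> \<in> carrier ?G" for \<sigma> \<tau>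
    using m_closed[OF that] by simp
  have inv_comp: "?inv \<sigma> \<circ> \<sigma> = id" "\<sigma> \<circ> ?inv \<sigma> = id" if "\<sigma> \<in> carrier ?G" for \<sigma>
    using l_inv[OF that] r_inv[OF that] by simp_all
  have r1_inv: "\<rho>\<^sub>1 (?inv \<sigma>) ** \<rho>\<^sub>1 \<sigma> = mat 1" "\<rho>\<^sub>1 \<sigma> ** \<rho>\<^sub>1 (?inv \<sigma>) = mat 1"
    if "\<sigma> \<in> carrier ?G" for \<sigma>
    using that by (simp_all add: inv_comp r1(4) flip: r1(2))
  obtain P where P: "invertible P" "\<forall>\<tau>\<in>N. P ** \<rho>\<^sub>1 \<tau> = \<rho>\<^sub>2 \<tau> ** P"
    using iso unfolding isomorphic_representations_def by (elim exE conjE)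
  obtain Q where Q: "P ** Q = mat 1" "Q ** P = mat 1" using P(1) by (auto simp: invertible_def)
  define M where "M \<sigma> = Q ** \<rho>\<^sub>2 \<sigma> ** P ** \<rho>\<^sub>1 (?inv \<sigma>)" for \<sigma>
  have M: "Q ** \<rho>\<^sub>2 \<sigma> ** P = M \<sigma> ** \<rho>\<^sub>1 \<sigma>" if "\<sigma> \<in> carrier ?G" for \<sigma>
    using r1_inv(1)[OF that] by (simp add: M_def flip: matrix_mul_assoc)
  have PN: "Q ** \<rho>\<^sub>2 \<tau> ** P = \<rho>\<^sub>1 \<tau>" if "\<tau> \<in> N" for \<tau>
  proof -
    have "Q ** \<rho>\<^sub>2 \<tau> ** P = Q ** (P ** \<rho>\<^sub>1 \<tau>)" using bspec[OF P(2) that] by (simp flip: matrix_mul_assoc)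
    also have "\<dots> = \<rho>\<^sub>1 \<tau>" by (simp add: matrix_mul_assoc Q(2))
    finally show ?thesis .
  qed
  have conj2: "Q ** \<rho>\<^sub>2 (\<sigma> \<circ> \<tau>) ** P = (Q ** \<rho>\<^sub>2 \<sigma> ** P) ** (Q ** \<rho>\<^sub>2 \<tau> ** P)"
    if "\<sigma> \<in> carrier ?G" "\<tau> \<in> carrier ?G" for \<sigma> \<tau>
  proof -
    have "(Q ** \<rho>\<^sub>2 \<sigma> ** P) ** (Q ** \<rho>\<^sub>2 \<tau> ** P) = Q ** \<rho>\<^sub>2 \<sigma> ** (P ** Q) ** \<rho>\<^sub>2 \<tau> ** P"
      by (simp only: matrix_mul_assoc)
    then show ?thesis by (simp add: Q(1) r2(2) that matrix_mul_assoc)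
  qed
  have M_N: "M \<sigma> ** \<rho>\<^sub>1 \<tau> = \<rho>\<^sub>1 \<tau> ** M \<sigma>" if \<sigma>: "\<sigma> \<in> carrier ?G" and \<tau>: "\<tau> \<in> N" for \<sigma> \<tau>
  proof -
    \<comment> \<open>Chosen so that \<open>\<sigma> \<tau>' = \<tau> \<sigma>\<close>. On
      \<open>N\<close> the conjugated \<open>\<rho>\<^sub>2\<close> is
      \<open>\<rho>\<^sub>1\<close>, so evaluating it at this element in the two ways yields the
      commutation.\<close>
    define \<tau>' where "\<tau>' = ?inv \<sigma> \<circ> \<tau> \<circ> \<sigma>"
    have \<tau>': "\<tau>' \<in> N" using inv_op_closed1[OF \<sigma> \<tau>] by (simp add: \<tau>'_def)
    have eq: "\<sigma> \<circ> \<tau>' = \<tau> \<circ> \<sigma>" using inv_comp(2)[OF \<sigma>] by (simp add: \<tau>'_def flip: comp_assoc)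
    have "M \<sigma> ** \<rho>\<^sub>1 \<sigma> ** \<rho>\<^sub>1 \<tau>' = Q ** \<rho>\<^sub>2 (\<sigma> \<circ> \<tau>') ** P"
      by (simp add: conj2[OF \<sigma> NG[OF \<tau>']] PN[OF \<tau>'] M[OF \<sigma>])
    also have "\<dots> = \<rho>\<^sub>1 \<tau> ** (M \<sigma> ** \<rho>\<^sub>1 \<sigma>)"
      unfolding eq by (simp add: conj2[OF NG[OF \<tau>] \<sigma>] PN[OF \<tau>] M[OF \<sigma>])
    also have "M \<sigma> ** \<rho>\<^sub>1 \<sigma> ** \<rho>\<^sub>1 \<tau>' = M \<sigma> ** \<rho>\<^sub>1 \<tau> ** \<rho>\<^sub>1 \<sigma>"
      using r1(2)[OF \<sigma> NG[OF \<tau>']] r1(2)[OF NG[OF \<tau>] \<sigma>] by (simp add: eq flip: matrix_mul_assoc)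
    finally have "M \<sigma> ** \<rho>\<^sub>1 \<tau> ** \<rho>\<^sub>1 \<sigma> ** \<rho>\<^sub>1 (?inv \<sigma>) = \<rho>\<^sub>1 \<tau> ** (M \<sigma> ** \<rho>\<^sub>1 \<sigma>) ** \<rho>\<^sub>1 (?inv \<sigma>)" by simp
    then show ?thesis by (simp add: r1_inv(2)[OF \<sigma>] flip: matrix_mul_assoc)
  qed
  have M_G: "M \<sigma> ** \<rho>\<^sub>1 \<tau> = \<rho>\<^sub>1 \<tau> ** M \<sigma>" if "\<sigma> \<in> carrier ?G" "\<tau> \<in> carrier ?G" for \<sigma> \<tau>
    by (rule commutes_of_connected_monodromy[OF is_group r1(1) conn F M_N[OF that(1)] that(2)])
  have inf: "infinite (UNIV :: 'e alg_closure set)"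
    using infinite_local_field inj_to_ac by (meson finite_imageD finite_subset subset_UNIV)
  have "\<exists>c. M \<sigma> = mat c" if \<sigma>: "\<sigma> \<in> carrier ?G" for \<sigma>
  proof -
    \<comment> \<open>Schur's lemma yields a scalar in the algebraic closure; being a diagonal entry
      of \<open>M \<sigma>\<close>, it lies in the base field.\<close>
    have "\<exists>c. base_change (M \<sigma>) = mat c"
      by (rule schur[OF inf irr[unfolded absolutely_irreducible_def]])
        (simp add: M_G[OF \<sigma>] flip: base_change_mult)
    then obtain c where c: "base_change (M \<sigma>) = mat c" by (elim exE)
    have "base_change (M \<sigma>) $ i $ j = (if i = j then c else 0)" for i j
      unfolding c by (simp add: mat_def)
    then have e: "to_ac (M \<sigma> $ i $ j) = (if i = j then c else 0)" for i j by simp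
    obtain i0 :: 'n where True by simp
    have "M \<sigma> = mat (M \<sigma> $ i0 $ i0)"
    proof -
      have "to_ac (M \<sigma> $ i $ j) = to_ac (mat (M \<sigma> $ i0 $ i0) $ i $ j)" for i j
        using e[of i j] e[of i0 i0] by (simp add: mat_def)
      then have "M \<sigma> $ i $ j = mat (M \<sigma> $ i0 $ i0) $ i $ j" for i j
        by (rule injD[OF inj_to_ac])
      then show ?thesis unfolding vec_eq_iff by (intro allI)
    qed
    then show ?thesis by (rule exI)
  qed
  then obtain \<psi> where \<psi>: "\<And>\<sigma>. \<sigma> \<in> carrier ?G \<Longrightarrow> M \<sigma> = mat (\<psi> \<sigma>)" by metis
  have \<psi>M: "Q ** \<rho>\<^sub>2 \<sigma> ** P = mat (\<psi> \<sigma>) ** \<rho>\<^sub>1 \<sigma>" if "\<sigma> \<in> carrier ?G" for \<sigma>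
    using M[OF that] \<psi>[OF that] by simp
  have cancel: "c = d" if "mat c ** \<rho>\<^sub>1 \<sigma> = mat d ** \<rho>\<^sub>1 \<sigma>" "\<sigma> \<in> carrier ?G" for c d \<sigma>
  proof -
    have "mat c ** \<rho>\<^sub>1 \<sigma> ** \<rho>\<^sub>1 (?inv \<sigma>) = mat d ** \<rho>\<^sub>1 \<sigma> ** \<rho>\<^sub>1 (?inv \<sigma>)" using that(1) by simp
    then have "(mat c :: 'e ^'n ^'n) = mat d" by (simp add: r1_inv(2)[OF that(2)] flip: matrix_mul_assoc)
    then have "(mat c :: 'e ^'n ^'n) $ i $ i = mat d $ i $ i" for i by simp
    then show ?thesis by (simp add: mat_def)
  qed
  have \<psi>_mult: "\<psi> (\<sigma> \<circ> \<tau>) = \<psi> \<sigma> * \<psi> \<tau>" if "\<sigma> \<in> carrier ?G" "\<tau> \<in> carrier ?G" for \<sigma> \<tau>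
  proof (rule cancel[OF _ comp[OF that]])
    have "mat (\<psi> (\<sigma> \<circ> \<tau>)) ** \<rho>\<^sub>1 (\<sigma> \<circ> \<tau>) = mat (\<psi> \<sigma>) ** (\<rho>\<^sub>1 \<sigma> ** mat (\<psi> \<tau>)) ** \<rho>\<^sub>1 \<tau>"
      using conj2[OF that] unfolding \<psi>M[OF comp[OF that]] \<psi>M[OF that(1)] \<psi>M[OF that(2)]
      by (simp only: matrix_mul_assoc)
    also have "\<dots> = (mat (\<psi> \<sigma>) ** mat (\<psi> \<tau>)) ** \<rho>\<^sub>1 (\<sigma> \<circ> \<tau>)"
      unfolding mat_commute[of "\<psi> \<tau>" "\<rho>\<^sub>1 \<sigma>", symmetric] r1(2)[OF that] by (simp only: matrix_mul_assoc)
    also have "(mat (\<psi> \<sigma>) :: 'e ^'n ^'n) ** mat (\<psi> \<tau>) = mat (\<psi> \<sigma> * \<psi> \<tau>)"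
      by (simp add: vec_eq_iff mat_mult_entry) (simp add: mat_def)
    finally show "mat (\<psi> (\<sigma> \<circ> \<tau>)) ** \<rho>\<^sub>1 (\<sigma> \<circ> \<tau>) = mat (\<psi> \<sigma> * \<psi> \<tau>) ** \<rho>\<^sub>1 (\<sigma> \<circ> \<tau>)" .
  qed
  have \<psi>_N: "\<psi> \<tau> = 1" if "\<tau> \<in> N" for \<tau>
    by (rule cancel[OF _ NG[OF that]]) (use \<psi>M[OF NG[OF that]] PN[OF that] in simp)
  have id_N: "id \<in> N" using subgroup.one_closed[OF subgroup_axioms] by simp
  have \<psi>_nz: "\<psi> \<sigma> \<noteq> 0" if "\<sigma> \<in> carrier ?G" for \<sigma>
  proof
    assume "\<psi> \<sigma> = 0"
    then have "\<psi> (\<sigma> \<circ> ?inv \<sigma>) = 0" using \<psi>_mult[OF that inv_closed[OF that]] by simp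
    then show False using \<psi>_N[OF id_N] by (simp add: inv_comp(2)[OF that])
  qed
  have \<psi>_F: "\<exists>\<tau>\<in>F. \<psi> \<sigma> = \<psi> \<tau>" if \<sigma>: "\<sigma> \<in> carrier ?G" for \<sigma>
  proof -
    obtain \<tau> where \<tau>: "\<tau> \<in> F" "?inv \<tau> \<otimes>\<^bsub>?G\<^esub> \<sigma> \<in> N" using F(3)[OF \<sigma>] by (elim bexE)
    have \<tau>G: "\<tau> \<in> carrier ?G" using \<tau>(1) F(2) by auto
    have n: "?inv \<tau> \<circ> \<sigma> \<in> N" using \<tau>(2) by simp
    have "\<tau> \<circ> (?inv \<tau> \<circ> \<sigma>) = \<sigma>" using inv_comp(2)[OF \<tau>G] by (simp flip: comp_assoc)
    then have "\<psi> \<sigma> = \<psi> \<tau>" using \<psi>_mult[OF \<tau>G NG[OF n]] \<psi>_N[OF n] by simp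
    with \<tau>(1) show ?thesis by (intro bexI)
  qed
  have pow: "\<exists>\<tau>\<in>carrier ?G. \<psi> \<tau> = \<psi> \<sigma> ^ k" if \<sigma>: "\<sigma> \<in> carrier ?G" for \<sigma> and k :: nat
  proof (induction k)
    case 0
    have "\<psi> id = \<psi> \<sigma> ^ 0" using \<psi>_N[OF id_N] by (simp only: power_0)
    then show ?case by (rule bexI[OF _ NG[OF id_N]])
  next
    case (Suc k)
    then obtain \<tau> where \<tau>: "\<tau> \<in> carrier ?G" "\<psi> \<tau> = \<psi> \<sigma> ^ k" by (elim bexE)
    have "\<psi> (\<sigma> \<circ> \<tau>) = \<psi> \<sigma> ^ Suc k" using \<psi>_mult[OF \<sigma> \<tau>(1)] \<tau>(2) by (simp only: power_Suc)
    then show ?case by (rule bexI[OF _ comp[OF \<sigma> \<tau>(1)]])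
  qed
  have "\<exists>k>0. \<psi> \<sigma> ^ k = 1" if \<sigma>: "\<sigma> \<in> carrier ?G" for \<sigma>
  proof -
    \<comment> \<open>Powers of a value are again values, hence occur on \<open>F\<close>; two of
      them must coincide.\<close>
    have "range (\<lambda>k. \<psi> \<sigma> ^ k) \<subseteq> \<psi> ` F"
    proof
      fix x assume "x \<in> range (\<lambda>k. \<psi> \<sigma> ^ k)"
      then obtain k where "x = \<psi> \<sigma> ^ k" by (elim rangeE)
      moreover obtain \<tau> where \<tau>: "\<tau> \<in> carrier ?G" "\<psi> \<tau> = \<psi> \<sigma> ^ k"
        using pow[OF \<sigma>, of k] by (elim bexE)
      moreover obtain \<upsilon> where "\<upsilon> \<in> F" "\<psi> \<tau> = \<psi> \<upsilon>" using \<psi>_F[OF \<tau>(1)] by (elim bexE)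
      ultimately show "x \<in> \<psi> ` F" by (intro image_eqI[of _ _ \<upsilon>]) simp_all
    qed
    then have "finite (range (\<lambda>k. \<psi> \<sigma> ^ k))" using F(1) by (rule finite_subset[OF _ finite_imageI])
    then have "\<not> inj (\<lambda>k. \<psi> \<sigma> ^ k)" using finite_imageD infinite_UNIV_nat by blast
    then obtain i j where "i \<noteq> j" "\<psi> \<sigma> ^ i = \<psi> \<sigma> ^ j" by (auto simp: inj_def)
    then have "\<exists>i j. i < j \<and> \<psi> \<sigma> ^ i = \<psi> \<sigma> ^ j" by (metis nat_neq_iff)
    then obtain i j where ij: "i < j" "\<psi> \<sigma> ^ i = \<psi> \<sigma> ^ j" by (elim exE conjE)
    have "\<psi> \<sigma> ^ j = \<psi> \<sigma> ^ i * \<psi> \<sigma> ^ (j - i)" using ij(1) by (simp flip: power_add)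
    then have "\<psi> \<sigma> ^ (j - i) = 1" using ij(2) \<psi>_nz[OF \<sigma>] by simp
    then show ?thesis using ij(1) by (intro exI[of _ "j - i"]) simp
  qed
  then obtain k where k: "\<And>\<sigma>. \<sigma> \<in> carrier ?G \<Longrightarrow> k \<sigma> > 0 \<and> \<psi> \<sigma> ^ k \<sigma> = 1" by metis
  \<comment> \<open>Every value is attained on \<open>F\<close>, so the product of exponents over
    \<open>F\<close> works for all elements.\<close>
  define m where "m = (\<Prod>\<tau>\<in>F. k \<tau>)"
  have "m > 0" unfolding m_def by (rule prod_pos) (use k F(2) in auto)
  have order: "\<psi> \<sigma> ^ m = 1" if \<sigma>: "\<sigma> \<in> carrier ?G" for \<sigma>
  proof -
    obtain \<tau> where \<tau>: "\<tau> \<in> F" "\<psi> \<sigma> = \<psi> \<tau>" using \<psi>_F[OF \<sigma>] by (elim bexE)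
    have "k \<tau> dvd m" unfolding m_def using F(1) \<tau>(1) by (rule dvd_prodI)
    then obtain q where q: "m = k \<tau> * q" by (elim dvdE)
    have "\<psi> \<tau> ^ k \<tau> = 1" using k[of \<tau>] \<tau>(1) F(2) by auto
    then show ?thesis by (simp add: \<tau>(2) q power_mult)
  qed
  have "\<psi> \<in> hom ?G (units_of ring_of_type_algebra)"
  proof (rule homI)
    fix \<sigma> \<tau> assume st: "\<sigma> \<in> carrier ?G" "\<tau> \<in> carrier ?G"
    show "\<psi> \<sigma> \<in> carrier (units_of ring_of_type_algebra)"
      using \<psi>_nz[OF st(1)]
      by (auto simp: units_of_def Units_def ring_of_type_algebra_def intro!: exI[of _ "inverse (\<psi> \<sigma>)"])
    show "\<psi> (\<sigma> \<otimes>\<^bsub>?G\<^esub> \<tau>) = \<psi> \<sigma> \<otimes>\<^bsub>units_of ring_of_type_algebra\<^esub> \<psi> \<tau>"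
      using \<psi>_mult[OF st] by (simp add: units_of_def ring_of_type_algebra_def)
  qed
  moreover have "continuous_map krull_topology (top_of_set (- {0})) \<psi>"
    unfolding continuous_map_in_subtopology
  proof
    show "\<psi> \<in> topspace krull_topology \<rightarrow> - {0}"
      using \<psi>_nz topspace_krull_topology by auto
    show "continuous_map krull_topology euclidean \<psi>"
      unfolding continuous_map
    proof (intro conjI allI impI)
      fix U :: "'e set"
      show "openin krull_topology {\<sigma> \<in> topspace krull_topology. \<psi> \<sigma> \<in> U}"
      proof (subst openin_subopen, rule ballI)
        fix \<sigma> assume "\<sigma> \<in> {\<sigma> \<in> topspace krull_topology. \<psi> \<sigma> \<in> U}"
        then have \<sigma>: "\<sigma> \<in> carrier ?G" "\<psi> \<sigma> \<in> U" using topspace_krull_topology by auto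
        let ?C = "(\<lambda>\<tau>. \<sigma> \<circ> \<tau>) ` galois_subgroup L"
        have "openin krull_topology ?C" by (rule openin_krull_coset[OF \<sigma>(1) L(1)])
        moreover have "\<sigma> \<in> ?C" by (rule image_eqI[OF _ id_galois_subgroup]) simp
        moreover have "?C \<subseteq> {\<sigma> \<in> topspace krull_topology. \<psi> \<sigma> \<in> U}"
        proof
          fix \<upsilon> assume u: "\<upsilon> \<in> ?C"
          then obtain \<tau> where \<tau>: "\<upsilon> = \<sigma> \<circ> \<tau>" "\<tau> \<in> galois_subgroup L" by (elim imageE)
          have "\<tau> \<in> N" using \<tau>(2) L(2) by auto
          then have "\<psi> \<upsilon> = \<psi> \<sigma>" using \<psi>_mult[OF \<sigma>(1) NG] \<psi>_N by (simp add: \<tau>(1))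
          moreover have "\<upsilon> \<in> topspace krull_topology"
            using openin_subset[OF \<open>openin krull_topology ?C\<close>] u by (rule subsetD)
          ultimately show "\<upsilon> \<in> {\<sigma> \<in> topspace krull_topology. \<psi> \<sigma> \<in> U}" using \<sigma>(2) by simp
        qed
        ultimately show "\<exists>T. openin krull_topology T \<and> \<sigma> \<in> T \<and>
            T \<subseteq> {\<sigma> \<in> topspace krull_topology. \<psi> \<sigma> \<in> U}" by (intro exI conjI)
      qed
    qed simp
  qed
  ultimately have "finite_order_character \<psi>"
    unfolding finite_order_character_def galois_character_def
    using \<open>m > 0\<close> order by (intro conjI exI[of _ m] ballI)
  moreover have "isomorphic_representations (carrier ?G) \<rho>\<^sub>2 (twist \<rho>\<^sub>1 \<psi>)"
    unfolding isomorphic_representations_def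
  proof (intro exI[of _ Q] conjI ballI)
    show "invertible Q" unfolding invertible_def using Q by (intro exI[of _ P] conjI)
    fix \<sigma> assume \<sigma>: "\<sigma> \<in> carrier ?G"
    have "twist \<rho>\<^sub>1 \<psi> \<sigma> = mat (\<psi> \<sigma>) ** \<rho>\<^sub>1 \<sigma>"
      by (simp add: twist_def vec_eq_iff mat_mult_entry)
    then have "twist \<rho>\<^sub>1 \<psi> \<sigma> ** Q = Q ** \<rho>\<^sub>2 \<sigma> ** P ** Q" using \<psi>M[OF \<sigma>] by simp
    then show "Q ** \<rho>\<^sub>2 \<sigma> = twist \<rho>\<^sub>1 \<psi> \<sigma> ** Q" by (simp add: Q(1) flip: matrix_mul_assoc)
  qed
  ultimately show ?thesis by (intro exI[of _ \<psi>] conjI)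
qed

theorem theorem4p4:
  fixes \<rho>\<^sub>1 \<rho>\<^sub>2 :: "('k::field alg_closure \<Rightarrow> 'k alg_closure) \<Rightarrow> 'e::local_field ^'n::finite ^'n"
  assumes K: "global_function_field TYPE('k)"
    and E: "CHAR('e) > 0"
    and rep: "galois_representation \<rho>\<^sub>1" "galois_representation \<rho>\<^sub>2"
    and semisimple: "semisimple_representation (carrier absolute_galois_group) \<rho>\<^sub>1"
      "semisimple_representation (carrier absolute_galois_group) \<rho>\<^sub>2"
    and H: "identity_component (joint_monodromy_group (carrier absolute_galois_group) \<rho>\<^sub>1 \<rho>\<^sub>2)
      \<subseteq> equal_charpoly_locus"
  shows "(\<exists>L. finite_extension L \<and> isomorphic_representations (galois_subgroup L) \<rho>\<^sub>1 \<rho>\<^sub>2) \<and>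
    (absolutely_irreducible (carrier absolute_galois_group) \<rho>\<^sub>1 \<and>
     connectedin zariski_GL (monodromy_group (carrier absolute_galois_group) \<rho>\<^sub>1) \<longrightarrow>
     (\<exists>\<psi>. finite_order_character \<psi> \<and>
       isomorphic_representations (carrier absolute_galois_group) \<rho>\<^sub>2 (twist \<rho>\<^sub>1 \<psi>)))"
proof -
  let ?G = "absolute_galois_group :: ('k alg_closure \<Rightarrow> 'k alg_closure) monoid"
  define N where "N = {\<sigma> \<in> carrier ?G. (base_change (\<rho>\<^sub>1 \<sigma>), base_change (\<rho>\<^sub>2 \<sigma>)) \<in>
    identity_component (joint_monodromy_group (carrier ?G) \<rho>\<^sub>1 \<rho>\<^sub>2)}"
  note N = identity_component_open_normal_subgroup[OF rep, folded N_def]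
  obtain L where L: "finite_extension L" "galois_subgroup L \<subseteq> N" using N(2) by (elim exE conjE)
  obtain F where F: "finite F" "F \<subseteq> carrier ?G"
    "\<forall>\<sigma>\<in>carrier ?G. \<exists>\<tau>\<in>F. inv\<^bsub>?G\<^esub> \<tau> \<otimes>\<^bsub>?G\<^esub> \<sigma> \<in> N" using N(3) by (elim exE conjE)
  \<comment> \<open>The isomorphism is established on all of \<open>N\<close> before it is
    restricted to \<open>galois_subgroup L\<close>: Clifford's theorem requires normality, which
    \<open>N\<close> has, and the twisting argument conjugates inside \<open>N\<close>.\<close>
  have iso: "isomorphic_representations N \<rho>\<^sub>1 \<rho>\<^sub>2"
  proof (rule isomorphic_of_equal_det[OF infinite_local_field N(1) _ _ semisimple])
    show "\<rho>\<^sub>1 \<in> hom ?G general_linear_group" "\<rho>\<^sub>2 \<in> hom ?G general_linear_group"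
      by (rule galois_representationD(1)[OF rep(1)], rule galois_representationD(1)[OF rep(2)])
    fix \<sigma> x assume "\<sigma> \<in> N"
    then have "(base_change (\<rho>\<^sub>1 \<sigma>), base_change (\<rho>\<^sub>2 \<sigma>)) \<in> equal_charpoly_locus"
      using H by (auto simp: N_def)
    then show "det (mat x - \<rho>\<^sub>1 \<sigma>) = det (mat x - \<rho>\<^sub>2 \<sigma>)" by (rule equal_charpoly_det)
  qed
  then have "isomorphic_representations (galois_subgroup L) \<rho>\<^sub>1 \<rho>\<^sub>2"
    using L(2) unfolding isomorphic_representations_def by (auto simp: subset_iff)
  with L(1) finite_order_twist[OF rep N(1) L F(1,2) bspec[OF F(3)] iso] show ?thesis by auto
qed

end
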